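(* (Pontryagin minimum principle.) Assume that $\alpha\in\mathcal A_{t_*,T}$ is an optimal control for $(t_*,w_* )\in\mathbb G$, and let $x(\cdot)=x(\cdot\,|\,t_*,w_*,\alpha)$. Assume also that $g$ is Fr\'echet differentiable at $(x(T),x_T)$. Define $D(s)=s-\tau(s,x(s))$, $s\in[t_*,T]$, and let $\gamma:[D(t_* ),D(T)]\to[t_*,T]$ be its inverse. Let $p:[t_*,T]\to\mathbb R^n$ solve the adjoint equation $$\begin{aligned}\dot p(s)=&-f_z(s,x(s),x(D(s)),\alpha(s))^\top p(s)-L_z(s,x(s),x(D(s)),\alpha(s))\\&+\tau_z(s,x(s))\bigl[\dot x(D(s))\cdot f_y(s,x(s),x(D(s)),\alpha(s))^\top p(s)\bigr]\\&+\tau_z(s,x(s))\bigl[\dot x(D(s))\cdot L_y(s,x(s),x(D(s)),\alpha(s))\bigr]\\&-\mathbf 1_{[t_*,D(T)]}(s)\,\dot\gamma(s)\,f_y(\gamma(s),x(\gamma(s)),x(s),\alpha(\gamma(s)))^\top p(\gamma(s))\\&-\mathbf 1_{[t_*,D(T)]}(s)\,\dot\gamma(s)\,L_y(\gamma(s),x(\gamma(s)),x(s),\alpha(\gamma(s)))\\&-\mathbf 1_{[T-\bar\tau,T]}(s)\,g_w(x(T),x_T)(s-T),\qquad\text{a.e. }s\in(t_*,T),\end{aligned}$$ with $p(T)=g_z(x(T),x_T)$. Then $$\mathcal H(t,x(t),x(D(t)),p(t),\alpha(t))=\min_{a\in A}\mathcal H(t,x(t),x(D(t)),p(t),a)\qquad\text{for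 a.e. }t\in(t_*,T].$$
   Context: Setting. Let $t_0<T$, $I=[t_0,T]$, $n,m\ge 1$; $A\subset\mathbb R^m$ is nonempty, convex and compact. $\|\cdot\|$ is the Euclidean norm on $\mathbb R^n$; $\|\cdot\|_1,\|\cdot\|_\infty$ are the usual $L^1,L^\infty$ norms for functions on $[-\bar\tau,0]$ (with $\bar\tau$ introduced in (7) below). $\mathbb G:=I\times\operatorname{Lip}([-\bar\tau,0];\mathbb R^n)$. For $t_0\le t<s\le T$, $\mathcal A_{t,s}$ is the set of measurable functions $\alpha:(t,s)\to A$. For $R>0$: $P(R)=\{w\in\operatorname{Lip}([-\bar\tau,0];\mathbb R^n):\|w\|_\infty\le R\}$, $B_R=\{x\in\mathbb R^n:\|x\|\le R\}$. $\mathcal X=\{(z,w):w\in\operatorname{Lip}([-\bar\tau,0];\mathbb R^n),\ z=w(0)\}$ with norm $\|(z,w)\|_{\mathcal X}=\|z\|+\|w\|_1$. Standing assumptions. (1) $f:I\times\mathbb R^n\times\mathbb R^n\times A\to\mathbb R^n$ and $L:I\times\mathbb R^n\times\mathbb R^n\times A\to\mathbb R$ (arguments $(t,z,y,a)$) are continuous. (2) There is $\lambda_f>0$ with $\|f(t,z,y,a)-f(t,z',y',a)\|\le\lambda_f(\|z-z'\|+\|y-y'\|)$ for all arguments, and hence $\|f(t,z,y,a)\|\le C_f(1+\|z\|+\|y\|)$ for some $C_f>0$. (3) For every $(t,z,y)$ the set $\{(f(t,z,y,a),\ell)\in\mathbb R^n\times\mathbb R:a\in A,\ \ell\ge L(t,z,y,a)\}$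 is convex. (4) For every $R>0$ there is $\lambda_L(R)>0$ with $|L(t,z,y,a)-L(t,z',y',a)|\le\lambda_L(R)(\|z-z'\|+\|y-y'\|)$ for $t\in I$, $a\in A$, $z,y,z',y'\in B_R$. (5) There is $C_L>0$ with $|L(t,z,y,a)|\le C_L(1+\|z\|+\|y\|)$ for all arguments. (6) $g:\mathcal X\to\mathbb R$ and for every $R>0$ there is $\lambda_g(R)>0$ with $|g(z_1,w_1)-g(z_2,w_2)|\le\lambda_g(R)\|(z_1,w_1)-(z_2,w_2)\|_{\mathcal X}$ for all $(z_i,w_i)\in\mathcal X$ with $w_i\in P(R)$. (7) $\tau:I\times\mathbb R^n\to[0,\infty)$ is $C^1$ with supremum $\bar\tau<\infty$, and there is $\lambda_\tau>0$ with $|\tau(t,z)-\tau(t,y)|\le\lambda_\tau\|z-y\|$ for all $t\in I$, $z,y\in\mathbb R^n$. State equation. For $(t,w)\in\mathbb G$ and $\alpha\in\mathcal A_{t,T}$, $x(\cdot\,|\,t,w,\alpha)$ denotes the unique Lipschitz $x:[t-\bar\tau,T]\to\mathbb R^n$ with $\dot x(s)=f(s,x(s),x(s-\tau(s,x(s))),\alpha(s))$ for a.e. $s\in(t,T)$ and $x(t+\theta)=w(\theta)$ for $\theta\in[-\bar\tau,0]$ (it exists and is unique under (1)-(7)). Write $x_s(\theta)=x(s+\theta)$, $\theta\in[-\bar\tau,0]$. (8) (Monotone delay) For every $r>0$ there is $d(r)>0$ such that for every such solution with $t\in I$, $w\in P(r)$, $\alpha\in\mathcal A_{t,T}$: $1-\tau_t(s,x(s))-\tau_z(s,x(s))\cdot\dot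 x(s)\ge d(r)$ for a.e. $s\in[t,T]$. (So $s\mapsto s-\tau(s,x(s))$ is strictly increasing and invertible onto its image.) (9) In addition, $f$ and $L$ are $C^1$ in $(z,y)$ uniformly with respect to $(t,a)$. $f_z,f_y$ are the Jacobian matrices of $f$ in $z$ and $y$; $L_z,L_y,\tau_z$ are gradients; vectors are column vectors. Cost and value. $J(t,w,\alpha)=\int_t^TL(s,x(s),x(s-\tau(s,x(s))),\alpha(s))\,ds+g(x(T),x_T)$ with $x=x(\cdot\,|\,t,w,\alpha)$, $\rho(t,w)=\inf_{\alpha\in\mathcal A_{t,T}}J(t,w,\alpha)$; $\alpha$ is an optimal control for $(t,w)$ if $J(t,w,\alpha)=\rho(t,w)$. Pre-Hamiltonian. $\mathcal H(t,z,y,p,a)=f(t,z,y,a)\cdot p+L(t,z,y,a)$. Fr\'echet differentiability of $g$ at $(z,w)\in\mathcal X$: there exist $g_z(z,w)\in\mathbb R^n$ and $g_w(z,w)\in L^\infty([-\bar\tau,0];\mathbb R^n)$ with $g(z+\delta z,w+\delta w)-g(z,w)=g_z(z,w)\cdot\delta z+\int_{-\bar\tau}^0g_w(z,w)(\theta)\cdot\delta w(\theta)\,d\theta+o(\|(\delta z,\delta w)\|_{\mathcal X})$ for all $(\delta z,\delta w)\in\mathcal X$. Solutions of the adjoint equation are understood as Lipschitz functions satisfying the equation a.e. (terms carrying an indicator are $0$ where the indicator vanishes, and $[t_*,D(T)]=\emptyset$ if $D(T)<t_*$). *)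

theory Defs
  imports "HOL-Analysis.Analysis"
begin

(* A function on a bounded interval J is modelled by a total function of which only the values on J
   matter.  In the definitions, b is the maximal delay; "measurable" means Lebesgue
   measurable. *)

definition Lip :: "real \<Rightarrow> (real \<Rightarrow> real^'n) set" where
  "Lip b = {w. \<exists>C. C-lipschitz_on {-b..0} w}"

(* Elements of Lip b are continuous, so the sup norm is taken pointwise. *)
definition Lip_ball :: "real \<Rightarrow> real \<Rightarrow> (real \<Rightarrow> real^'n) set" where
  "Lip_ball b R = {w \<in> Lip b. \<forall>\<theta>\<in>{-b..0}. norm (w \<theta>) \<le> R}"

definition state_space :: "real \<Rightarrow> ((real^'n) \<times> (real \<Rightarrow> real^'n)) set" where
  "state_space b = {(z, w). w \<in> Lip b \<and> z = w 0}"

definition state_norm :: "real \<Rightarrow> real^'n \<Rightarrow> (real \<Rightarrow> real^'n) \<Rightarrow> real" where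
  "state_norm b z w = norm z + (LINT \<theta>|lebesgue_on {-b..0}. norm (w \<theta>))"

definition segment :: "(real \<Rightarrow> real^'n) \<Rightarrow> real \<Rightarrow> real \<Rightarrow> real^'n" where
  "segment x s = (\<lambda>\<theta>. x (s + \<theta>))"

definition controls :: "(real^'m) set \<Rightarrow> real \<Rightarrow> real \<Rightarrow> (real \<Rightarrow> real^'m) set" where
  "controls A t s =
     {\<alpha> \<in> borel_measurable (lebesgue_on {t<..<s}). \<forall>r\<in>{t<..<s}. \<alpha> r \<in> A}"

definition is_solution ::
  "real \<Rightarrow> (real \<Rightarrow> real^'n \<Rightarrow> real^'n \<Rightarrow> real^'m \<Rightarrow> real^'n) \<Rightarrow> (real \<Rightarrow> real^'n \<Rightarrow> real) \<Rightarrow> real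
   \<Rightarrow> real \<Rightarrow> (real \<Rightarrow> real^'n) \<Rightarrow> (real \<Rightarrow> real^'m) \<Rightarrow> (real \<Rightarrow> real^'n) \<Rightarrow> bool" where
  "is_solution T f \<tau> b t w \<alpha> x \<longleftrightarrow>
     (\<exists>C. C-lipschitz_on {t - b..T} x) \<and>
     (AE s in lebesgue_on {t<..<T}.
        (x has_vector_derivative f s (x s) (x (s - \<tau> s (x s))) (\<alpha> s)) (at s)) \<and>
     (\<forall>\<theta>\<in>{-b..0}. x (t + \<theta>) = w \<theta>)"

(* Solutions are unique on {t - b..T}; extensional fixes the irrelevant values elsewhere. *)
definition trajectory ::
  "real \<Rightarrow> (real \<Rightarrow> real^'n \<Rightarrow> real^'n \<Rightarrow> real^'m \<Rightarrow> real^'n) \<Rightarrow> (real \<Rightarrow> real^'n \<Rightarrow> real) \<Rightarrow> real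
   \<Rightarrow> real \<Rightarrow> (real \<Rightarrow> real^'n) \<Rightarrow> (real \<Rightarrow> real^'m) \<Rightarrow> real \<Rightarrow> real^'n" where
  "trajectory T f \<tau> b t w \<alpha> =
     (THE x. x \<in> extensional {t - b..T} \<and> is_solution T f \<tau> b t w \<alpha> x)"

definition cost ::
  "real \<Rightarrow> (real \<Rightarrow> real^'n \<Rightarrow> real^'n \<Rightarrow> real^'m \<Rightarrow> real^'n)
   \<Rightarrow> (real \<Rightarrow> real^'n \<Rightarrow> real^'n \<Rightarrow> real^'m \<Rightarrow> real) \<Rightarrow> ((real^'n) \<times> (real \<Rightarrow> real^'n) \<Rightarrow> real)
   \<Rightarrow> (real \<Rightarrow> real^'n \<Rightarrow> real) \<Rightarrow> real
   \<Rightarrow> real \<Rightarrow> (real \<Rightarrow> real^'n) \<Rightarrow> (real \<Rightarrow> real^'m) \<Rightarrow> real" where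
  "cost T f L g \<tau> b t w \<alpha> =
     (let x = trajectory T f \<tau> b t w \<alpha>
      in (LINT s|lebesgue_on {t..T}. L s (x s) (x (s - \<tau> s (x s))) (\<alpha> s))
         + g (x T, segment x T))"

definition value_function ::
  "real \<Rightarrow> (real^'m) set \<Rightarrow> (real \<Rightarrow> real^'n \<Rightarrow> real^'n \<Rightarrow> real^'m \<Rightarrow> real^'n)
   \<Rightarrow> (real \<Rightarrow> real^'n \<Rightarrow> real^'n \<Rightarrow> real^'m \<Rightarrow> real) \<Rightarrow> ((real^'n) \<times> (real \<Rightarrow> real^'n) \<Rightarrow> real)
   \<Rightarrow> (real \<Rightarrow> real^'n \<Rightarrow> real) \<Rightarrow> real
   \<Rightarrow> real \<Rightarrow> (real \<Rightarrow> real^'n) \<Rightarrow> real" where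
  "value_function T A f L g \<tau> b t w = (INF \<alpha>\<in>controls A t T. cost T f L g \<tau> b t w \<alpha>)"

definition optimal_control ::
  "real \<Rightarrow> (real^'m) set \<Rightarrow> (real \<Rightarrow> real^'n \<Rightarrow> real^'n \<Rightarrow> real^'m \<Rightarrow> real^'n)
   \<Rightarrow> (real \<Rightarrow> real^'n \<Rightarrow> real^'n \<Rightarrow> real^'m \<Rightarrow> real) \<Rightarrow> ((real^'n) \<times> (real \<Rightarrow> real^'n) \<Rightarrow> real)
   \<Rightarrow> (real \<Rightarrow> real^'n \<Rightarrow> real) \<Rightarrow> real
   \<Rightarrow> real \<Rightarrow> (real \<Rightarrow> real^'n) \<Rightarrow> (real \<Rightarrow> real^'m) \<Rightarrow> bool" where
  "optimal_control T A f L g \<tau> b t w \<alpha> \<longleftrightarrow>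
     \<alpha> \<in> controls A t T \<and> cost T f L g \<tau> b t w \<alpha> = value_function T A f L g \<tau> b t w"

definition pre_hamiltonian ::
  "(real \<Rightarrow> real^'n \<Rightarrow> real^'n \<Rightarrow> real^'m \<Rightarrow> real^'n)
   \<Rightarrow> (real \<Rightarrow> real^'n \<Rightarrow> real^'n \<Rightarrow> real^'m \<Rightarrow> real)
   \<Rightarrow> real \<Rightarrow> real^'n \<Rightarrow> real^'n \<Rightarrow> real^'n \<Rightarrow> real^'m \<Rightarrow> real" where
  "pre_hamiltonian f L t z y p a = f t z y a \<bullet> p + L t z y a"

(* g is Frechet differentiable at (z, w) with derivative (gz, gw), gw in L^infinity; only increments
   in the state space are considered, and their size is measured in the weaker state_norm. *)
definition has_state_derivative ::
  "((real^'n) \<times> (real \<Rightarrow> real^'n) \<Rightarrow> real) \<Rightarrow> real^'n \<Rightarrow> (real \<Rightarrow> real^'n) \<Rightarrow> real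
   \<Rightarrow> real^'n \<Rightarrow> (real \<Rightarrow> real^'n) \<Rightarrow> bool" where
  "has_state_derivative g gz gw b z w \<longleftrightarrow>
     (z, w) \<in> state_space b \<and>
     gw \<in> borel_measurable (lebesgue_on {-b..0}) \<and>
     (\<exists>M. AE \<theta> in lebesgue_on {-b..0}. norm (gw \<theta>) \<le> M) \<and>
     (\<forall>\<epsilon>>0. \<exists>\<delta>>0. \<forall>(dz, dw)\<in>state_space b. state_norm b dz dw < \<delta> \<longrightarrow>
        \<bar>g (z + dz, \<lambda>\<theta>. w \<theta> + dw \<theta>) - g (z, w)
          - (gz \<bullet> dz + (LINT \<theta>|lebesgue_on {-b..0}. gw \<theta> \<bullet> dw \<theta>))\<bar>
        \<le> \<epsilon> * state_norm b dz dw)"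

(* The derivatives are parameters of the locale; they are uniquely determined by the assumptions
   (on {t0..T}, respectively A).  Linear growth of f follows from f_cont, f_lip and compactness of A.
   That f and L are C^1 in (z, y) uniformly in (t, a) means that the partial derivatives are
   continuous in (z, y) uniformly in (t, a). *)
locale delay_control_problem =
  fixes t0 T :: real
    and A :: "(real^'m) set"
    and f :: "real \<Rightarrow> real^'n \<Rightarrow> real^'n \<Rightarrow> real^'m \<Rightarrow> real^'n"
    and L :: "real \<Rightarrow> real^'n \<Rightarrow> real^'n \<Rightarrow> real^'m \<Rightarrow> real"
    and g :: "(real^'n) \<times> (real \<Rightarrow> real^'n) \<Rightarrow> real"
    and \<tau> :: "real \<Rightarrow> real^'n \<Rightarrow> real"
    and \<tau>b :: real
    and f\<^sub>z f\<^sub>y :: "real \<Rightarrow> real^'n \<Rightarrow> real^'n \<Rightarrow> real^'m \<Rightarrow> real^'n^'n"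
    and L\<^sub>z L\<^sub>y :: "real \<Rightarrow> real^'n \<Rightarrow> real^'n \<Rightarrow> real^'m \<Rightarrow> real^'n"
    and \<tau>\<^sub>t :: "real \<Rightarrow> real^'n \<Rightarrow> real"
    and \<tau>\<^sub>z :: "real \<Rightarrow> real^'n \<Rightarrow> real^'n"
  assumes t0_less_T: "t0 < T"
    and A_nonempty: "A \<noteq> {}"
    and A_convex: "convex A"
    and A_compact: "compact A"
    and f_cont: "continuous_on ({t0..T} \<times> UNIV \<times> UNIV \<times> A) (\<lambda>(t, z, y, a). f t z y a)"
    and L_cont: "continuous_on ({t0..T} \<times> UNIV \<times> UNIV \<times> A) (\<lambda>(t, z, y, a). L t z y a)"
    and f_lip: "\<exists>l>0. \<forall>t\<in>{t0..T}. \<forall>a\<in>A. \<forall>z y z' y'.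
          norm (f t z y a - f t z' y' a) \<le> l * (norm (z - z') + norm (y - y'))"
    and epi_convex: "\<forall>t\<in>{t0..T}. \<forall>z y. convex {(f t z y a, l) | a l. a \<in> A \<and> l \<ge> L t z y a}"
    and L_lip: "\<forall>R>0. \<exists>l>0. \<forall>t\<in>{t0..T}. \<forall>a\<in>A.
          \<forall>z\<in>cball 0 R. \<forall>y\<in>cball 0 R. \<forall>z'\<in>cball 0 R. \<forall>y'\<in>cball 0 R.
          \<bar>L t z y a - L t z' y' a\<bar> \<le> l * (norm (z - z') + norm (y - y'))"
    and L_growth: "\<exists>C>0. \<forall>t\<in>{t0..T}. \<forall>a\<in>A. \<forall>z y. \<bar>L t z y a\<bar> \<le> C * (1 + norm z + norm y)"
    and g_lip: "\<forall>R>0. \<exists>l>0. \<forall>(z1, w1)\<in>state_space \<tau>b. \<forall>(z2, w2)\<in>state_space \<tau>b.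
          w1 \<in> Lip_ball \<tau>b R \<longrightarrow> w2 \<in> Lip_ball \<tau>b R \<longrightarrow>
          \<bar>g (z1, w1) - g (z2, w2)\<bar> \<le> l * state_norm \<tau>b (z1 - z2) (\<lambda>\<theta>. w1 \<theta> - w2 \<theta>)"
    and \<tau>_nonneg: "\<forall>t\<in>{t0..T}. \<forall>z. \<tau> t z \<ge> 0"
    and \<tau>_bdd: "bdd_above ((\<lambda>(t, z). \<tau> t z) ` ({t0..T} \<times> UNIV))"
    and \<tau>b_eq: "\<tau>b = (SUP (t, z)\<in>{t0..T} \<times> UNIV. \<tau> t z)"
    and \<tau>_deriv: "\<forall>t\<in>{t0..T}. \<forall>z.
          ((\<lambda>(t, z). \<tau> t z) has_derivative (\<lambda>(h, k). \<tau>\<^sub>t t z * h + \<tau>\<^sub>z t z \<bullet> k))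
            (at (t, z) within {t0..T} \<times> UNIV)"
    and \<tau>\<^sub>t_cont: "continuous_on ({t0..T} \<times> UNIV) (\<lambda>(t, z). \<tau>\<^sub>t t z)"
    and \<tau>\<^sub>z_cont: "continuous_on ({t0..T} \<times> UNIV) (\<lambda>(t, z). \<tau>\<^sub>z t z)"
    and \<tau>_lip: "\<exists>l>0. \<forall>t\<in>{t0..T}. \<forall>z y. \<bar>\<tau> t z - \<tau> t y\<bar> \<le> l * norm (z - y)"
    and monotone_delay: "\<forall>r>0. \<exists>d>0. \<forall>t\<in>{t0..T}. \<forall>w\<in>Lip_ball \<tau>b r. \<forall>\<alpha>\<in>controls A t T. \<forall>x.
          is_solution T f \<tau> \<tau>b t w \<alpha> x \<longrightarrow>
          (AE s in lebesgue_on {t..T}.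
             1 - \<tau>\<^sub>t s (x s) - \<tau>\<^sub>z s (x s) \<bullet> vector_derivative x (at s) \<ge> d)"
    and f_deriv: "\<forall>t\<in>{t0..T}. \<forall>a\<in>A. \<forall>z y.
          ((\<lambda>(z, y). f t z y a) has_derivative (\<lambda>(h, k). f\<^sub>z t z y a *v h + f\<^sub>y t z y a *v k))
            (at (z, y))"
    and f\<^sub>z_unif: "\<forall>z y. uniform_limit ({t0..T} \<times> A)
          (\<lambda>(z', y') (t, a). f\<^sub>z t z' y' a) (\<lambda>(t, a). f\<^sub>z t z y a) (at (z, y))"
    and f\<^sub>y_unif: "\<forall>z y. uniform_limit ({t0..T} \<times> A)
          (\<lambda>(z', y') (t, a). f\<^sub>y t z' y' a) (\<lambda>(t, a). f\<^sub>y t z y a) (at (z, y))"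
    and L_deriv: "\<forall>t\<in>{t0..T}. \<forall>a\<in>A. \<forall>z y.
          ((\<lambda>(z, y). L t z y a) has_derivative (\<lambda>(h, k). L\<^sub>z t z y a \<bullet> h + L\<^sub>y t z y a \<bullet> k))
            (at (z, y))"
    and L\<^sub>z_unif: "\<forall>z y. uniform_limit ({t0..T} \<times> A)
          (\<lambda>(z', y') (t, a). L\<^sub>z t z' y' a) (\<lambda>(t, a). L\<^sub>z t z y a) (at (z, y))"
    and L\<^sub>y_unif: "\<forall>z y. uniform_limit ({t0..T} \<times> A)
          (\<lambda>(z', y') (t, a). L\<^sub>y t z' y' a) (\<lambda>(t, a). L\<^sub>y t z y a) (at (z, y))"

end

theory Submission
  imports Defs
begin

text \<open>
  Needle variation: on \<open>[s\<^sub>0 - e, s\<^sub>0]\<close> the optimal control is replaced by a constant \<open>a\<close>. The resulting change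
  \<open>\<delta>\<close> of the trajectory is \<open>O(e)\<close>. Differentiating \<open>p \<bullet> \<delta>\<close> and integrating, the adjoint equation cancels all
  first-order terms in \<open>\<delta>\<close>: the advanced term with \<open>\<gamma>\<close> meets the term with \<open>\<delta>(D s)\<close> after the change of
  variables \<open>r = D s\<close>, and the terminal conditions meet the derivative of \<open>g\<close>. What is left of the change of
  cost is the integral over the needle of the increment of the pre-Hamiltonian, up to \<open>o(e)\<close>. The error is
  controlled by dominated convergence; pointwise convergence needs \<open>x\<close> to be differentiable at \<open>D s\<close>, which
  holds for almost every \<open>s\<close> because \<open>D\<close> is expanding. At a Lebesgue point \<open>s\<^sub>0\<close> the increment is therefore
  nonnegative, and a countable dense set of values \<open>a\<close> suffices.
\<close>

section \<open>Lipschitz functions of a real variable\<close>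

text \<open>The variation is never linearised and no variational equation is solved.
  \<open>remainder_has_integral\<close> is an exact identity for each n, obtained by testing the
  adjoint equation with the true difference \<open>\<delta> n\<close>; every approximation error
  sits in \<open>remainder\<close>. The same identity yields the integrability of
  \<open>remainder\<close>: the terms with \<open>Gz\<close> and \<open>\<xi>\<close> enter through
  the derivative of the product of \<open>p\<close> and \<open>\<delta> n\<close>. The obstacle is
  the dependence of the delay on the state. The perturbed trajectory is read at another delayed time
  than \<open>x\<close>, so the error contains the change of \<open>\<delta> n\<close> between these
  two times. On the needle \<open>\<delta> n\<close> may have slope of order one, and a shift of
  order \<open>e n\<close> would then count at first order. Hence times with \<open>D s = s0\<close>
  are discarded; for all others both delayed times eventually avoid the needle. For the same reason
  the composition of \<open>f\<close> with the delay is Lipschitz only relative to a function of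
  known Lipschitz constant, which shapes existence and stability. Differentiability of
  \<open>x\<close> at \<open>D s\<close> requires pulling null sets back through \<open>D\<close>;
  the constant d of the monotone delay enters here, as it makes the inverse of \<open>D\<close>
  Lipschitz.\<close>

lemma AE_lebesgue_on_iff_negligible:
  assumes "S \<in> sets lebesgue"
  shows "(AE s in lebesgue_on S. P s) \<longleftrightarrow> negligible {s \<in> S. \<not> P s}"
proof -
  have "(AE s in lebesgue_on S. P s) \<longleftrightarrow> (AE s in lebesgue. s \<in> S \<longrightarrow> P s)"
    using assms by (simp add: AE_restrict_space_iff)
  also have "\<dots> \<longleftrightarrow> negligible {s \<in> S. \<not> P s}"
    unfolding eventually_ae_filter_negligible
    by (metis (mono_tags, lifting) Collect_cong negligible_subset order_refl)
  finally show ?thesis .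
qed

text \<open>Controls are constrained on the open interval only, whereas the integrals run over
  closed ones. The endpoints form a null set, so integrability carries over.\<close>

lemma bounded_measurable_absolutely_integrable:
  fixes h :: "real \<Rightarrow> 'b::euclidean_space"
  assumes "h \<in> borel_measurable (lebesgue_on {a<..<b})" "\<And>s. s \<in> {a<..<b} \<Longrightarrow> norm (h s) \<le> B"
    "a \<le> c" "d \<le> b"
  shows "h absolutely_integrable_on {c..d}"
proof -
  have "h absolutely_integrable_on {a<..<b}"
    by (rule measurable_bounded_by_integrable_imp_absolutely_integrable[OF assms(1), where g = "\<lambda>_. B"])
      (use assms(2) in \<open>auto simp: integrable_on_const lmeasurable_open\<close>)
  moreover have "negligible (({a<..<b} - {a..b}) \<union> ({a..b} - {a<..<b}))"
    by (rule negligible_subset[of "{a, b}"]) auto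
  ultimately have "h absolutely_integrable_on {a..b}"
    by (auto intro: absolutely_integrable_spike_set negligible_subset)
  then show ?thesis
    by (rule absolutely_integrable_on_subinterval) (use assms in auto)
qed

lemma negligible_lipschitz_image:
  fixes F :: "real \<Rightarrow> real"
  assumes "negligible N" "C-lipschitz_on N F"
  shows "negligible (F ` N)"
proof (rule negligible_locally_Lipschitz_image[OF _ assms(1)])
  fix s assume "s \<in> N"
  then show "\<exists>T B. open T \<and> s \<in> T \<and> (\<forall>y\<in>N \<inter> T. norm (F y - F s) \<le> B * norm (y - s))"
    using lipschitz_on_normD[OF assms(2)] by (intro exI[of _ UNIV] exI[of _ C]) auto
qed simp

text \<open>At almost every s, \<open>integrable_ccontinuous_explicit\<close> gives convergence of
  the averages over windows to the right of s. Applied to the reflected function it gives those to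
  the left, and both together are the two-sided derivative. The second exceptional set is reflected
  back, which keeps it null.\<close>

lemma indefinite_integral_has_vector_derivative_AE:
  fixes h :: "real \<Rightarrow> 'b::euclidean_space"
  assumes h: "h integrable_on {a..b}"
  shows "AE s in lebesgue_on {a<..<b}. ((\<lambda>u. integral {a..u} h) has_vector_derivative h s) (at s)"
proof -
  \<comment> \<open>Extension by zero makes the function integrable on every interval, also on
    windows that leave {a..b} and on reflected ones.\<close>
  define k where "k = (\<lambda>s. if s \<in> {a..b} then h s else 0)"
  have k_UNIV: "k integrable_on UNIV"
    unfolding k_def using h integrable_restrict_UNIV by blast
  have k_int: "k integrable_on cbox c d" for c d
    using integrable_on_subcbox[OF k_UNIV] by simp
  have rk_int: "(\<lambda>s. k (- s)) integrable_on cbox c d" for c d :: real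
    using k_int[of "-d" "-c"] Henstock_Kurzweil_Integration.integrable_reflect_real[where f = k and a = "-d" and b = "-c"] by simp
  obtain M where M: "negligible M" "\<And>s e. \<lbrakk>s \<notin> M; 0 < e\<rbrakk> \<Longrightarrow>
      \<exists>d>0. \<forall>h. 0 < h \<and> h < d \<longrightarrow> norm (integral {s..s + h} k /\<^sub>R h - k s) < e"
    using integrable_ccontinuous_explicit[of k] k_int by (auto simp: One_nat_def)
  obtain N where N: "negligible N" "\<And>s e. \<lbrakk>s \<notin> N; 0 < e\<rbrakk> \<Longrightarrow>
      \<exists>d>0. \<forall>h. 0 < h \<and> h < d \<longrightarrow> norm (integral {s..s + h} (\<lambda>s. k (- s)) /\<^sub>R h - k (- s)) < e"
    using integrable_ccontinuous_explicit[of "\<lambda>s. k (- s)"] rk_int by auto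
  have "negligible (uminus ` N)"
    by (rule negligible_lipschitz_image[of _ 1]) (auto simp: N lipschitz_on_id)
  then have neg: "negligible (M \<union> uminus ` N)"
    using M(1) by simp
  have "((\<lambda>u. integral {a..u} h) has_vector_derivative h s) (at s)"
    if s: "s \<in> {a<..<b}" "s \<notin> M \<union> uminus ` N" for s
    unfolding has_vector_derivative_def has_derivative_at_alt
  proof (intro conjI allI impI)
    show "bounded_linear (\<lambda>x. x *\<^sub>R h s)" by (rule bounded_linear_scaleR_left)
    fix e :: real assume e: "e > 0"
    have "- s \<notin> N" using s by force
    with N(2)[OF _ e, of "- s"] M(2)[OF _ e, of s] s obtain d1 d2 where
      d1: "d1 > 0" "\<And>h. \<lbrakk>0 < h; h < d1\<rbrakk> \<Longrightarrow> norm (integral {s..s + h} k /\<^sub>R h - k s) < e" and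
      d2: "d2 > 0" "\<And>h. \<lbrakk>0 < h; h < d2\<rbrakk> \<Longrightarrow> norm (integral {-s..-s + h} (\<lambda>s. k (- s)) /\<^sub>R h - k s) < e"
      by auto
    have ks: "k s = h s" using s by (simp add: k_def)
    have diff: "integral {a..v} h - integral {a..u} h = integral {u..v} k" if "a \<le> u" "u \<le> v" "v \<le> b" for u v
    proof -
      have "integral {a..u} h + integral {u..v} h = integral {a..v} h"
        by (rule Henstock_Kurzweil_Integration.integral_combine)
          (use that integrable_on_subinterval[OF h] in auto)
      moreover have "integral {u..v} h = integral {u..v} k"
        by (rule integral_cong) (use that in \<open>auto simp: k_def\<close>)
      ultimately show ?thesis by (simp add: algebra_simps)
    qed
    have scaled: "norm (i - r *\<^sub>R w) \<le> e * r" if "norm (i /\<^sub>R r - w) < e" "r > 0" for i w :: 'b and r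
    proof -
      have "i - r *\<^sub>R w = r *\<^sub>R (i /\<^sub>R r - w)" using that by (simp add: scaleR_diff_right)
      then show ?thesis using that
        by (metis abs_of_pos less_eq_real_def mult.commute mult_left_mono norm_scaleR)
    qed
    show "\<exists>d>0. \<forall>y. norm (y - s) < d \<longrightarrow>
        norm (integral {a..y} h - integral {a..s} h - (y - s) *\<^sub>R h s) \<le> e * norm (y - s)"
    proof (intro exI[of _ "min (min d1 d2) (min (s - a) (b - s))"] conjI allI impI)
      fix y assume y: "norm (y - s) < min (min d1 d2) (min (s - a) (b - s))"
      consider "y = s" | "y > s" | "y < s" by linarith
      then show "norm (integral {a..y} h - integral {a..s} h - (y - s) *\<^sub>R h s) \<le> e * norm (y - s)"
      proof cases
        case 2
        then have "norm (integral {s..s + (y - s)} k /\<^sub>R (y - s) - k s) < e"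
          using y by (intro d1) auto
        from scaled[OF this] 2 show ?thesis
          using diff[of s y] y s by (simp add: ks)
      next
        case 3
        then have "norm (integral {-s..-s + (s - y)} (\<lambda>s. k (- s)) /\<^sub>R (s - y) - k s) < e"
          using y by (intro d2) auto
        moreover have "integral {-s..-s + (s - y)} (\<lambda>s. k (- s)) = integral {y..s} k"
          using integral_reflect_real[of "- y" "- s" k] by simp
        ultimately have "norm (integral {y..s} k - (s - y) *\<^sub>R h s) \<le> e * (s - y)"
          using scaled 3 ks by auto
        moreover have "integral {a..y} h - integral {a..s} h - (y - s) *\<^sub>R h s
            = - (integral {y..s} k - (s - y) *\<^sub>R h s)"
          using diff[of y s] y s 3 by (simp add: algebra_simps)
        moreover have "e * norm (y - s) = e * (s - y)" using 3 by simp
        ultimately show ?thesis by (simp only: norm_minus_cancel)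
      qed auto
    qed (use s d1 d2 in auto)
  qed
  then show ?thesis
    by (subst AE_lebesgue_on_iff_negligible) (auto intro: negligible_subset[OF neg])
qed

text \<open>Clamping is 1-Lipschitz, so the constant extension beyond both ends keeps the Lipschitz
  constant. Difference quotients of the extension then make sense at every point.\<close>

lemma lipschitz_on_clamp:
  fixes F :: "real \<Rightarrow> 'b::real_normed_vector"
  assumes F: "C-lipschitz_on {a..b} F" and "a \<le> b"
  shows "C-lipschitz_on UNIV (\<lambda>s. F (max a (min b s)))"
proof (rule lipschitz_onI)
  fix s r :: real
  have "dist (F (max a (min b s))) (F (max a (min b r))) \<le> C * dist (max a (min b s)) (max a (min b r))"
    by (rule lipschitz_onD[OF F]) (use \<open>a \<le> b\<close> in auto)
  also have "\<dots> \<le> C * dist s r"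
    by (rule mult_left_mono[OF _ lipschitz_on_nonneg[OF F]]) (auto simp: dist_real_def)
  finally show "dist (F (max a (min b s))) (F (max a (min b r))) \<le> C * dist s r" .
qed (use lipschitz_on_nonneg[OF F] in auto)

text \<open>The pointwise bound is asked for inside only, because a control may leave
  \<open>A\<close> at the endpoints.\<close>

lemma integral_norm_bound_interior:
  fixes h :: "real \<Rightarrow> 'b::euclidean_space"
  assumes "h integrable_on {a..b}" "k integrable_on {a..b}" "\<And>s. s \<in> {a<..<b} \<Longrightarrow> norm (h s) \<le> k s"
  shows "norm (integral {a..b} h) \<le> integral {a..b} k"
proof -
  have "norm (integral {a<..<b} h) \<le> integral {a<..<b} k"
    by (rule integral_norm_bound_integral) (use assms in \<open>auto simp: integrable_on_open_interval_real\<close>)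
  then show ?thesis by (simp add: integral_open_interval_real)
qed

lemma integral_norm_bound_const_interior:
  fixes h :: "real \<Rightarrow> 'b::euclidean_space"
  assumes "h integrable_on {a..b}" "a \<le> b" "\<And>s. s \<in> {a<..<b} \<Longrightarrow> norm (h s) \<le> B"
  shows "norm (integral {a..b} h) \<le> B * (b - a)"
  using integral_norm_bound_interior[OF assms(1), of "\<lambda>_. B"] assms
  by (simp add: integrable_on_const mult.commute)

lemma lipschitz_on_union_Icc:
  fixes F :: "real \<Rightarrow> 'b::metric_space"
  assumes "C-lipschitz_on {a..b} F" "C-lipschitz_on {b..c} F"
  shows "C-lipschitz_on {a..c} F"
  using lipschitz_on_concat[OF assms] by simp

lemma lipschitz_on_indefinite_integral:
  fixes h :: "real \<Rightarrow> 'b::euclidean_space"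
  assumes h: "h integrable_on {t..T}" and bound: "\<And>s. s \<in> {t<..<T} \<Longrightarrow> norm (h s) \<le> B" and "B \<ge> 0"
  shows "B-lipschitz_on {t..T} (\<lambda>s. c + integral {t..s} h)"
proof (rule lipschitz_on_leI)
  fix u v assume uv: "u \<in> {t..T}" "v \<in> {t..T}" "u \<le> v"
  have int: "h integrable_on {p..q}" if "t \<le> p" "q \<le> T" for p q
    by (rule integrable_on_subinterval[OF h]) (use that in auto)
  have comb: "integral {t..u} h + integral {u..v} h = integral {t..v} h"
    by (rule Henstock_Kurzweil_Integration.integral_combine) (use uv in \<open>auto intro: int\<close>)
  have "dist (c + integral {t..u} h) (c + integral {t..v} h) = norm (integral {u..v} h)"
    by (simp add: dist_norm flip: comb)
  also have "\<dots> \<le> B * (v - u)"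
    by (rule integral_norm_bound_const_interior) (use uv in \<open>auto intro: int bound\<close>)
  finally show "dist (c + integral {t..u} h) (c + integral {t..v} h) \<le> B * dist u v"
    using uv by (simp add: dist_real_def)
qed fact

section \<open>Almost everywhere differentiability and the fundamental theorem for Lipschitz
  functions\<close>

lemma has_vector_derivative_sequence:
  assumes "(F has_vector_derivative D) (at s)" "r \<longlonglongrightarrow> (0::real)" "\<And>n. r n \<noteq> 0"
  shows "(\<lambda>n. (F (s + r n) - F s) /\<^sub>R r n) \<longlonglongrightarrow> D"
proof -
  have "((\<lambda>h. norm (F (s + h) - F s - h *\<^sub>R D) / norm h) \<longlongrightarrow> 0) (at 0)"
    using assms(1) unfolding has_vector_derivative_def has_derivative_at by simp
  moreover have "filterlim r (at 0) sequentially"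
    using assms(2,3) by (simp add: filterlim_at)
  ultimately have "(\<lambda>n. norm (F (s + r n) - F s - r n *\<^sub>R D) / norm (r n)) \<longlonglongrightarrow> 0"
    by (rule filterlim_compose)
  moreover have "norm (F (s + r n) - F s - r n *\<^sub>R D) / norm (r n) = norm ((F (s + r n) - F s) /\<^sub>R r n - D)" for n
  proof -
    have "(F (s + r n) - F s) /\<^sub>R r n - D = (F (s + r n) - F s - r n *\<^sub>R D) /\<^sub>R r n"
      using assms(3)[of n] by (simp add: scaleR_diff_right)
    then show ?thesis by (simp add: divide_inverse mult.commute)
  qed
  ultimately have "(\<lambda>n. norm ((F (s + r n) - F s) /\<^sub>R r n - D)) \<longlonglongrightarrow> 0" by (simp only:)
  then show ?thesis by (rule LIM_zero_cancel[OF tendsto_norm_zero_cancel])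
qed

lemma lipschitz_vector_derivative_bound:
  fixes F :: "real \<Rightarrow> 'b::real_normed_vector"
  assumes F: "C-lipschitz_on {a..b} F" and s: "s \<in> {a<..<b}"
    and D: "(F has_vector_derivative D) (at s)"
  shows "norm D \<le> C"
proof -
  \<comment> \<open>The denominator starts at 2, so that \<open>s + r n\<close> stays strictly below
    b for every n.\<close>
  define r where "r n = (b - s) / (2 + real n)" for n
  have "r \<longlonglongrightarrow> 0" unfolding r_def by real_asymp
  moreover have r: "r n > 0" "r n < b - s" for n
  proof -
    have "s * real n \<le> b * real n" using s by (intro mult_right_mono) auto
    with s show "r n > 0" "r n < b - s" by (auto simp: r_def field_simps)
  qed
  ultimately have "(\<lambda>n. (F (s + r n) - F s) /\<^sub>R r n) \<longlonglongrightarrow> D"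
    by (intro has_vector_derivative_sequence[OF D]) (auto simp: less_imp_neq[symmetric])
  then have "(\<lambda>n. norm ((F (s + r n) - F s) /\<^sub>R r n)) \<longlonglongrightarrow> norm D"
    by (rule tendsto_norm)
  moreover have "norm ((F (s + r n) - F s) /\<^sub>R r n) \<le> C" for n
  proof -
    have "norm (F (s + r n) - F s) \<le> C * norm (s + r n - s)"
      by (rule lipschitz_on_normD[OF F]) (use r[of n] s in auto)
    then show ?thesis using r[of n] by (simp add: pos_divide_le_eq divide_inverse_commute[symmetric])
  qed
  ultimately show ?thesis
    by (intro LIMSEQ_le_const2) auto
qed

text \<open>The difference quotients \<open>q n\<close> of the clamped function are bounded by C and
  converge to \<open>F'\<close> almost everywhere, so their integrals converge to the integral of
  \<open>F'\<close>. On the other hand the integral of a difference quotient telescopes to the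
  averages over two windows of length \<open>r n\<close> starting at b and at a, and these tend to
  the values of F there.\<close>

lemma lipschitz_has_integral_vector_derivative:
  fixes F :: "real \<Rightarrow> 'b::euclidean_space"
  assumes F: "C-lipschitz_on {a..b} F" and "a \<le> b"
    and D: "AE s in lebesgue_on {a<..<b}. (F has_vector_derivative F' s) (at s)"
  shows "(F' has_integral F b - F a) {a..b}"
proof -
  define G where "G s = F (max a (min b s))" for s
  have G: "C-lipschitz_on UNIV G"
    unfolding G_def by (rule lipschitz_on_clamp[OF F \<open>a \<le> b\<close>])
  then have contG: "continuous_on S G" for S
    by (blast intro: lipschitz_on_continuous_on lipschitz_on_subset)
  have intG: "G integrable_on {c..d}" for c d
    by (rule integrable_continuous_real[OF contG])
  have C0: "C \<ge> 0" using lipschitz_on_nonneg[OF F] .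
  define r where "r n = inverse (real (Suc n))" for n
  have r0: "r \<longlonglongrightarrow> 0" unfolding r_def by (rule LIMSEQ_inverse_real_of_nat)
  have rpos: "r n > 0" for n by (simp add: r_def)
  define q where "q n s = (G (s + r n) - G s) /\<^sub>R r n" for n s
  have near: "norm ((integral {c..c + r n} G) /\<^sub>R r n - G c) \<le> C * r n" for n c
  proof -
    have "((\<lambda>s. G s - G c) has_integral (integral {c..c + r n} G - r n *\<^sub>R G c)) {c..c + r n}"
      using has_integral_diff[OF integrable_integral[OF intG] has_integral_const_real[of "G c" c "c + r n"]]
        rpos[of n] by simp
    then have "norm (integral {c..c + r n} G - r n *\<^sub>R G c) \<le> (C * r n) * Henstock_Kurzweil_Integration.content {c..c + r n}"
    proof (rule has_integral_bound_real[rotated 2])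
      fix s assume "s \<in> {c..c + r n} - {}"
      then have "norm (G s - G c) \<le> C * norm (s - c)" "norm (s - c) \<le> r n"
        using lipschitz_on_normD[OF G, of s c] by auto
      then show "norm (G s - G c) \<le> C * r n"
        using mult_left_mono[OF _ C0] order_trans by blast
    qed (use C0 rpos[of n] in auto)
    then have "norm (integral {c..c + r n} G - r n *\<^sub>R G c) / r n \<le> C * r n"
      using rpos[of n] by (simp add: pos_divide_le_eq)
    then have "norm ((integral {c..c + r n} G - r n *\<^sub>R G c) /\<^sub>R r n) \<le> C * r n"
      using rpos[of n] by (simp add: divide_inverse_commute)
    then show ?thesis using rpos[of n] by (simp add: scaleR_diff_right)
  qed
  have lim_near: "(\<lambda>n. (integral {c..c + r n} G) /\<^sub>R r n) \<longlonglongrightarrow> G c" for c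
  proof -
    have "(\<lambda>n. C * r n) \<longlonglongrightarrow> 0" using tendsto_mult_right_zero[OF r0] .
    then have "(\<lambda>n. (integral {c..c + r n} G) /\<^sub>R r n - G c) \<longlonglongrightarrow> 0"
      by (rule Lim_null_comparison[rotated]) (use near in auto)
    then show ?thesis by (rule LIM_zero_cancel)
  qed
  have int_q: "(q n has_integral (integral {b..b + r n} G) /\<^sub>R r n - (integral {a..a + r n} G) /\<^sub>R r n) {a..b}" for n
  proof -
    have "((\<lambda>s. G (s + r n)) has_integral integral {a + r n..b + r n} G) {a..b}"
      using has_integral_shift_Icc_real[of G "r n" "integral {a + r n..b + r n} G" a b]
        integrable_integral[OF intG] by (simp add: o_def add.commute)
    from has_integral_cmul[OF has_integral_diff[OF this integrable_integral[OF intG]], of "inverse (r n)"]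
    have q: "(q n has_integral (integral {a + r n..b + r n} G - integral {a..b} G) /\<^sub>R r n) {a..b}"
      unfolding q_def .
    have "integral {a..a + r n} G + integral {a + r n..b + r n} G = integral {a..b + r n} G"
      "integral {a..b} G + integral {b..b + r n} G = integral {a..b + r n} G"
      using \<open>a \<le> b\<close> rpos[of n] by (auto intro!: Henstock_Kurzweil_Integration.integral_combine intG)
    then have "integral {a + r n..b + r n} G - integral {a..b} G = integral {b..b + r n} G - integral {a..a + r n} G"
      by (simp add: algebra_simps)
    with q show ?thesis
      by (simp add: scaleR_diff_right)
  qed
  define N where "N = {s \<in> {a<..<b}. \<not> (F has_vector_derivative F' s) (at s)} \<union> {a, b}"
  have neg: "negligible N"
    using D by (simp add: N_def AE_lebesgue_on_iff_negligible)
  have spike: "(k has_integral i) ({a..b} - N) \<longleftrightarrow> (k has_integral i) {a..b}" for k :: "real \<Rightarrow> 'b" and i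
    by (rule has_integral_spike_set_eq) (auto intro: negligible_subset[OF neg])
  have int_q': "(q n has_integral (integral {b..b + r n} G) /\<^sub>R r n - (integral {a..a + r n} G) /\<^sub>R r n) ({a..b} - N)" for n
    using int_q by (simp add: spike)
  have conv: "(\<lambda>n. q n s) \<longlonglongrightarrow> F' s" if "s \<in> {a..b} - N" for s
    unfolding q_def
  proof (rule has_vector_derivative_sequence[OF _ r0])
    have s: "s \<in> {a<..<b}" "(F has_vector_derivative F' s) (at s)"
      using that by (auto simp: N_def)
    then show "(G has_vector_derivative F' s) (at s)"
      by (intro has_vector_derivative_transform_within_open[of F _ s "{a<..<b}" G]) (auto simp: G_def)
  qed (simp add: r_def)
  have bound: "norm (q n s) \<le> C" for n s
    using lipschitz_on_normD[OF G, of "s + r n" s] rpos[of n]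
    by (simp add: q_def pos_divide_le_eq divide_inverse_commute[symmetric])
  have dom: "F' integrable_on ({a..b} - N)" "(\<lambda>n. integral ({a..b} - N) (q n)) \<longlonglongrightarrow> integral ({a..b} - N) F'"
  proof -
    have "(\<lambda>_::real. C) integrable_on {a..b} - N"
      by (rule integrable_spike_set[where S = "{a..b}"]) (auto intro: negligible_subset[OF neg])
    from dominated_convergence[of q, OF _ this, of F'] int_q' bound conv
    show "F' integrable_on ({a..b} - N)" "(\<lambda>n. integral ({a..b} - N) (q n)) \<longlonglongrightarrow> integral ({a..b} - N) F'"
      by (auto simp: has_integral_integrable_integral)
  qed
  have "(\<lambda>n. integral ({a..b} - N) (q n)) \<longlonglongrightarrow> G b - G a"
    using tendsto_diff[OF lim_near[of b] lim_near[of a]] integral_unique[OF int_q'] by simp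
  with dom(2) have "integral ({a..b} - N) F' = G b - G a"
    by (rule LIMSEQ_unique)
  with dom(1) have "(F' has_integral G b - G a) ({a..b} - N)"
    by (simp only: has_integral_integrable_integral)
  then have "(F' has_integral G b - G a) {a..b}"
    by (rule iffD1[OF spike])
  then show ?thesis using \<open>a \<le> b\<close> by (simp add: G_def)
qed

lemma lipschitz_real_differentiable_AE:
  fixes F :: "real \<Rightarrow> real"
  assumes F: "C-lipschitz_on {a..b} F"
  shows "AE s in lebesgue_on {a<..<b}. \<exists>D. (F has_vector_derivative D) (at s)"
proof (cases "a \<le> b")
  case True
  have C0: "C \<ge> 0" using lipschitz_on_nonneg[OF F] .
  \<comment> \<open>Slope C would only make G nondecreasing. The extra 1 makes its increments at
    least those of the identity, so that the inverse is 1-Lipschitz.\<close>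
  define G where "G s = F (max a (min b s)) + (C + 1) * s" for s
  have Fc: "C-lipschitz_on UNIV (\<lambda>s. F (max a (min b s)))"
    by (rule lipschitz_on_clamp[OF F True])
  have G_diff: "v - u \<le> G v - G u \<and> G v - G u \<le> (2 * C + 1) * (v - u)" if "u \<le> v" for u v
  proof -
    have "\<bar>F (max a (min b v)) - F (max a (min b u))\<bar> \<le> C * (v - u)"
      using lipschitz_onD[OF Fc, of v u] that by (simp add: dist_real_def)
    moreover have "G v - G u = F (max a (min b v)) - F (max a (min b u)) + C * (v - u) + (v - u)"
      by (simp add: G_def ring_distribs)
    moreover have "(2 * C + 1) * (v - u) = C * (v - u) + C * (v - u) + (v - u)"
      by (simp add: ring_distribs)
    ultimately show ?thesis by linarith
  qed
  then have lower: "v - u \<le> G v - G u" and upper: "G v - G u \<le> (2 * C + 1) * (v - u)" if "u \<le> v" for u v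
    using that by blast+
  have strict: "strict_mono G"
  proof (rule strict_monoI)
    fix u v :: real assume "u < v"
    then show "G u < G v" using lower[of u v] by linarith
  qed
  have "continuous_on UNIV G"
    unfolding G_def using lipschitz_on_continuous_on[OF Fc] by (intro continuous_intros)
  have "surj G"
    unfolding surj_def
  proof
    fix y
    \<comment> \<open>As G grows at least as fast as the identity, moving from 0 by the defect
      \<open>y - G 0\<close> already reaches y; the intermediate value theorem is applied between u
      and v.\<close>
    define u where "u = min 0 (y - G 0)"
    define v where "v = max 0 (y - G 0)"
    have "G u \<le> y" "y \<le> G v" using lower[of u 0] lower[of 0 v] by (auto simp: u_def v_def)
    moreover have "u \<le> v" by (auto simp: u_def v_def)
    ultimately show "\<exists>x. y = G x"
      using IVT'[of G u y v] continuous_on_subset[OF \<open>continuous_on UNIV G\<close>] by auto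
  qed
  define H where "H = inv G"
  have GH: "G (H y) = y" and HG: "H (G s) = s" for y s
    by (simp_all add: H_def surj_f_inv_f[OF \<open>surj G\<close>] inv_f_f[OF strict_mono_imp_inj_on[OF strict]])
  have "1-lipschitz_on UNIV H"
  proof (rule lipschitz_onI)
    fix y z :: real
    show "dist (H y) (H z) \<le> 1 * dist y z"
      using lower[of "H y" "H z"] lower[of "H z" "H y"] by (cases "H y \<le> H z") (auto simp: GH dist_real_def)
  qed auto
  then have H_meas[measurable]: "H \<in> borel_measurable borel"
    by (intro borel_measurable_continuous_onI lipschitz_on_continuous_on)
  \<comment> \<open>Since H is the inverse of G, preimages under H are images under G, and \<mu>
    measures X by the length of its image.\<close>
  define \<mu> where "\<mu> = distr lborel borel H"
  have vimage: "H -` X = G ` X" for X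
  proof (intro set_eqI iffI)
    fix y assume "y \<in> H -` X"
    then show "y \<in> G ` X" by (intro image_eqI[of _ _ "H y"]) (simp_all add: GH)
  qed (auto simp: HG)
  have ac: "absolutely_continuous lborel \<mu>"
    unfolding absolutely_continuous_def
  proof
    fix X :: "real set" assume X: "X \<in> null_sets lborel"
    then have "negligible X"
      using null_sets_completionI negligible_iff_null_sets by blast
    moreover have "(2 * C + 1)-lipschitz_on X G"
    proof (rule lipschitz_onI)
      fix y s
      show "dist (G y) (G s) \<le> (2 * C + 1) * dist y s"
        using upper[of y s] upper[of s y] lower[of y s] lower[of s y]
        by (cases "y \<le> s") (auto simp: dist_real_def)
    qed (use C0 in simp)
    ultimately have "negligible (G ` X)"
      by (rule negligible_lipschitz_image)
    then have "G ` X \<in> null_sets lebesgue" by (simp add: negligible_iff_null_sets)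
    moreover have "G ` X \<in> sets lborel"
      using X measurable_sets[OF H_meas, of X] by (simp add: vimage null_sets_def)
    ultimately have "emeasure lborel (G ` X) = 0"
      by (simp add: null_sets_completion_iff null_setsD1)
    then show "X \<in> null_sets \<mu>"
      using X by (auto simp: null_sets_def \<mu>_def emeasure_distr vimage)
  qed
  obtain h where h[measurable]: "h \<in> borel_measurable borel" and dens: "density lborel h = \<mu>"
    using sigma_finite_measure.Radon_Nikodym[OF lborel.sigma_finite_measure_axioms ac] by (auto simp: \<mu>_def)
  have nn: "(\<integral>\<^sup>+s. h s * indicator {u..v} s \<partial>lborel) = ennreal (G v - G u)" if "u \<le> v" for u v
  proof -
    have "(\<integral>\<^sup>+s. h s * indicator {u..v} s \<partial>lborel) = emeasure \<mu> {u..v}"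
      by (simp add: emeasure_density flip: dens)
    also have "\<dots> = emeasure lborel (G ` {u..v})"
      by (simp add: \<mu>_def emeasure_distr vimage)
    also have "G ` {u..v} = {G u..G v}"
    proof (intro set_eqI iffI)
      fix y assume "y \<in> {G u..G v}"
      then show "y \<in> G ` {u..v}"
        using GH[of y] strict_mono_less_eq[OF strict, of u "H y"] strict_mono_less_eq[OF strict, of "H y" v]
        by (intro image_eqI[of _ _ "H y"]) auto
    qed (use strict in \<open>auto simp: strict_mono_less_eq\<close>)
    also have "emeasure lborel {G u..G v} = ennreal (G v - G u)"
      using that strict by (simp add: strict_mono_less_eq)
    finally show ?thesis .
  qed
  \<comment> \<open>The density takes extended values. Its integral over {a..b} is finite, so the
    infinite values fill a null set and \<open>enn2real\<close> does not change the
    integral.\<close>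
  have fin: "AE s in lborel. s \<in> {a..b} \<longrightarrow> h s \<noteq> \<infinity>"
  proof -
    have "AE s in lborel. h s * indicator {a..b} s \<noteq> \<infinity>"
      by (rule nn_integral_noteq_infinite) (use nn[OF True] in auto)
    then show ?thesis by eventually_elim (auto simp: indicator_def)
  qed
  have hi: "((\<lambda>s. enn2real (h s)) has_integral (G v - G a)) {a..v}" if "a \<le> v" "v \<le> b" for v
  proof -
    have "((\<lambda>s. enn2real (h s) * indicator {a..v} s) has_integral (G v - G a)) UNIV"
    proof (rule nn_integral_has_integral)
      have "(\<integral>\<^sup>+s. ennreal (enn2real (h s) * indicator {a..v} s) \<partial>lborel)
          = (\<integral>\<^sup>+s. h s * indicator {a..v} s \<partial>lborel)"
        by (rule nn_integral_cong_AE, use fin in eventually_elim)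
          (use that in \<open>auto simp: indicator_def ennreal_enn2real_if\<close>)
      then show "(\<integral>\<^sup>+s. ennreal (enn2real (h s) * indicator {a..v} s) \<partial>lborel) = ennreal (G v - G a)"
        using nn that by simp
      show "0 \<le> G v - G a" using lower[of a v] that by simp
    qed (auto intro!: borel_measurable_times)
    then have "((\<lambda>s. if s \<in> {a..v} then enn2real (h s) else 0) has_integral (G v - G a)) UNIV"
      by (rule has_integral_eq[rotated]) (auto simp: indicator_def)
    then show ?thesis by (simp only: has_integral_restrict_UNIV)
  qed
  have "AE s in lebesgue_on {a<..<b}.
      ((\<lambda>v. integral {a..v} (\<lambda>s. enn2real (h s))) has_vector_derivative enn2real (h s)) (at s)"
    by (rule indefinite_integral_has_vector_derivative_AE) (use hi[of b] True in blast)
  then show ?thesis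
  proof (rule lebesgue_on_mono)
    fix s assume s: "s \<in> {a<..<b}"
      and D: "((\<lambda>v. integral {a..v} (\<lambda>s. enn2real (h s))) has_vector_derivative enn2real (h s)) (at s)"
    have "((\<lambda>v. integral {a..v} (\<lambda>s. enn2real (h s)) + (G a - (C + 1) * v)) has_vector_derivative
        enn2real (h s) + (0 - (C + 1) * 1)) (at s)"
      by (intro derivative_intros D)
    then have "(F has_vector_derivative enn2real (h s) + (0 - (C + 1) * 1)) (at s)"
    proof (rule has_vector_derivative_transform_within_open[where S = "{a<..<b}"])
      fix v assume v: "v \<in> {a<..<b}"
      then show "integral {a..v} (\<lambda>s. enn2real (h s)) + (G a - (C + 1) * v) = F v"
        using integral_unique[OF hi[of v]] by (simp add: G_def)
    qed (use s in auto)
    then show "\<exists>D. (F has_vector_derivative D) (at s)" by blast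
  qed
qed (simp add: AE_lebesgue_on_iff_negligible)

lemma lipschitz_differentiable_AE:
  fixes F :: "real \<Rightarrow> 'b::euclidean_space"
  assumes F: "C-lipschitz_on {a..b} F"
  shows "AE s in lebesgue_on {a<..<b}. \<exists>D. (F has_vector_derivative D) (at s)"
proof -
  have "AE s in lebesgue_on {a<..<b}. \<exists>D. ((\<lambda>s. F s \<bullet> i) has_vector_derivative D) (at s)" if "i \<in> Basis" for i
  proof (rule lipschitz_real_differentiable_AE[of C], rule lipschitz_onI)
    fix s r assume "s \<in> {a..b}" "r \<in> {a..b}"
    then have "norm (F s - F r) \<le> C * norm (s - r)" by (rule lipschitz_on_normD[OF F])
    moreover have "\<bar>(F s - F r) \<bullet> i\<bar> \<le> norm (F s - F r)" using that by (rule Basis_le_norm)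
    ultimately show "dist (F s \<bullet> i) (F r \<bullet> i) \<le> C * dist s r"
      by (simp add: dist_norm inner_diff_left)
  qed (rule lipschitz_on_nonneg[OF F])
  then have "AE s in lebesgue_on {a<..<b}. \<forall>i\<in>Basis. \<exists>D. ((\<lambda>s. F s \<bullet> i) has_vector_derivative D) (at s)"
    by (subst AE_finite_all) auto
  then show ?thesis
  proof eventually_elim
    case (elim s)
    then obtain D where D: "\<And>i. i \<in> Basis \<Longrightarrow> ((\<lambda>s. F s \<bullet> i) has_vector_derivative D i) (at s)"
      by metis
    have "(F has_vector_derivative (\<Sum>i\<in>Basis. D i *\<^sub>R i)) (at s)"
      unfolding has_vector_derivative_def
      by (subst has_derivative_componentwise_within)
        (use D in \<open>auto simp: has_vector_derivative_def inner_sum_left_Basis\<close>)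
    then show ?case by blast
  qed
qed

text \<open>The rate \<open>2 * K\<close> is chosen so that K times the weight has half the weight
  as antiderivative. This half is absorbed in \<open>weighted_gronwall\<close> and is the
  contraction factor in \<open>solution_exists\<close>.\<close>

lemma integral_norm_bound_exp:
  fixes h :: "real \<Rightarrow> 'b::euclidean_space"
  assumes "h integrable_on {t..s}" "t \<le> s" "K > 0" "M \<ge> 0"
    and "\<And>r. r \<in> {t<..<s} \<Longrightarrow> norm (h r) \<le> K * (M * exp (2 * K * (r - t)))"
  shows "norm (integral {t..s} h) \<le> M * exp (2 * K * (s - t)) / 2"
proof -
  have "((\<lambda>r. K * (M * exp (2 * K * (r - t)))) has_integral
      (M * exp (2 * K * (s - t)) / 2 - M * exp (2 * K * (t - t)) / 2)) {t..s}"
    by (rule fundamental_theorem_of_calculus)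
      (use assms in \<open>auto intro!: derivative_eq_intros simp: has_real_derivative_iff_has_vector_derivative[symmetric]\<close>)
  then have "norm (integral {t..s} h) \<le> M * exp (2 * K * (s - t)) / 2 - M * exp (2 * K * (t - t)) / 2"
    using integral_norm_bound_interior[OF assms(1) _ assms(5)] by (metis has_integral_integrable_integral)
  with \<open>M \<ge> 0\<close> show ?thesis by simp
qed

text \<open>The step hypothesis sees \<open>\<phi>\<close> only through its running maximum, as a delay requires; the exponential weight
  takes the place of the usual integral kernel.\<close>
lemma weighted_gronwall:
  fixes \<phi> :: "real \<Rightarrow> real"
  assumes "t \<le> T" "0 \<le> b" "K > 0"
    and cont: "continuous_on {t - b..T} \<phi>"
    and nonneg: "\<And>s. s \<in> {t - b..T} \<Longrightarrow> 0 \<le> \<phi> s"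
    and init: "\<And>s. s \<in> {t - b..t} \<Longrightarrow> \<phi> s \<le> c"
    and step: "\<And>M s. \<lbrakk>0 \<le> M; s \<in> {t..T};
        \<And>r r'. \<lbrakk>r \<in> {t..s}; r' \<in> {t - b..r}\<rbrakk> \<Longrightarrow> \<phi> r' \<le> M * exp (2 * K * (r - t))\<rbrakk>
        \<Longrightarrow> \<phi> s \<le> c + M * exp (2 * K * (s - t)) / 2"
    and s: "s \<in> {t - b..T}"
  shows "\<phi> s \<le> 2 * c * exp (2 * K * (T - t))"
proof -
  \<comment> \<open>The weight is 1 up to time t and increases afterwards, so a bound at time r'
    passes to every later r.\<close>
  define W where "W s = exp (2 * K * max 0 (s - t))" for s
  have W1: "W s \<ge> 1" for s using \<open>K > 0\<close> by (simp add: W_def)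
  have W0: "W s > 0" for s by (simp add: W_def)
  have W_mono: "W r' \<le> W r" if "r' \<le> r" for r r'
    using that \<open>K > 0\<close> unfolding W_def by (auto intro!: mult_left_mono)
  have c0: "c \<ge> 0" using nonneg[of t] init[of t] assms(1,2) by force
  have "continuous_on {t - b..T} (\<lambda>s. \<phi> s / W s)"
    unfolding W_def by (intro continuous_intros cont) auto
  then obtain m where m: "m \<in> {t - b..T}" and max: "\<And>s. s \<in> {t - b..T} \<Longrightarrow> \<phi> s / W s \<le> \<phi> m / W m"
    using continuous_attains_sup[of "{t - b..T}" "\<lambda>s. \<phi> s / W s"] s by auto
  define M where "M = \<phi> m / W m"
  have M0: "M \<ge> 0" using nonneg[OF m] W0[of m] by (simp add: M_def)
  have bound: "\<phi> s \<le> M * W s" if "s \<in> {t - b..T}" for s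
    using max[OF that] W0[of s] by (simp add: M_def[symmetric] pos_divide_le_eq)
  \<comment> \<open>M is the maximum of the weighted function. If it is attained beyond t, the step
    hypothesis applies with this very M, and half of the maximum is absorbed on the left; otherwise
    the initial bound applies.\<close>
  have "M \<le> 2 * c"
  proof (cases "m \<le> t")
    case True
    then have "M \<le> c" using init[of m] m by (simp add: M_def W_def)
    then show ?thesis using c0 by linarith
  next
    case False
    have "\<phi> m \<le> c + M * exp (2 * K * (m - t)) / 2"
    proof (rule step[OF M0])
      fix r r' assume r: "r \<in> {t..m}" "r' \<in> {t - b..r}"
      then have "\<phi> r' \<le> M * W r'" using m by (intro bound) auto
      also have "\<dots> \<le> M * W r" using r M0 by (intro mult_left_mono W_mono) auto
      finally show "\<phi> r' \<le> M * exp (2 * K * (r - t))" using r by (simp add: W_def)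
    qed (use False m in auto)
    then have "\<phi> m \<le> c + M * W m / 2" using False by (simp add: W_def)
    then have "M * W m \<le> c + M * W m / 2" using W0[of m] by (simp add: M_def)
    then have "M * W m \<le> 2 * c" by simp
    moreover have "M * 1 \<le> M * W m" using M0 W1 by (intro mult_left_mono) auto
    ultimately show ?thesis by simp
  qed
  have "\<phi> s \<le> M * W s" by (rule bound[OF s])
  also have "\<dots> \<le> 2 * c * W T"
    using \<open>M \<le> 2 * c\<close> M0 W0[of s] W_mono[of s T] s c0 by (intro mult_mono) auto
  finally show ?thesis using \<open>t \<le> T\<close> by (simp add: W_def)
qed

section \<open>The state equation\<close>

context delay_control_problem
begin

text \<open>Here F stands for \<open>f\<close>, for \<open>L\<close> and later for the
  pre-Hamiltonian \<open>Hm\<close>, so that measurability and Lipschitz estimates along a state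
  function are shared.\<close>

definition rhs :: "(real \<Rightarrow> real^'n \<Rightarrow> real^'n \<Rightarrow> real^'m \<Rightarrow> 'c) \<Rightarrow> (real \<Rightarrow> real^'n) \<Rightarrow> real \<Rightarrow> real^'m \<Rightarrow> 'c" where
  "rhs F u s a = F s (u s) (u (s - \<tau> s (u s))) a"

abbreviation solves :: "real \<Rightarrow> (real \<Rightarrow> real^'n) \<Rightarrow> (real \<Rightarrow> real^'m) \<Rightarrow> (real \<Rightarrow> real^'n) \<Rightarrow> bool" where
  "solves \<equiv> is_solution T f \<tau> \<tau>b"

section \<open>Measurability, growth and Lipschitz estimates along a state function\<close>

lemma delay_le: "t \<in> {t0..T} \<Longrightarrow> \<tau> t z \<le> \<tau>b"
  unfolding \<tau>b_eq by (rule cSUP_upper2[OF \<tau>_bdd, of "(t, z)"]) auto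

lemma max_delay_nonneg: "0 \<le> \<tau>b"
  using delay_le[of t0 0] \<tau>_nonneg t0_less_T by (meson atLeastAtMost_iff less_imp_le order_refl order_trans)

lemma delayed_time_in:
  assumes "s \<in> {t0..T}" "t \<le> s"
  shows "s - \<tau> s z \<in> {t - \<tau>b..s}"
  using assms delay_le[of s z] \<tau>_nonneg by force

lemma carath_measurable:
  fixes F :: "real \<Rightarrow> real^'n \<Rightarrow> real^'n \<Rightarrow> real^'m \<Rightarrow> 'c::topological_space"
  assumes F: "continuous_on ({t0..T} \<times> UNIV \<times> UNIV \<times> A) (\<lambda>(t, z, y, a). F t z y a)"
    and S: "S \<in> sets lebesgue" "S \<subseteq> {t0..T}"
    and u: "u \<in> borel_measurable (lebesgue_on S)" and v: "v \<in> borel_measurable (lebesgue_on S)"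
    and \<alpha>: "\<alpha> \<in> borel_measurable (lebesgue_on S)" "\<And>s. s \<in> S \<Longrightarrow> \<alpha> s \<in> A"
  shows "(\<lambda>s. F s (u s) (v s) (\<alpha> s)) \<in> borel_measurable (lebesgue_on S)"
proof -
  let ?D = "{t0..T} \<times> UNIV \<times> UNIV \<times> A"
  have "(\<lambda>s. s) \<in> borel_measurable (lebesgue_on S)"
    using continuous_imp_measurable_on_sets_lebesgue[OF continuous_on_id S(1)] by simp
  then have "(\<lambda>s. (s, u s, v s, \<alpha> s)) \<in> borel_measurable (lebesgue_on S)"
    using u v \<alpha>(1) by (intro borel_measurable_Pair)
  then have "(\<lambda>s. (s, u s, v s, \<alpha> s)) \<in> measurable (lebesgue_on S) (restrict_space borel ?D)"
    using S \<alpha>(2) by (intro measurable_restrict_space2) auto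
  moreover have "(\<lambda>(t, z, y, a). F t z y a) \<in> measurable (restrict_space borel ?D) borel"
    by (rule borel_measurable_continuous_on_restrict[OF F])
  ultimately have "(\<lambda>(t, z, y, a). F t z y a) \<circ> (\<lambda>s. (s, u s, v s, \<alpha> s)) \<in> borel_measurable (lebesgue_on S)"
    by (rule measurable_comp)
  then show ?thesis by (simp add: o_def)
qed

lemma delay_continuous: "continuous_on ({t0..T} \<times> UNIV) (\<lambda>(t, z). \<tau> t z)"
proof (rule has_derivative_continuous_on)
  fix q assume "q \<in> {t0..T} \<times> (UNIV :: (real^'n) set)"
  then show "((\<lambda>(t, z). \<tau> t z) has_derivative
      (\<lambda>(h, k). \<tau>\<^sub>t (fst q) (snd q) * h + \<tau>\<^sub>z (fst q) (snd q) \<bullet> k)) (at q within {t0..T} \<times> UNIV)"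
    using \<tau>_deriv by (cases q) auto
qed

lemma continuous_on_delayed_time:
  assumes "continuous_on {t..T} u" "t \<in> {t0..T}"
  shows "continuous_on {t..T} (\<lambda>s. s - \<tau> s (u s))"
proof -
  have "continuous_on {t..T} (\<lambda>s. (\<lambda>(t, z). \<tau> t z) (s, u s))"
    by (rule continuous_on_compose2[OF delay_continuous]) (use assms in \<open>auto intro!: continuous_intros\<close>)
  then show ?thesis by (auto intro: continuous_intros)
qed

lemma continuous_on_delayed_state:
  assumes "continuous_on {t - \<tau>b..T} u" "t \<in> {t0..T}"
  shows "continuous_on {t..T} (\<lambda>s. u (s - \<tau> s (u s)))"
proof (rule continuous_on_compose2[OF assms(1)])
  show "continuous_on {t..T} (\<lambda>s. s - \<tau> s (u s))"
    using assms max_delay_nonneg by (intro continuous_on_delayed_time) (auto intro: continuous_on_subset)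
  show "(\<lambda>s. s - \<tau> s (u s)) ` {t..T} \<subseteq> {t - \<tau>b..T}"
  proof (rule image_subsetI)
    fix s assume "s \<in> {t..T}"
    then show "s - \<tau> s (u s) \<in> {t - \<tau>b..T}"
      using assms(2) delayed_time_in[of s t "u s"] by auto
  qed
qed

lemma rhs_measurable:
  fixes F :: "real \<Rightarrow> real^'n \<Rightarrow> real^'n \<Rightarrow> real^'m \<Rightarrow> 'c::topological_space"
  assumes F: "continuous_on ({t0..T} \<times> UNIV \<times> UNIV \<times> A) (\<lambda>(t, z, y, a). F t z y a)"
    and u: "continuous_on {t - \<tau>b..T} u" and t: "t \<in> {t0..T}" and \<alpha>: "\<alpha> \<in> controls A t T"
  shows "(\<lambda>s. rhs F u s (\<alpha> s)) \<in> borel_measurable (lebesgue_on {t<..<T})"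
  unfolding rhs_def
proof (rule carath_measurable[OF F])
  have "continuous_on {t<..<T} u" "continuous_on {t<..<T} (\<lambda>s. u (s - \<tau> s (u s)))"
    using u continuous_on_delayed_state[OF u t] max_delay_nonneg by (auto intro: continuous_on_subset)
  then show "u \<in> borel_measurable (lebesgue_on {t<..<T})"
      "(\<lambda>s. u (s - \<tau> s (u s))) \<in> borel_measurable (lebesgue_on {t<..<T})"
    by (auto intro: continuous_imp_measurable_on_sets_lebesgue)
qed (use t \<alpha> in \<open>auto simp: controls_def\<close>)

lemma f_growth: "\<exists>C>0. \<forall>t\<in>{t0..T}. \<forall>a\<in>A. \<forall>z y. norm (f t z y a) \<le> C * (1 + norm z + norm y)"
proof -
  obtain l where l: "l > 0" "\<And>t a z y z' y'. \<lbrakk>t \<in> {t0..T}; a \<in> A\<rbrakk> \<Longrightarrow>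
      norm (f t z y a - f t z' y' a) \<le> l * (norm (z - z') + norm (y - y'))"
    using f_lip by blast
  have "compact ((\<lambda>(t, a). f t 0 0 a) ` ({t0..T} \<times> A))"
  proof (rule compact_continuous_image)
    have "continuous_on ({t0..T} \<times> A) (\<lambda>q. (\<lambda>(t, z, y, a). f t z y a) (fst q, 0, 0, snd q))"
      by (rule continuous_on_compose2[OF f_cont]) (auto intro!: continuous_intros)
    then show "continuous_on ({t0..T} \<times> A) (\<lambda>(t, a). f t 0 0 a)"
      by (simp add: case_prod_unfold)
  qed (simp add: A_compact compact_Times)
  then obtain B where B: "\<And>t a. \<lbrakk>t \<in> {t0..T}; a \<in> A\<rbrakk> \<Longrightarrow> norm (f t 0 0 a) \<le> B"
    using compact_imp_bounded bounded_iff by (force simp: bounded_iff)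
  have "norm (f t z y a) \<le> max B l * (1 + norm z + norm y)" if "t \<in> {t0..T}" "a \<in> A" for t a z y
  proof -
    have "norm (f t z y a) \<le> norm (f t 0 0 a) + norm (f t z y a - f t 0 0 a)"
      by (metis add.commute diff_add_cancel norm_triangle_ineq)
    also have "\<dots> \<le> B + l * (norm z + norm y)"
      using B[OF that] l(2)[OF that, of z y 0 0] by simp
    also have "\<dots> \<le> max B l + max B l * (norm z + norm y)"
      by (intro add_mono mult_right_mono) auto
    finally show ?thesis by (simp add: algebra_simps)
  qed
  then show ?thesis using \<open>l > 0\<close> by (intro exI[of _ "max B l"]) auto
qed

text \<open>The delayed points D1 and D2 of u and v differ by at most \<open>k * E\<close>, and the
  Lipschitz constant C of u turns this shift into \<open>C * k * E\<close>. The remaining 2 counts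
  the difference of the states at time s and of the delayed states at the common point D2. The
  detour through u at D2 is why only u has to be Lipschitz. The set Z admits functions that are
  Lipschitz on bounded sets only.\<close>

lemma rhs_diff:
  assumes F: "\<And>z y z' y'. \<lbrakk>z \<in> Z; y \<in> Z; z' \<in> Z; y' \<in> Z\<rbrakk> \<Longrightarrow>
      norm (F s z y a - F s z' y' a :: 'c::real_normed_vector) \<le> l * (norm (z - z') + norm (y - y'))"
    and u: "C-lipschitz_on {t - \<tau>b..T} u" and l: "l \<ge> 0"
    and \<tau>: "k \<ge> 0" "\<And>z y. \<bar>\<tau> s z - \<tau> s y\<bar> \<le> k * norm (z - y)"
    and s: "s \<in> {t0..T}" "t \<le> s"
    and E: "\<And>r. r \<in> {t - \<tau>b..s} \<Longrightarrow> norm (u r - v r) \<le> E"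
    and Z: "u ` {t - \<tau>b..T} \<subseteq> Z" "v ` {t - \<tau>b..T} \<subseteq> Z"
  shows "norm (rhs F u s a - rhs F v s a) \<le> l * (2 + C * k) * E"
proof -
  define D1 D2 where "D1 = s - \<tau> s (u s)" and "D2 = s - \<tau> s (v s)"
  have D: "D1 \<in> {t - \<tau>b..s}" "D2 \<in> {t - \<tau>b..s}"
    unfolding D1_def D2_def by (rule delayed_time_in[OF s])+
  have "s \<in> {t - \<tau>b..s}" using s max_delay_nonneg by simp
  note Es = E[OF this]
  have C0: "C \<ge> 0" using lipschitz_on_nonneg[OF u] .
  have "norm (u D1 - u D2) \<le> C * norm (D1 - D2)"
    by (rule lipschitz_on_normD[OF u]) (use D s in auto)
  also have "norm (D1 - D2) \<le> k * norm (u s - v s)"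
    using \<tau>(2)[of "v s" "u s"] by (simp add: D1_def D2_def norm_minus_commute)
  also have "\<dots> \<le> k * E" by (rule mult_left_mono[OF Es \<tau>(1)])
  finally have 1: "norm (u D1 - u D2) \<le> C * (k * E)" using C0 by (simp add: mult_left_mono)
  have "norm (u D1 - v D2) \<le> norm (u D1 - u D2) + norm (u D2 - v D2)"
    by (metis diff_add_cancel add_diff_eq norm_triangle_ineq)
  with 1 E[OF D(2)] have 2: "norm (u D1 - v D2) \<le> C * (k * E) + E" by linarith
  have "norm (rhs F u s a - rhs F v s a) \<le> l * (norm (u s - v s) + norm (u D1 - v D2))"
    unfolding rhs_def D1_def[symmetric] D2_def[symmetric]
    by (rule F) (use D s Z max_delay_nonneg in \<open>auto simp: image_subset_iff\<close>)
  also have "\<dots> \<le> l * (E + (C * (k * E) + E))"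
    by (intro mult_left_mono add_mono Es 2 l)
  finally show ?thesis by (simp add: algebra_simps)
qed

lemma f_rhs_diff:
  "\<exists>K>0. \<forall>t u v s a E. C-lipschitz_on {t - \<tau>b..T} u \<longrightarrow> s \<in> {t0..T} \<longrightarrow> t \<le> s \<longrightarrow> a \<in> A \<longrightarrow>
     (\<forall>r\<in>{t - \<tau>b..s}. norm (u r - v r) \<le> E) \<longrightarrow> norm (rhs f u s a - rhs f v s a) \<le> K * E"
proof -
  obtain l where l: "l > 0" "\<And>t a z y z' y'. \<lbrakk>t \<in> {t0..T}; a \<in> A\<rbrakk> \<Longrightarrow>
      norm (f t z y a - f t z' y' a) \<le> l * (norm (z - z') + norm (y - y'))"
    using f_lip by blast
  obtain k where k: "k > 0" "\<And>t z y. t \<in> {t0..T} \<Longrightarrow> \<bar>\<tau> t z - \<tau> t y\<bar> \<le> k * norm (z - y)"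
    using \<tau>_lip by blast
  \<comment> \<open>The absolute value keeps the constant positive for every C; for negative C there
    is no C-Lipschitz u.\<close>
  have "norm (rhs f u s a - rhs f v s a) \<le> l * (2 + \<bar>C\<bar> * k) * E"
    if u: "C-lipschitz_on {t - \<tau>b..T} u" and s: "s \<in> {t0..T}" "t \<le> s" "a \<in> A"
      "\<forall>r\<in>{t - \<tau>b..s}. norm (u r - v r) \<le> E" for t u v s a E
    using rhs_diff[where F = f and Z = UNIV, OF _ u, of s a l k v E] l k s lipschitz_on_nonneg[OF u] by simp
  moreover have "l * (2 + \<bar>C\<bar> * k) > 0" using l k by (simp add: add_pos_nonneg)
  ultimately show ?thesis by blast
qed

lemma rhs_integrable:
  fixes F :: "real \<Rightarrow> real^'n \<Rightarrow> real^'n \<Rightarrow> real^'m \<Rightarrow> 'c::euclidean_space"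
  assumes F: "continuous_on ({t0..T} \<times> UNIV \<times> UNIV \<times> A) (\<lambda>(t, z, y, a). F t z y a)"
    and growth: "\<exists>C>0. \<forall>t\<in>{t0..T}. \<forall>a\<in>A. \<forall>z y. norm (F t z y a) \<le> C * (1 + norm z + norm y)"
    and u: "continuous_on {t - \<tau>b..T} u" and t: "t \<in> {t0..T}" and \<alpha>: "\<alpha> \<in> controls A t T"
    and "t \<le> c" "d \<le> T"
  shows "(\<lambda>s. rhs F u s (\<alpha> s)) absolutely_integrable_on {c..d}"
proof -
  obtain C where C: "C > 0" "\<And>t a z y. \<lbrakk>t \<in> {t0..T}; a \<in> A\<rbrakk> \<Longrightarrow> norm (F t z y a) \<le> C * (1 + norm z + norm y)"
    using growth by blast
  have "compact (u ` {t - \<tau>b..T})" using u by (intro compact_continuous_image) auto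
  then obtain B where B: "\<And>s. s \<in> {t - \<tau>b..T} \<Longrightarrow> norm (u s) \<le> B"
    using compact_imp_bounded bounded_iff by (metis imageI)
  show ?thesis
  proof (rule bounded_measurable_absolutely_integrable[OF rhs_measurable[OF F u t \<alpha>]])
    fix s assume s: "s \<in> {t<..<T}"
    then have "s \<in> {t0..T}" "\<alpha> s \<in> A" using t \<alpha> by (auto simp: controls_def)
    then have "norm (rhs F u s (\<alpha> s)) \<le> C * (1 + norm (u s) + norm (u (s - \<tau> s (u s))))"
      unfolding rhs_def by (rule C)
    also have "\<dots> \<le> C * (1 + B + B)"
      using C(1) s max_delay_nonneg delayed_time_in[of s t "u s"] \<open>s \<in> {t0..T}\<close>
      by (intro mult_left_mono add_mono B) auto
    finally show "norm (rhs F u s (\<alpha> s)) \<le> C * (1 + B + B)" .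
  qed fact+
qed

lemmas rhs_f_integrable = rhs_integrable[OF f_cont f_growth]

lemma rhs_L_integrable:
  assumes "continuous_on {t - \<tau>b..T} u" "t \<in> {t0..T}" "\<alpha> \<in> controls A t T" "t \<le> c" "d \<le> T"
  shows "(\<lambda>s. rhs L u s (\<alpha> s)) absolutely_integrable_on {c..d}"
  by (rule rhs_integrable[OF L_cont _ assms]) (use L_growth in auto)

text \<open>One direction is the fundamental theorem for Lipschitz functions, the other Lebesgue
  differentiation. The integral form is the one that passes to limits and depends only on values in
  the time interval.\<close>

lemma is_solution_iff_integral:
  assumes t: "t \<in> {t0..T}" and \<alpha>: "\<alpha> \<in> controls A t T"
  shows "solves t w \<alpha> x \<longleftrightarrow>
    (\<exists>C. C-lipschitz_on {t - \<tau>b..T} x) \<and> (\<forall>\<theta>\<in>{-\<tau>b..0}. x (t + \<theta>) = w \<theta>) \<and>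
    (\<forall>s\<in>{t..T}. x s = w 0 + integral {t..s} (\<lambda>r. rhs f x r (\<alpha> r)))"
    (is "_ \<longleftrightarrow> ?R")
proof
  assume sol: "solves t w \<alpha> x"
  then obtain C where C: "C-lipschitz_on {t - \<tau>b..T} x" and init: "\<forall>\<theta>\<in>{-\<tau>b..0}. x (t + \<theta>) = w \<theta>"
    and D: "AE s in lebesgue_on {t<..<T}. (x has_vector_derivative rhs f x s (\<alpha> s)) (at s)"
    by (auto simp: is_solution_def rhs_def)
  have xt: "x t = w 0" using init[rule_format, of 0] max_delay_nonneg by simp
  have "x s = w 0 + integral {t..s} (\<lambda>r. rhs f x r (\<alpha> r))" if s: "s \<in> {t..T}" for s
  proof -
    have "C-lipschitz_on {t..s} x"
      by (rule lipschitz_on_subset[OF C]) (use s max_delay_nonneg in auto)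
    moreover have "AE r in lebesgue_on {t<..<s}. (x has_vector_derivative rhs f x r (\<alpha> r)) (at r)"
      using D s by (auto simp: AE_lebesgue_on_iff_negligible elim!: negligible_subset)
    ultimately have "((\<lambda>r. rhs f x r (\<alpha> r)) has_integral x s - x t) {t..s}"
      using s by (intro lipschitz_has_integral_vector_derivative) auto
    then show ?thesis using xt by (simp add: integral_unique)
  qed
  with C init show ?R by blast
next
  assume R: ?R
  then obtain C where C: "C-lipschitz_on {t - \<tau>b..T} x" by blast
  have "(\<lambda>s. rhs f x s (\<alpha> s)) absolutely_integrable_on {t..T}"
    by (rule rhs_f_integrable[OF lipschitz_on_continuous_on[OF C] t \<alpha>]) auto
  then have "(\<lambda>s. rhs f x s (\<alpha> s)) integrable_on {t..T}"
    using set_lebesgue_integral_eq_integral(1) by blast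
  from indefinite_integral_has_vector_derivative_AE[OF this]
  have "AE s in lebesgue_on {t<..<T}. (x has_vector_derivative f s (x s) (x (s - \<tau> s (x s))) (\<alpha> s)) (at s)"
  proof (rule lebesgue_on_mono)
    fix s assume s: "s \<in> {t<..<T}"
      and D: "((\<lambda>u. integral {t..u} (\<lambda>s. rhs f x s (\<alpha> s))) has_vector_derivative rhs f x s (\<alpha> s)) (at s)"
    have "((\<lambda>u. w 0 + integral {t..u} (\<lambda>s. rhs f x s (\<alpha> s))) has_vector_derivative 0 + rhs f x s (\<alpha> s)) (at s)"
      by (intro derivative_intros D)
    then have "(x has_vector_derivative 0 + rhs f x s (\<alpha> s)) (at s)"
      by (rule has_vector_derivative_transform_within_open[where S = "{t<..<T}"]) (use s R in auto)
    then show "(x has_vector_derivative f s (x s) (x (s - \<tau> s (x s))) (\<alpha> s)) (at s)"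
      by (simp add: rhs_def)
  qed
  with R show "solves t w \<alpha> x" by (simp add: is_solution_def)
qed

section \<open>A priori bounds, stability, uniqueness and existence of trajectories\<close>

lemma solution_initial:
  assumes "solves t w \<alpha> x" "s \<in> {t - \<tau>b..t}"
  shows "x s = w (s - t)"
proof -
  have "\<forall>\<theta>\<in>{-\<tau>b..0}. x (t + \<theta>) = w \<theta>" using assms(1) by (simp add: is_solution_def)
  from bspec[OF this, of "s - t"] show ?thesis using assms(2) by simp
qed

lemma solution_integral:
  assumes "solves t w \<alpha> x" "t \<in> {t0..T}" "\<alpha> \<in> controls A t T" "s \<in> {t..T}"
  shows "x s = w 0 + integral {t..s} (\<lambda>r. rhs f x r (\<alpha> r))"
  using assms is_solution_iff_integral by blast

lemma solution_continuous: "solves t w \<alpha> x \<Longrightarrow> continuous_on {t - \<tau>b..T} x"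
  unfolding is_solution_def using lipschitz_on_continuous_on by blast

lemma rhs_f_integrable_on:
  assumes "continuous_on {t - \<tau>b..T} u" "t \<in> {t0..T}" "\<alpha> \<in> controls A t T" "t \<le> c" "d \<le> T"
  shows "(\<lambda>s. rhs f u s (\<alpha> s)) integrable_on {c..d}"
  using rhs_f_integrable[OF assms] set_lebesgue_integral_eq_integral(1) by blast

lemma Lip_bounded:
  assumes "w \<in> Lip \<tau>b"
  obtains B where "\<And>\<theta>. \<theta> \<in> {-\<tau>b..0} \<Longrightarrow> norm (w \<theta>) \<le> B" "B \<ge> 0"
proof -
  obtain C where "C-lipschitz_on {-\<tau>b..0} w" using assms by (auto simp: Lip_def)
  then have "compact (w ` {-\<tau>b..0})"
    by (intro compact_continuous_image) (auto intro: lipschitz_on_continuous_on)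
  then obtain B where "\<forall>y\<in>w ` {-\<tau>b..0}. norm y \<le> B" using compact_imp_bounded bounded_iff by metis
  then show ?thesis by (intro that[of "max B 0"]) force+
qed

lemma lipschitz_on_shifted_initial:
  assumes w: "Cw-lipschitz_on {-\<tau>b..0} w" and "Cw \<le> C" and eq: "\<And>s. s \<in> {t - \<tau>b..t} \<Longrightarrow> u s = w (s - t)"
  shows "C-lipschitz_on {t - \<tau>b..t} u"
proof (rule lipschitz_onI)
  fix r s assume rs: "r \<in> {t - \<tau>b..t}" "s \<in> {t - \<tau>b..t}"
  have "dist (w (r - t)) (w (s - t)) \<le> Cw * dist (r - t) (s - t)"
    by (rule lipschitz_onD[OF w]) (use rs in auto)
  also have "\<dots> \<le> C * dist r s" using \<open>Cw \<le> C\<close> by (simp add: mult_right_mono dist_real_def)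
  finally show "dist (u r) (u s) \<le> C * dist r s" using eq rs by simp
qed (use lipschitz_on_nonneg[OF w] \<open>Cw \<le> C\<close> in simp)

text \<open>Adding 1 to the norm makes linear growth homogeneous, as both the present and the
  delayed norm plus the constant are at most twice the running bound; hence the Gronwall rate K is
  \<open>2 * Cf\<close>. The bounds are uniform in the control, so all needle variations share
  them.\<close>

lemma solution_bounds:
  assumes t: "t \<in> {t0..T}" and w: "w \<in> Lip \<tau>b"
  shows "\<exists>R>0. \<exists>C. \<forall>\<alpha>\<in>controls A t T. \<forall>x. solves t w \<alpha> x \<longrightarrow>
     (\<forall>s\<in>{t - \<tau>b..T}. norm (x s) \<le> R) \<and> C-lipschitz_on {t - \<tau>b..T} x"
proof -
  obtain Cf where Cf: "Cf > 0"
    "\<And>t a z y. \<lbrakk>t \<in> {t0..T}; a \<in> A\<rbrakk> \<Longrightarrow> norm (f t z y a) \<le> Cf * (1 + norm z + norm y)"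
    using f_growth by blast
  obtain B where B: "\<And>\<theta>. \<theta> \<in> {-\<tau>b..0} \<Longrightarrow> norm (w \<theta>) \<le> B" "B \<ge> 0"
    using Lip_bounded[OF w] by blast
  obtain Cw where Cw: "Cw-lipschitz_on {-\<tau>b..0} w" using w by (auto simp: Lip_def)
  define K where "K = 2 * Cf"
  have K: "K > 0" using Cf by (simp add: K_def)
  define R where "R = 2 * (1 + B) * exp (2 * K * (T - t))"
  have R0: "R > 0" using B by (simp add: R_def)
  define C where "C = max Cw (Cf * (1 + R + R))"
  have "(\<forall>s\<in>{t - \<tau>b..T}. norm (x s) \<le> R) \<and> C-lipschitz_on {t - \<tau>b..T} x"
    if \<alpha>: "\<alpha> \<in> controls A t T" and x: "solves t w \<alpha> x" for \<alpha> x
  proof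
    have f_bound: "norm (rhs f x r (\<alpha> r)) \<le> Cf * (E + E)" if "r \<in> {t<..<T}"
      "\<And>r'. r' \<in> {t - \<tau>b..r} \<Longrightarrow> 1 + norm (x r') \<le> E" for r E
    proof -
      have r: "r \<in> {t0..T}" "\<alpha> r \<in> A" using that t \<alpha> by (auto simp: controls_def)
      then have "norm (rhs f x r (\<alpha> r)) \<le> Cf * (1 + norm (x r) + norm (x (r - \<tau> r (x r))))"
        unfolding rhs_def by (rule Cf(2))
      also have "\<dots> \<le> Cf * (E + E)"
        using that(2)[of r] that(2)[of "r - \<tau> r (x r)"] delayed_time_in[of r t "x r"] r that(1)
          max_delay_nonneg Cf(1) by (intro mult_left_mono) auto
      finally show ?thesis .
    qed
    have bound: "1 + norm (x s) \<le> R" if s: "s \<in> {t - \<tau>b..T}" for s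
      unfolding R_def
    proof (rule weighted_gronwall[OF _ max_delay_nonneg K _ _ _ _ s])
      show "t \<le> T" using t by simp
      show "continuous_on {t - \<tau>b..T} (\<lambda>s. 1 + norm (x s))"
        using solution_continuous[OF x] by (intro continuous_intros)
      show "1 + norm (x s) \<le> 1 + B" if "s \<in> {t - \<tau>b..t}" for s
        using solution_initial[OF x that] B(1)[of "s - t"] that by simp
      fix M s assume M: "0 \<le> M" and s: "s \<in> {t..T}"
        and E: "\<And>r r'. \<lbrakk>r \<in> {t..s}; r' \<in> {t - \<tau>b..r}\<rbrakk> \<Longrightarrow> 1 + norm (x r') \<le> M * exp (2 * K * (r - t))"
      have "norm (integral {t..s} (\<lambda>r. rhs f x r (\<alpha> r))) \<le> M * exp (2 * K * (s - t)) / 2"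
      proof (rule integral_norm_bound_exp[OF _ _ K M])
        show "(\<lambda>r. rhs f x r (\<alpha> r)) integrable_on {t..s}"
          using rhs_f_integrable_on[OF solution_continuous[OF x] t \<alpha>] s by simp
        fix r assume r: "r \<in> {t<..<s}"
        show "norm (rhs f x r (\<alpha> r)) \<le> K * (M * exp (2 * K * (r - t)))"
          using f_bound[of r "M * exp (2 * K * (r - t))"] E[of r] r s by (simp add: K_def)
      qed (use s in simp)
      moreover have "norm (x s) \<le> norm (w 0) + norm (integral {t..s} (\<lambda>r. rhs f x r (\<alpha> r)))"
        using solution_integral[OF x t \<alpha> s] norm_triangle_ineq by metis
      moreover have "norm (w 0) \<le> B" using B(1)[of 0] max_delay_nonneg by simp
      ultimately show "1 + norm (x s) \<le> 1 + B + M * exp (2 * K * (s - t)) / 2" by linarith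
    qed simp
    then show "\<forall>s\<in>{t - \<tau>b..T}. norm (x s) \<le> R" by force
    have "C-lipschitz_on {t..T} x"
    proof (rule lipschitz_on_transform)
      show "C-lipschitz_on {t..T} (\<lambda>s. w 0 + integral {t..s} (\<lambda>r. rhs f x r (\<alpha> r)))"
      proof (rule lipschitz_on_indefinite_integral)
        show "(\<lambda>r. rhs f x r (\<alpha> r)) integrable_on {t..T}"
          using rhs_f_integrable_on[OF solution_continuous[OF x] t \<alpha>] by simp
        show "0 \<le> C" using lipschitz_on_nonneg[OF Cw] by (simp add: C_def)
        fix r assume r: "r \<in> {t<..<T}"
        then have "norm (rhs f x r (\<alpha> r)) \<le> Cf * (R + R)"
          using bound by (intro f_bound) auto
        also have "\<dots> \<le> C" using Cf(1) R0 by (auto simp: C_def le_max_iff_disj)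
        finally show "norm (rhs f x r (\<alpha> r)) \<le> C" .
      qed
    qed (use solution_integral[OF x t \<alpha>] in simp)
    moreover have "C-lipschitz_on {t - \<tau>b..t} x"
      by (rule lipschitz_on_shifted_initial[OF Cw _ solution_initial[OF x]]) (simp_all add: C_def)
    ultimately show "C-lipschitz_on {t - \<tau>b..T} x" by (rule lipschitz_on_union_Icc[rotated])
  qed
  with R0 show ?thesis by blast
qed

text \<open>The difference of the two right-hand sides is split at y driven by \<alpha>. The first
  part compares two states under one control and goes into Gronwall's inequality. The second
  compares two controls along one state; it is bounded by \<open>2 * B\<close> and lives on {c..d}
  only, which produces the factor \<open>d - c\<close>.\<close>

lemma solution_stability:
  assumes t: "t \<in> {t0..T}" and w: "w \<in> Lip \<tau>b"
  shows "\<exists>K\<ge>0. \<forall>\<alpha>\<in>controls A t T. \<forall>\<beta>\<in>controls A t T. \<forall>x y c d.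
     solves t w \<alpha> x \<longrightarrow> solves t w \<beta> y \<longrightarrow> c \<le> d \<longrightarrow>
     (\<forall>s\<in>{t<..<T} - {c..d}. \<alpha> s = \<beta> s) \<longrightarrow> (\<forall>s\<in>{t - \<tau>b..T}. norm (x s - y s) \<le> K * (d - c))"
proof -
  obtain R C where R: "R > 0" and sol: "\<And>\<alpha> x. \<lbrakk>\<alpha> \<in> controls A t T; solves t w \<alpha> x\<rbrakk> \<Longrightarrow>
     (\<forall>s\<in>{t - \<tau>b..T}. norm (x s) \<le> R) \<and> C-lipschitz_on {t - \<tau>b..T} x"
    using solution_bounds[OF assms] by blast
  obtain Cf where Cf: "Cf > 0"
    "\<And>t a z y. \<lbrakk>t \<in> {t0..T}; a \<in> A\<rbrakk> \<Longrightarrow> norm (f t z y a) \<le> Cf * (1 + norm z + norm y)"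
    using f_growth by blast
  obtain K where K: "K > 0" "\<And>t u v s a E. \<lbrakk>C-lipschitz_on {t - \<tau>b..T} u; s \<in> {t0..T}; t \<le> s; a \<in> A;
     \<forall>r\<in>{t - \<tau>b..s}. norm (u r - v r) \<le> E\<rbrakk> \<Longrightarrow> norm (rhs f u s a - rhs f v s a) \<le> K * E"
    using f_rhs_diff[of C] by blast
  define B where "B = Cf * (1 + R + R)"
  have B0: "B > 0" using Cf R by (simp add: B_def add_pos_pos)
  have stable: "norm (x s - y s) \<le> 2 * (2 * B * (d - c)) * exp (2 * K * (T - t))"
    if \<alpha>: "\<alpha> \<in> controls A t T" "\<beta> \<in> controls A t T" and
      x: "solves t w \<alpha> x" and y: "solves t w \<beta> y" and cd: "c \<le> d"
      and eq: "\<forall>s\<in>{t<..<T} - {c..d}. \<alpha> s = \<beta> s" and s: "s \<in> {t - \<tau>b..T}" for \<alpha> \<beta> x y c d s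
  proof (rule weighted_gronwall[OF _ max_delay_nonneg K(1) _ _ _ _ s])
    show "t \<le> T" using t by simp
    show "continuous_on {t - \<tau>b..T} (\<lambda>s. norm (x s - y s))"
      by (intro continuous_intros solution_continuous[OF x] solution_continuous[OF y])
    show "norm (x s - y s) \<le> 2 * B * (d - c)" if "s \<in> {t - \<tau>b..t}" for s
      using solution_initial[OF x that] solution_initial[OF y that] B0 cd by simp
    fix M s assume M: "0 \<le> M" and s: "s \<in> {t..T}"
      and E: "\<And>r r'. \<lbrakk>r \<in> {t..s}; r' \<in> {t - \<tau>b..r}\<rbrakk> \<Longrightarrow> norm (x r' - y r') \<le> M * exp (2 * K * (r - t))"
    have fB: "norm (rhs f y r a) \<le> B" if "r \<in> {t..T}" "a \<in> A" for r a
    proof -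
      have r: "r \<in> {t0..T}" using t that by simp
      have "norm (rhs f y r a) \<le> Cf * (1 + norm (y r) + norm (y (r - \<tau> r (y r))))"
        unfolding rhs_def by (rule Cf(2)[OF r that(2)])
      also have "\<dots> \<le> B" unfolding B_def
        using sol[OF \<alpha>(2) y] delayed_time_in[of r t "y r"] r that(1) max_delay_nonneg Cf(1)
        by (intro mult_left_mono add_mono) auto
      finally show ?thesis .
    qed
    note ix = rhs_f_integrable_on[OF solution_continuous[OF x] t \<alpha>(1)]
    note iy = rhs_f_integrable_on[OF solution_continuous[OF y] t \<alpha>(2)]
    note iyx = rhs_f_integrable_on[OF solution_continuous[OF y] t \<alpha>(1)]
    have "norm (integral {t..s} (\<lambda>r. rhs f x r (\<alpha> r) - rhs f y r (\<alpha> r))) \<le> M * exp (2 * K * (s - t)) / 2"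
    proof (rule integral_norm_bound_exp[OF _ _ K(1) M])
      show "(\<lambda>r. rhs f x r (\<alpha> r) - rhs f y r (\<alpha> r)) integrable_on {t..s}"
        using s by (intro integrable_diff ix iyx) auto
      fix r assume r: "r \<in> {t<..<s}"
      show "norm (rhs f x r (\<alpha> r) - rhs f y r (\<alpha> r)) \<le> K * (M * exp (2 * K * (r - t)))"
        by (rule K(2)[of t]) (use sol[OF \<alpha>(1) x] r s t \<alpha>(1) E in \<open>auto simp: controls_def\<close>)
    qed (use s in simp)
    moreover have "norm (integral {t..s} (\<lambda>r. rhs f y r (\<alpha> r) - rhs f y r (\<beta> r))) \<le> 2 * B * (d - c)"
    proof -
      have "norm (integral {t..s} (\<lambda>r. rhs f y r (\<alpha> r) - rhs f y r (\<beta> r)))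
          \<le> integral {t..s} (\<lambda>r. if r \<in> {c..d} then 2 * B else 0)"
      proof (rule integral_norm_bound_interior)
        show "(\<lambda>r. rhs f y r (\<alpha> r) - rhs f y r (\<beta> r)) integrable_on {t..s}"
          using s by (intro integrable_diff iy iyx) auto
        show "(\<lambda>r. if r \<in> {c..d} then 2 * B else 0) integrable_on {t..s}"
          by (subst integrable_restrict_Int) (simp add: integrable_on_const)
        fix r assume r: "r \<in> {t<..<s}"
        then have "\<alpha> r \<in> A" "\<beta> r \<in> A" "r \<in> {t..T}" using \<alpha> s by (auto simp: controls_def)
        then have "norm (rhs f y r (\<alpha> r) - rhs f y r (\<beta> r)) \<le> B + B"
          using fB by (intro norm_triangle_le_diff add_mono)
        then show "norm (rhs f y r (\<alpha> r) - rhs f y r (\<beta> r)) \<le> (if r \<in> {c..d} then 2 * B else 0)"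
          using eq r s by auto
      qed
      also have "\<dots> = integral ({c..d} \<inter> {t..s}) (\<lambda>r. 2 * B)"
        by (rule integral_restrict_Int)
      also have "\<dots> \<le> integral {c..d} (\<lambda>r. 2 * B)"
        using B0 by (intro integral_subset_le) (auto simp: integrable_on_const)
      also have "\<dots> = 2 * B * (d - c)" using cd by simp
      finally show ?thesis .
    qed
    moreover
    have "x s - y s = integral {t..s} (\<lambda>r. rhs f x r (\<alpha> r) - rhs f y r (\<alpha> r))
        + integral {t..s} (\<lambda>r. rhs f y r (\<alpha> r) - rhs f y r (\<beta> r))"
    proof -
      have "(\<lambda>r. rhs f x r (\<alpha> r)) integrable_on {t..s}" "(\<lambda>r. rhs f y r (\<alpha> r)) integrable_on {t..s}"
          "(\<lambda>r. rhs f y r (\<beta> r)) integrable_on {t..s}"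
        using s by (auto intro: ix iy iyx)
      then show ?thesis
        unfolding solution_integral[OF x t \<alpha>(1) s] solution_integral[OF y t \<alpha>(2) s]
        by (simp add: Henstock_Kurzweil_Integration.integral_diff)
    qed
    then have "norm (x s - y s) \<le> norm (integral {t..s} (\<lambda>r. rhs f x r (\<alpha> r) - rhs f y r (\<alpha> r)))
        + norm (integral {t..s} (\<lambda>r. rhs f y r (\<alpha> r) - rhs f y r (\<beta> r)))"
      by (simp only: norm_triangle_ineq)
    ultimately show "norm (x s - y s) \<le> 2 * B * (d - c) + M * exp (2 * K * (s - t)) / 2"
      by linarith
  qed simp
  have "norm (x s - y s) \<le> 4 * B * exp (2 * K * (T - t)) * (d - c)"
    if "\<alpha> \<in> controls A t T" "\<beta> \<in> controls A t T" "solves t w \<alpha> x"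
      "solves t w \<beta> y" "c \<le> d" "\<forall>s\<in>{t<..<T} - {c..d}. \<alpha> s = \<beta> s" "s \<in> {t - \<tau>b..T}"
    for \<alpha> \<beta> x y c d s
  proof -
    have "2 * (2 * B * (d - c)) * E = 4 * B * E * (d - c)" for E by (simp add: algebra_simps)
    with stable[OF that] show ?thesis by metis
  qed
  moreover have "0 \<le> 4 * B * exp (2 * K * (T - t))" using B0 by simp
  ultimately show ?thesis
    by (intro exI[of _ "4 * B * exp (2 * K * (T - t))"] conjI ballI allI impI)
qed

lemma solution_unique:
  assumes t: "t \<in> {t0..T}" and w: "w \<in> Lip \<tau>b" and \<alpha>: "\<alpha> \<in> controls A t T"
    and "solves t w \<alpha> x" "solves t w \<alpha> y" "s \<in> {t - \<tau>b..T}"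
  shows "x s = y s"
proof -
  obtain K where "\<forall>\<alpha>\<in>controls A t T. \<forall>\<beta>\<in>controls A t T. \<forall>x y c d.
     solves t w \<alpha> x \<longrightarrow> solves t w \<beta> y \<longrightarrow> c \<le> d \<longrightarrow>
     (\<forall>s\<in>{t<..<T} - {c..d}. \<alpha> s = \<beta> s) \<longrightarrow> (\<forall>s\<in>{t - \<tau>b..T}. norm (x s - y s) \<le> K * (d - c))"
    using solution_stability[OF t w] by blast
  \<comment> \<open>The degenerate window c = d = t turns stability into uniqueness.\<close>
  from this[rule_format, OF \<alpha> \<alpha> assms(4,5), of t t s] assms(6) show ?thesis by simp
qed

text \<open>Picard iteration. Because of the state-dependent delay \<Phi> contracts only on
  functions with a common Lipschitz constant, so the iteration is confined to a set U that records
  this constant and a growth bound. Two exponential weights are used: V with the rate from the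
  growth of \<open>f\<close> makes U invariant, and W with the rate from \<open>f_rhs_diff\<close>
  makes \<Phi> contract by 1/2. The Lipschitz constant survives the limit.\<close>

lemma solution_exists:
  assumes t: "t \<in> {t0..T}" and w: "w \<in> Lip \<tau>b" and \<alpha>: "\<alpha> \<in> controls A t T"
  shows "\<exists>x. solves t w \<alpha> x"
proof -
  obtain Cf where Cf: "Cf > 0"
    "\<And>t a z y. \<lbrakk>t \<in> {t0..T}; a \<in> A\<rbrakk> \<Longrightarrow> norm (f t z y a) \<le> Cf * (1 + norm z + norm y)"
    using f_growth by blast
  obtain B where B: "\<And>\<theta>. \<theta> \<in> {-\<tau>b..0} \<Longrightarrow> norm (w \<theta>) \<le> B" "B \<ge> 0"
    using Lip_bounded[OF w] by blast
  obtain Cw where Cw: "Cw-lipschitz_on {-\<tau>b..0} w" using w by (auto simp: Lip_def)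
  define k where "k = 2 * Cf"
  have k: "k > 0" using Cf by (simp add: k_def)
  define V where "V r = exp (2 * k * max 0 (r - t))" for r
  have V1: "1 \<le> V r" for r using k by (simp add: V_def)
  have V_mono: "V r' \<le> V r" if "r' \<le> r" for r' r
    using that k unfolding V_def by (auto intro!: mult_left_mono)
  \<comment> \<open>The factor 2 leaves room: the initial data use up half of the bound
    \<open>M * V s\<close>, the integral term the other half.\<close>
  define M where "M = 2 * (1 + B)"
  have M0: "M \<ge> 0" using B by (simp add: M_def)
  define C where "C = max Cw (k * (M * V T))"
  have C0: "C \<ge> 0" using lipschitz_on_nonneg[OF Cw] by (simp add: C_def)
  obtain K where K: "K > 0" "\<And>t u v s a E. \<lbrakk>C-lipschitz_on {t - \<tau>b..T} u; s \<in> {t0..T}; t \<le> s; a \<in> A;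
     \<forall>r\<in>{t - \<tau>b..s}. norm (u r - v r) \<le> E\<rbrakk> \<Longrightarrow> norm (rhs f u s a - rhs f v s a) \<le> K * E"
    using f_rhs_diff[of C] by blast
  define \<Phi> where "\<Phi> u s = (if s \<le> t then w (s - t) else w 0 + integral {t..s} (\<lambda>r. rhs f u r (\<alpha> r)))"
    for u :: "real \<Rightarrow> real^'n" and s
  define U where "U = {u. (\<forall>s\<in>{t - \<tau>b..t}. u s = w (s - t)) \<and> C-lipschitz_on {t - \<tau>b..T} u \<and>
      (\<forall>s\<in>{t - \<tau>b..T}. 1 + norm (u s) \<le> M * V s)}"
  have \<Phi>_eq: "\<Phi> u s = w 0 + integral {t..s} (\<lambda>r. rhs f u r (\<alpha> r))" if "s \<in> {t..T}" for u s
    using that by (cases "s = t") (auto simp: \<Phi>_def)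
  have integrable: "(\<lambda>r. rhs f u r (\<alpha> r)) integrable_on {t..s}" if "C-lipschitz_on {t - \<tau>b..T} u" "s \<le> T" for u s
    using that by (intro rhs_f_integrable_on[OF _ t \<alpha>]) (auto intro: lipschitz_on_continuous_on)
  have init_lip: "C-lipschitz_on {t - \<tau>b..t} u" if "\<And>s. s \<in> {t - \<tau>b..t} \<Longrightarrow> u s = w (s - t)" for u
    by (rule lipschitz_on_shifted_initial[OF Cw _ that]) (simp_all add: C_def)
  have norm_init: "1 + norm (w (s - t)) \<le> M * V s / 2" if "s \<in> {t - \<tau>b..t}" for s
  proof -
    have "1 + norm (w (s - t)) \<le> M / 2 * 1" using B(1)[of "s - t"] that by (simp add: M_def)
    also have "\<dots> \<le> M / 2 * V s" using M0 V1 by (intro mult_left_mono) auto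
    finally show ?thesis by simp
  qed
  have \<Phi>_closed: "\<Phi> u \<in> U" if u: "u \<in> U" for u
  proof -
    have lip: "C-lipschitz_on {t - \<tau>b..T} u" and bd: "\<And>s. s \<in> {t - \<tau>b..T} \<Longrightarrow> 1 + norm (u s) \<le> M * V s"
      using u by (auto simp: U_def)
    have rhs_bound: "norm (rhs f u r (\<alpha> r)) \<le> k * (M * V r)" if r: "r \<in> {t<..<T}" for r
    proof -
      have "r \<in> {t0..T}" "\<alpha> r \<in> A" using that t \<alpha> by (auto simp: controls_def)
      then have "norm (rhs f u r (\<alpha> r)) \<le> Cf * (1 + norm (u r) + norm (u (r - \<tau> r (u r))))"
        unfolding rhs_def by (rule Cf(2))
      also have "\<dots> \<le> Cf * (M * V r + M * V r)"
      proof (rule mult_left_mono)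
        define D where "D = r - \<tau> r (u r)"
        have D: "D \<in> {t - \<tau>b..r}" unfolding D_def using \<open>r \<in> {t0..T}\<close> r by (intro delayed_time_in) auto
        have "1 + norm (u D) \<le> M * V D" using D r by (intro bd) auto
        also have "\<dots> \<le> M * V r" using D M0 by (intro mult_left_mono V_mono) auto
        finally have "1 + norm (u D) \<le> M * V r" .
        moreover have "1 + norm (u r) \<le> M * V r" using r max_delay_nonneg by (intro bd) auto
        ultimately show "1 + norm (u r) + norm (u (r - \<tau> r (u r))) \<le> M * V r + M * V r"
          unfolding D_def by linarith
      qed (use Cf in simp)
      finally show ?thesis by (simp add: k_def)
    qed
    have "C-lipschitz_on {t..T} (\<Phi> u)"
    proof (rule lipschitz_on_transform)
      show "C-lipschitz_on {t..T} (\<lambda>s. w 0 + integral {t..s} (\<lambda>r. rhs f u r (\<alpha> r)))"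
      proof (rule lipschitz_on_indefinite_integral[OF integrable[OF lip order_refl] _ C0])
        fix r assume r: "r \<in> {t<..<T}"
        have "norm (rhs f u r (\<alpha> r)) \<le> k * (M * V r)" by (rule rhs_bound[OF r])
        also have "\<dots> \<le> k * (M * V T)" using r k M0 by (intro mult_left_mono V_mono) auto
        also have "\<dots> \<le> C" by (simp add: C_def)
        finally show "norm (rhs f u r (\<alpha> r)) \<le> C" .
      qed
    qed (simp add: \<Phi>_eq)
    moreover have "C-lipschitz_on {t - \<tau>b..t} (\<Phi> u)" by (rule init_lip) (simp add: \<Phi>_def)
    ultimately have "C-lipschitz_on {t - \<tau>b..T} (\<Phi> u)" by (rule lipschitz_on_union_Icc[rotated])
    moreover have "1 + norm (\<Phi> u s) \<le> M * V s" if s: "s \<in> {t - \<tau>b..T}" for s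
    proof (cases "s \<le> t")
      case True
      then have "1 + norm (\<Phi> u s) \<le> M * V s / 2" using norm_init[of s] s by (simp add: \<Phi>_def)
      with norm_ge_zero[of "\<Phi> u s"] show ?thesis by linarith
    next
      case False
      have "norm (integral {t..s} (\<lambda>r. rhs f u r (\<alpha> r))) \<le> M * exp (2 * k * (s - t)) / 2"
      proof (rule integral_norm_bound_exp[OF integrable[OF lip] _ k M0])
        fix r assume "r \<in> {t<..<s}"
        then show "norm (rhs f u r (\<alpha> r)) \<le> k * (M * exp (2 * k * (r - t)))"
          using rhs_bound[of r] s by (simp add: V_def)
      qed (use s False in auto)
      moreover have "norm (\<Phi> u s) \<le> norm (w 0) + norm (integral {t..s} (\<lambda>r. rhs f u r (\<alpha> r)))"
        using False by (simp add: \<Phi>_def norm_triangle_ineq)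
      moreover have "1 + norm (w 0) \<le> M * V t / 2" using norm_init[of t] max_delay_nonneg by simp
      moreover have "M * V t \<le> M * V s" using False M0 by (intro mult_left_mono V_mono) auto
      ultimately show ?thesis using False by (simp add: V_def)
    qed
    ultimately show ?thesis by (simp add: U_def \<Phi>_def)
  qed
  \<comment> \<open>The iteration starts from the initial function, continued after t by its value
    at 0.\<close>
  define u where "u n = (\<Phi> ^^ n) (\<lambda>s. w (min 0 (s - t)))" for n
  have "u 0 \<in> U"
  proof -
    have "C-lipschitz_on {t - \<tau>b..t} (u 0)" by (rule init_lip) (simp add: u_def)
    moreover have "C-lipschitz_on {t..T} (u 0)"
      by (rule lipschitz_on_transform[of _ _ "\<lambda>_. w 0"])
        (use C0 in \<open>auto simp: u_def intro!: lipschitz_onI\<close>)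
    ultimately have "C-lipschitz_on {t - \<tau>b..T} (u 0)" by (rule lipschitz_on_union_Icc)
    moreover have "1 + norm (u 0 s) \<le> M * V s" if s: "s \<in> {t - \<tau>b..T}" for s
    proof -
      have "1 + norm (w (min s t - t)) \<le> M * V (min s t) / 2"
        using s max_delay_nonneg t by (intro norm_init) auto
      also have "\<dots> \<le> M * V s"
        using M0 V1[of s] V_mono[of "min s t" s] mult_mono[of "M / 2" M "V (min s t)" "V s"]
        by (simp add: V_def)
      finally show ?thesis by (cases "s \<le> t") (auto simp: u_def min_def)
    qed
    ultimately show ?thesis by (simp add: U_def u_def)
  qed
  then have u_U: "u n \<in> U" for n
    by (induction n) (use \<Phi>_closed in \<open>auto simp: u_def\<close>)
  have u_lip: "C-lipschitz_on {t - \<tau>b..T} (u n)" for n using u_U by (auto simp: U_def)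
  have u_Suc: "u (Suc n) = \<Phi> (u n)" for n by (simp add: u_def)
  define W where "W r = exp (2 * K * max 0 (r - t))" for r
  have W1: "1 \<le> W r" for r using K(1) by (simp add: W_def)
  have W_mono: "W r' \<le> W r" if "r' \<le> r" for r' r
    using that K(1) unfolding W_def by (auto intro!: mult_left_mono)
  \<comment> \<open>All iterates are bounded by \<open>M * V T\<close>, so twice this bounds the
    difference of the first two.\<close>
  define M' where "M' = 2 * (M * V T)"
  have M'0: "M' \<ge> 0" using M0 V1[of T] by (simp add: M'_def)
  have contract: "norm (u (Suc n) s - u n s) \<le> M' * (1/2) ^ n * W s" if "s \<in> {t - \<tau>b..T}" for n s
    using that
  proof (induction n arbitrary: s)
    case 0
    have "norm (u n s) \<le> M * V T" for n
    proof -
      have "1 + norm (u n s) \<le> M * V s" using u_U[of n] 0 by (auto simp: U_def)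
      also have "\<dots> \<le> M * V T" using 0 M0 by (intro mult_left_mono V_mono) auto
      finally show ?thesis by simp
    qed
    then have "norm (u (Suc 0) s - u 0 s) \<le> M' * 1"
      unfolding M'_def using norm_triangle_le_diff[OF add_mono] by (metis mult.right_neutral mult_2)
    also have "\<dots> \<le> M' * W s" using M'0 W1 by (intro mult_left_mono) auto
    finally show ?case by simp
  next
    case (Suc n)
    have E0: "0 \<le> M' * (1/2) ^ n" using M'0 by simp
    show ?case
    proof (cases "s \<le> t")
      case True
      then show ?thesis using M'0 W1[of s] by (simp add: u_Suc \<Phi>_def)
    next
      case False
      then have s: "s \<in> {t..T}" using Suc.prems by simp
      have "norm (integral {t..s} (\<lambda>r. rhs f (u (Suc n)) r (\<alpha> r) - rhs f (u n) r (\<alpha> r)))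
          \<le> M' * (1/2) ^ n * exp (2 * K * (s - t)) / 2"
      proof (rule integral_norm_bound_exp[OF _ _ K(1) E0])
        show "(\<lambda>r. rhs f (u (Suc n)) r (\<alpha> r) - rhs f (u n) r (\<alpha> r)) integrable_on {t..s}"
          using s by (intro integrable_diff integrable[OF u_lip]) auto
        fix r assume r: "r \<in> {t<..<s}"
        show "norm (rhs f (u (Suc n)) r (\<alpha> r) - rhs f (u n) r (\<alpha> r))
            \<le> K * (M' * (1/2) ^ n * exp (2 * K * (r - t)))"
        proof (rule K(2)[OF u_lip])
          show "\<forall>q\<in>{t - \<tau>b..r}. norm (u (Suc n) q - u n q) \<le> M' * (1/2) ^ n * exp (2 * K * (r - t))"
          proof
            fix q assume q: "q \<in> {t - \<tau>b..r}"
            have "norm (u (Suc n) q - u n q) \<le> M' * (1/2) ^ n * W q" using q r s by (intro Suc.IH) auto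
            also have "\<dots> \<le> M' * (1/2) ^ n * W r" using q E0 by (intro mult_left_mono W_mono) auto
            finally show "norm (u (Suc n) q - u n q) \<le> M' * (1/2) ^ n * exp (2 * K * (r - t))"
              using r by (simp add: W_def)
          qed
        qed (use r s t \<alpha> in \<open>auto simp: controls_def\<close>)
      qed (use s in simp)
      moreover have "u (Suc (Suc n)) s - u (Suc n) s
          = integral {t..s} (\<lambda>r. rhs f (u (Suc n)) r (\<alpha> r) - rhs f (u n) r (\<alpha> r))"
      proof -
        have "u (Suc m) s = w 0 + integral {t..s} (\<lambda>r. rhs f (u m) r (\<alpha> r))" for m
          unfolding u_Suc by (rule \<Phi>_eq[OF s])
        moreover have "(\<lambda>r. rhs f (u m) r (\<alpha> r)) integrable_on {t..s}" for m
          using s by (intro integrable[OF u_lip]) simp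
        ultimately show ?thesis
          by (simp only: add_diff_cancel_left Henstock_Kurzweil_Integration.integral_diff)
      qed
      ultimately show ?thesis using False by (simp add: W_def)
    qed
  qed
  \<comment> \<open>The limit is written as a telescoping series, since \<open>contract\<close>
    bounds its terms by a geometric series.\<close>
  define x where "x s = u 0 s + (\<Sum>i. u (Suc i) s - u i s)" for s
  have unif: "uniform_limit {t - \<tau>b..T} (\<lambda>n s. u n s) x sequentially"
  proof -
    have "uniform_limit {t - \<tau>b..T} (\<lambda>n s. \<Sum>i<n. u (Suc i) s - u i s) (\<lambda>s. \<Sum>i. u (Suc i) s - u i s) sequentially"
    proof (rule Weierstrass_m_test)
      fix n s assume s: "s \<in> {t - \<tau>b..T}"
      have "norm (u (Suc n) s - u n s) \<le> M' * (1/2) ^ n * W s" by (rule contract[OF s])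
      also have "\<dots> \<le> M' * (1/2) ^ n * W T" using s M'0 by (intro mult_left_mono W_mono) auto
      finally show "norm (u (Suc n) s - u n s) \<le> M' * (1/2) ^ n * W T" .
    next
      show "summable (\<lambda>n. M' * (1/2) ^ n * W T)"
        by (intro summable_mult2 summable_mult summable_geometric) simp
    qed
    then have "uniform_limit {t - \<tau>b..T} (\<lambda>n s. u 0 s + (\<Sum>i<n. u (Suc i) s - u i s)) x sequentially"
      unfolding x_def by (intro uniform_limit_intros)
    moreover have "u 0 s + (\<Sum>i<n. u (Suc i) s - u i s) = u n s" for n s
      by (subst sum_lessThan_telescope) simp
    ultimately show ?thesis by simp
  qed
  have lim: "(\<lambda>n. u n s) \<longlonglongrightarrow> x s" if "s \<in> {t - \<tau>b..T}" for s
    by (rule tendsto_uniform_limitI[OF unif that])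
  have x_lip: "C-lipschitz_on {t - \<tau>b..T} x"
  proof (rule lipschitz_onI[OF _ C0])
    fix r s assume rs: "r \<in> {t - \<tau>b..T}" "s \<in> {t - \<tau>b..T}"
    have "(\<lambda>n. dist (u n r) (u n s)) \<longlonglongrightarrow> dist (x r) (x s)"
      by (intro tendsto_dist lim rs)
    then show "dist (x r) (x s) \<le> C * dist r s"
      by (rule LIMSEQ_le_const2) (use lipschitz_onD[OF u_lip] rs in blast)
  qed
  have x_init: "x s = w (s - t)" if "s \<in> {t - \<tau>b..t}" for s
  proof -
    have "u n s = w (s - t)" for n using u_U[of n] that by (auto simp: U_def)
    then have "(\<lambda>n. u n s) \<longlonglongrightarrow> w (s - t)" by simp
    moreover have "s \<in> {t - \<tau>b..T}" using that t by auto
    ultimately show ?thesis using lim LIMSEQ_unique by blast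
  qed
  have x_int: "x s = w 0 + integral {t..s} (\<lambda>r. rhs f x r (\<alpha> r))" if s: "s \<in> {t..T}" for s
  proof -
    have "(\<lambda>n. \<Phi> (u n) s) \<longlonglongrightarrow> \<Phi> x s"
    proof (rule LIMSEQ_I)
      fix e :: real assume e: "e > 0"
      \<comment> \<open>The summand 1 keeps the denominator positive also when t = T.\<close>
      define d where "d = e / (2 * K * (1 + (T - t)))"
      have d: "d > 0" using e K(1) t by (simp add: d_def)
      have "\<forall>\<^sub>F n in sequentially. \<forall>r\<in>{t - \<tau>b..T}. dist (u n r) (x r) < d"
        by (rule uniform_limitD[OF unif d])
      then obtain N where N: "\<And>n r. \<lbrakk>n \<ge> N; r \<in> {t - \<tau>b..T}\<rbrakk> \<Longrightarrow> dist (u n r) (x r) < d"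
        unfolding eventually_sequentially by blast
      have "norm (\<Phi> (u n) s - \<Phi> x s) < e" if "n \<ge> N" for n
      proof -
        have "(\<lambda>r. rhs f (u n) r (\<alpha> r)) integrable_on {t..s}" "(\<lambda>r. rhs f x r (\<alpha> r)) integrable_on {t..s}"
          using s by (auto intro: integrable[OF u_lip] integrable[OF x_lip])
        then have "\<Phi> (u n) s - \<Phi> x s = integral {t..s} (\<lambda>r. rhs f (u n) r (\<alpha> r) - rhs f x r (\<alpha> r))"
          by (simp only: \<Phi>_eq[OF s] add_diff_cancel_left Henstock_Kurzweil_Integration.integral_diff)
        also have "norm \<dots> \<le> K * d * (s - t)"
        proof (rule integral_norm_bound_const_interior)
          show "(\<lambda>r. rhs f (u n) r (\<alpha> r) - rhs f x r (\<alpha> r)) integrable_on {t..s}"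
            using s by (intro integrable_diff integrable[OF u_lip] integrable[OF x_lip]) auto
          fix r assume r: "r \<in> {t<..<s}"
          show "norm (rhs f (u n) r (\<alpha> r) - rhs f x r (\<alpha> r)) \<le> K * d"
          proof (rule K(2)[OF u_lip])
            show "\<forall>q\<in>{t - \<tau>b..r}. norm (u n q - x q) \<le> d"
              using N[OF that] r s by (force simp: dist_norm)
          qed (use r s t \<alpha> in \<open>auto simp: controls_def\<close>)
        qed (use s in simp)
        also have "\<dots> \<le> K * d * (1 + (T - t))"
          using s K(1) d by (intro mult_left_mono) auto
        also have "\<dots> < e"
        proof -
          have "K * (e / (2 * K * l)) * l = e / 2" if "l > 0" for l using K(1) that by (simp add: field_simps)
          from this[of "1 + (T - t)"] have "K * d * (1 + (T - t)) = e / 2" using t by (simp add: d_def)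
          then show ?thesis using e by simp
        qed
        finally show ?thesis .
      qed
      then show "\<exists>N. \<forall>n\<ge>N. norm (\<Phi> (u n) s - \<Phi> x s) < e" by blast
    qed
    moreover have "(\<lambda>n. u (Suc n) s) \<longlonglongrightarrow> x s"
      using lim[of s] s max_delay_nonneg by (intro LIMSEQ_Suc) auto
    ultimately show ?thesis
      by (simp add: u_Suc \<Phi>_eq[OF s, symmetric] LIMSEQ_unique)
  qed
  have "solves t w \<alpha> x"
    using x_lip x_init x_int by (subst is_solution_iff_integral[OF t \<alpha>]) auto
  then show ?thesis by blast
qed

text \<open>This lets an arbitrary solution be restricted to the interval, as the normalisation by
  \<open>extensional\<close> in \<open>trajectory\<close> demands. In the integral form the delayed
  times never leave {t - \<tau>b..T}, so the values elsewhere do not enter.\<close>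

lemma is_solution_cong:
  assumes x: "solves t w \<alpha> x" and eq: "\<And>s. s \<in> {t - \<tau>b..T} \<Longrightarrow> y s = x s"
    and t: "t \<in> {t0..T}" and \<alpha>: "\<alpha> \<in> controls A t T"
  shows "solves t w \<alpha> y"
proof -
  have rhs_eq: "rhs f y r a = rhs f x r a" if "r \<in> {t..T}" for r a
    using that t delayed_time_in[of r t "x r"] max_delay_nonneg by (auto simp: rhs_def eq)
  obtain C where "C-lipschitz_on {t - \<tau>b..T} x" using x by (auto simp: is_solution_def)
  then have "C-lipschitz_on {t - \<tau>b..T} y"
    by (rule lipschitz_on_transform) (simp add: eq)
  moreover have "y s = w 0 + integral {t..s} (\<lambda>r. rhs f y r (\<alpha> r))" if "s \<in> {t..T}" for s
  proof -
    have "integral {t..s} (\<lambda>r. rhs f y r (\<alpha> r)) = integral {t..s} (\<lambda>r. rhs f x r (\<alpha> r))"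
      by (rule integral_cong) (use that in \<open>auto intro: rhs_eq\<close>)
    then show ?thesis using solution_integral[OF x t \<alpha> that] that eq[of s] max_delay_nonneg by simp
  qed
  moreover have "y (t + \<theta>) = w \<theta>" if "\<theta> \<in> {-\<tau>b..0}" for \<theta>
    using x that t eq[of "t + \<theta>"] by (auto simp: is_solution_def)
  ultimately show ?thesis by (auto simp: is_solution_iff_integral[OF t \<alpha>])
qed

lemma trajectory_is_solution:
  assumes t: "t \<in> {t0..T}" and w: "w \<in> Lip \<tau>b" and \<alpha>: "\<alpha> \<in> controls A t T"
  shows "solves t w \<alpha> (trajectory T f \<tau> \<tau>b t w \<alpha>)"
proof -
  obtain x where x: "solves t w \<alpha> x" using solution_exists[OF assms] by blast
  have "solves t w \<alpha> (restrict x {t - \<tau>b..T})"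
    by (rule is_solution_cong[OF x _ t \<alpha>]) simp
  moreover have "y = restrict x {t - \<tau>b..T}"
    if "y \<in> extensional {t - \<tau>b..T}" "solves t w \<alpha> y" for y
    using solution_unique[OF t w \<alpha> that(2) x] that(1) by (auto simp: fun_eq_iff extensional_def restrict_def)
  ultimately have "\<exists>!x. x \<in> extensional {t - \<tau>b..T} \<and> solves t w \<alpha> x"
    by (intro ex1I[of _ "restrict x {t - \<tau>b..T}"]) auto
  from theI'[OF this] show ?thesis by (simp add: trajectory_def)
qed

end

section \<open>The delayed time\<close>

lemma lipschitz_growth_AE:
  fixes F :: "real \<Rightarrow> real"
  assumes F: "C-lipschitz_on {a..b} F" and "a \<le> b"
    and D: "AE s in lebesgue_on {a<..<b}. \<exists>y\<ge>c. (F has_real_derivative y) (at s)"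
  shows "c * (b - a) \<le> F b - F a"
proof -
  \<comment> \<open>The default value c on the exceptional set makes the lower bound hold at every
    point, so that integrals can be compared directly.\<close>
  define F' where "F' s = (if \<exists>y\<ge>c. (F has_real_derivative y) (at s) then deriv F s else c)" for s
  have "AE s in lebesgue_on {a<..<b}. (F has_vector_derivative F' s) (at s)"
    using D by (rule lebesgue_on_mono)
      (auto simp: F'_def DERIV_imp_deriv has_real_derivative_iff_has_vector_derivative[symmetric])
  from lipschitz_has_integral_vector_derivative[OF F \<open>a \<le> b\<close> this]
  have "(F' has_integral F b - F a) {a..b}" .
  moreover have "((\<lambda>_. c) has_integral c * (b - a)) {a..b}"
    using has_integral_const_real[of c a b] \<open>a \<le> b\<close> by (simp add: mult.commute)
  moreover have "c \<le> F' s" for s by (auto simp: F'_def DERIV_imp_deriv)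
  ultimately show ?thesis by (intro has_integral_le[of "\<lambda>_. c" "c * (b - a)" "{a..b}" F']) auto
qed

text \<open>The increments \<open>h n\<close> need not follow a fixed direction; it is enough that
  they are of order \<open>e n\<close>. This is the situation of the variations of the state, whose
  direction is not known to converge.\<close>

lemma has_derivative_seq:
  fixes F :: "'a::real_normed_vector \<Rightarrow> 'b::real_normed_vector"
  assumes F: "(F has_derivative F') (at c)" and h: "\<And>n. norm (h n) \<le> C * e n"
    and e: "\<And>n. e n > 0" "e \<longlonglongrightarrow> 0"
  shows "(\<lambda>n. (F (c + h n) - F c - F' (h n)) /\<^sub>R e n) \<longlonglongrightarrow> 0"
proof (rule LIMSEQ_I)
  fix r :: real assume "r > 0"
  have C0: "C \<ge> 0" using h[of 0] e(1)[of 0] norm_ge_zero[of "h 0"] by (metis mult_less_0_iff not_le order.trans)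
  define q where "q = r / (2 * (C + 1))"
  have q: "q > 0" using \<open>r > 0\<close> C0 by (simp add: q_def)
  obtain d where d: "d > 0" "\<And>y. norm (y - c) < d \<Longrightarrow> norm (F y - F c - F' (y - c)) \<le> q * norm (y - c)"
    using F q unfolding has_derivative_at_alt by blast
  have "(\<lambda>n. C * e n) \<longlonglongrightarrow> 0" using tendsto_mult_right_zero[OF e(2)] .
  then obtain N where N: "\<And>n. n \<ge> N \<Longrightarrow> norm (C * e n) < d"
    using LIMSEQ_D[of _ 0 d] d(1) by force
  have "norm ((F (c + h n) - F c - F' (h n)) /\<^sub>R e n - 0) < r" if "n \<ge> N" for n
  proof -
    have "norm (h n) < d" using N[OF that] h[of n] by simp
    then have "norm (F (c + h n) - F c - F' (h n)) \<le> q * norm (h n)" using d(2)[of "c + h n"] by simp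
    also have "\<dots> \<le> q * (C * e n)" using q h by (intro mult_left_mono) auto
    finally have "norm (F (c + h n) - F c - F' (h n)) / e n \<le> q * C"
      using e(1)[of n] by (simp add: pos_divide_le_eq mult.assoc)
    also have "\<dots> < r"
    proof -
      have "r / (2 * m) * m = r / 2" if "m > 0" for m using that by simp
      from this[of "C + 1"] have "q * (C + 1) = r / 2" using C0 by (simp add: q_def del: times_divide_eq_left)
      moreover have "q * C \<le> q * (C + 1)" using q by simp
      ultimately show ?thesis using \<open>r > 0\<close> by simp
    qed
    finally show ?thesis using e(1)[of n] by (simp add: divide_inverse_commute)
  qed
  then show "\<exists>N. \<forall>n\<ge>N. norm ((F (c + h n) - F c - F' (h n)) /\<^sub>R e n - 0) < r" by blast
qed

text \<open>The derivative is a limit of difference quotients along a ray, which inherits the local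
  Lipschitz bound. N is only assumed positively homogeneous, which allows the sum of two norms, the
  form in which the data are Lipschitz.\<close>

lemma has_derivative_lipschitz_bound:
  fixes F :: "'a::real_normed_vector \<Rightarrow> 'b::real_normed_vector"
  assumes F: "(F has_derivative F') (at c)" and "r > 0"
    and lip: "\<And>h. norm h \<le> r \<Longrightarrow> norm (F (c + h) - F c) \<le> l * N h"
    and N: "\<And>a h. a \<ge> 0 \<Longrightarrow> N (a *\<^sub>R h) = a * N h"
  shows "norm (F' h) \<le> l * N h"
proof -
  \<comment> \<open>The steps are scaled so that \<open>e n *\<^sub>R h\<close> stays within radius
    r; adding 1 to the norm covers h = 0.\<close>
  define e where "e n = r / ((1 + norm h) * real (Suc n))" for n
  have e: "e n > 0" for n using \<open>r > 0\<close> by (simp add: e_def add_pos_nonneg)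
  have e0: "e \<longlonglongrightarrow> 0"
  proof -
    have "(\<lambda>n. r / (1 + norm h) * inverse (real (Suc n))) \<longlonglongrightarrow> 0"
      by (rule tendsto_mult_right_zero[OF LIMSEQ_inverse_real_of_nat])
    then show ?thesis by (simp add: e_def[abs_def] field_simps)
  qed
  interpret F': bounded_linear F' using F by (rule has_derivative_bounded_linear)
  have "(\<lambda>n. (F (c + e n *\<^sub>R h) - F c - F' (e n *\<^sub>R h)) /\<^sub>R e n) \<longlonglongrightarrow> 0"
    by (rule has_derivative_seq[OF F _ e e0, of _ "norm h"]) (use e in \<open>simp add: less_imp_le mult.commute\<close>)
  moreover have "(F (c + e n *\<^sub>R h) - F c - F' (e n *\<^sub>R h)) /\<^sub>R e n = (F (c + e n *\<^sub>R h) - F c) /\<^sub>R e n - F' h" for n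
    using e[of n] by (simp add: F'.scaleR scaleR_diff_right)
  ultimately have "(\<lambda>n. (F (c + e n *\<^sub>R h) - F c) /\<^sub>R e n) \<longlonglongrightarrow> F' h"
    by (simp add: LIM_zero_cancel)
  then have "(\<lambda>n. norm ((F (c + e n *\<^sub>R h) - F c) /\<^sub>R e n)) \<longlonglongrightarrow> norm (F' h)"
    by (rule tendsto_norm)
  moreover have "norm ((F (c + e n *\<^sub>R h) - F c) /\<^sub>R e n) \<le> l * N h" for n
  proof -
    have "e n * norm h \<le> r"
    proof -
      have "r * norm h \<le> r * ((1 + norm h) * real (Suc n))"
        using \<open>r > 0\<close> mult_mono[of "norm h" "1 + norm h" 1 "real (Suc n)"] by (intro mult_left_mono) auto
      moreover have "0 < (1 + norm h) * real (Suc n)" by (simp add: add_pos_nonneg)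
      ultimately show ?thesis by (simp add: e_def pos_divide_le_eq)
    qed
    then have "norm (F (c + e n *\<^sub>R h) - F c) \<le> l * N (e n *\<^sub>R h)"
      using e[of n] by (intro lip) simp
    also have "\<dots> = e n * (l * N h)" using e[of n] by (simp add: N less_imp_le)
    finally have "norm (F (c + e n *\<^sub>R h) - F c) / e n \<le> l * N h"
      using e[of n] by (simp add: pos_divide_le_eq mult.commute)
    then show ?thesis using e[of n] by (simp add: divide_inverse_commute)
  qed
  ultimately show ?thesis by (intro LIMSEQ_le_const2) auto
qed

section \<open>Regularity of the delay and growth of the delayed time\<close>

context delay_control_problem
begin

text \<open>\<open>\<tau>_lip\<close> controls the state argument only. Joint Lipschitz continuity
  comes from the mean value inequality on a convex compact set, on which both partial derivatives
  are bounded; it is what makes \<open>D\<close> Lipschitz.\<close>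

lemma delay_lipschitz_on_bounded:
  "\<exists>C. C-lipschitz_on ({t0..T} \<times> cball 0 R) (\<lambda>(t, z). \<tau> t z)"
proof -
  let ?S = "{t0..T} \<times> cball (0 :: real^'n) R"
  have "compact ?S" by (intro compact_Times) auto
  have "compact ((\<lambda>(t, z). \<tau>\<^sub>t t z) ` ?S)" "compact ((\<lambda>(t, z). \<tau>\<^sub>z t z) ` ?S)"
    by (rule compact_continuous_image[OF continuous_on_subset[OF \<tau>\<^sub>t_cont] \<open>compact ?S\<close>], blast)
      (rule compact_continuous_image[OF continuous_on_subset[OF \<tau>\<^sub>z_cont] \<open>compact ?S\<close>], blast)
  then obtain B1 B2 where B1: "\<And>q. q \<in> ?S \<Longrightarrow> norm (case q of (t, z) \<Rightarrow> \<tau>\<^sub>t t z) \<le> B1"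
    and B2: "\<And>q. q \<in> ?S \<Longrightarrow> norm (case q of (t, z) \<Rightarrow> \<tau>\<^sub>z t z) \<le> B2"
    by (metis (no_types, lifting) compact_imp_bounded bounded_iff imageI)
  have lip: "norm ((\<lambda>(t, z). \<tau> t z) p - (\<lambda>(t, z). \<tau> t z) q) \<le> (\<bar>B1\<bar> + \<bar>B2\<bar>) * norm (p - q)"
    if "p \<in> ?S" "q \<in> ?S" for p q
  proof (rule differentiable_bound[where S = ?S])
    show "convex ?S" by (intro convex_Times) auto
    fix c assume c: "c \<in> ?S"
    obtain t z where tz: "c = (t, z)" by force
    show "((\<lambda>(t, z). \<tau> t z) has_derivative (\<lambda>(h, k). \<tau>\<^sub>t (fst c) (snd c) * h + \<tau>\<^sub>z (fst c) (snd c) \<bullet> k)) (at c within ?S)"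
      by (rule has_derivative_subset[of _ _ _ "{t0..T} \<times> UNIV"]) (use \<tau>_deriv c in \<open>auto simp: tz\<close>)
    show "onorm (\<lambda>(h, k). \<tau>\<^sub>t (fst c) (snd c) * h + \<tau>\<^sub>z (fst c) (snd c) \<bullet> k) \<le> \<bar>B1\<bar> + \<bar>B2\<bar>"
    proof (rule onorm_le)
      fix hk :: "real \<times> (real^'n)"
      obtain h k where hk: "hk = (h, k)" by force
      have "norm (\<tau>\<^sub>t t z * h + \<tau>\<^sub>z t z \<bullet> k) \<le> \<bar>\<tau>\<^sub>t t z\<bar> * \<bar>h\<bar> + norm (\<tau>\<^sub>z t z) * norm k"
        using Cauchy_Schwarz_ineq2[of "\<tau>\<^sub>z t z" k] by (simp add: abs_mult[symmetric])
      also have "\<dots> \<le> \<bar>B1\<bar> * norm hk + \<bar>B2\<bar> * norm hk"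
        using B1[OF c] B2[OF c] norm_fst_le[of h k] norm_snd_le[of k h]
        by (intro add_mono mult_mono) (auto simp: tz hk)
      finally show "norm ((\<lambda>(h, k). \<tau>\<^sub>t (fst c) (snd c) * h + \<tau>\<^sub>z (fst c) (snd c) \<bullet> k) hk) \<le> (\<bar>B1\<bar> + \<bar>B2\<bar>) * norm hk"
        by (simp add: tz hk ring_distribs)
    qed
  qed (use that in auto)
  show ?thesis
    by (rule exI[of _ "\<bar>B1\<bar> + \<bar>B2\<bar>"], rule lipschitz_onI) (use lip in \<open>auto simp: dist_norm\<close>)
qed

lemma delay_has_derivative_state:
  assumes "s \<in> {t0..T}"
  shows "((\<lambda>z. \<tau> s z) has_derivative (\<lambda>h. \<tau>\<^sub>z s z \<bullet> h)) (at z)"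
proof -
  have "((\<lambda>(t, z). \<tau> t z) has_derivative (\<lambda>(h, k). \<tau>\<^sub>t s z * h + \<tau>\<^sub>z s z \<bullet> k))
      (at (s, z) within (\<lambda>z. (s, z)) ` UNIV)"
    by (rule has_derivative_subset[of _ _ _ "{t0..T} \<times> UNIV"]) (use \<tau>_deriv assms in auto)
  moreover have "((\<lambda>z. (s, z)) has_derivative (\<lambda>h. (0, h))) (at z)"
    by (auto intro!: derivative_eq_intros)
  ultimately have "((\<lambda>z. (\<lambda>(t, z). \<tau> t z) (s, z)) has_derivative (\<lambda>h. (\<lambda>(h, k). \<tau>\<^sub>t s z * h + \<tau>\<^sub>z s z \<bullet> k) (0, h))) (at z)"
    using has_derivative_in_compose[where f = "\<lambda>z. (s, z)" and s = UNIV and x = z] by blast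
  then show ?thesis by simp
qed

end

locale controlled_trajectory = delay_control_problem t0 T A f L g \<tau> \<tau>b f\<^sub>z f\<^sub>y L\<^sub>z L\<^sub>y \<tau>\<^sub>t \<tau>\<^sub>z
  for t0 T :: real and A :: "(real^'m) set"
    and f :: "real \<Rightarrow> real^'n \<Rightarrow> real^'n \<Rightarrow> real^'m \<Rightarrow> real^'n" and L g \<tau> \<tau>b f\<^sub>z f\<^sub>y L\<^sub>z L\<^sub>y \<tau>\<^sub>t \<tau>\<^sub>z +
  fixes t :: real and w :: "real \<Rightarrow> real^'n" and \<alpha> :: "real \<Rightarrow> real^'m" and x :: "real \<Rightarrow> real^'n"
    and D :: "real \<Rightarrow> real"
  assumes t: "t \<in> {t0..T}" and t_less: "t < T" and w: "w \<in> Lip \<tau>b"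
    and \<alpha>: "\<alpha> \<in> controls A t T" and sol: "solves t w \<alpha> x"
    and D: "D = (\<lambda>s. s - \<tau> s (x s))"
begin

lemma D_lipschitz: "\<exists>C. C-lipschitz_on {t..T} D"
proof -
  obtain R C where R: "\<And>s. s \<in> {t - \<tau>b..T} \<Longrightarrow> norm (x s) \<le> R" and C: "C-lipschitz_on {t - \<tau>b..T} x"
    using solution_bounds[OF t w] \<alpha> sol by blast
  obtain B where B: "B-lipschitz_on ({t0..T} \<times> cball 0 R) (\<lambda>(t, z). \<tau> t z)"
    using delay_lipschitz_on_bounded by blast
  have "(1 + B * (1 + C))-lipschitz_on {t..T} D"
  proof (rule lipschitz_onI)
    fix r s assume rs: "r \<in> {t..T}" "s \<in> {t..T}"
    have xrs: "dist (x r) (x s) \<le> C * dist r s"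
      by (rule lipschitz_onD[OF C]) (use rs max_delay_nonneg in auto)
    have "dist (\<tau> r (x r)) (\<tau> s (x s)) \<le> B * dist (r, x r) (s, x s)"
      using lipschitz_onD[OF B, of "(r, x r)" "(s, x s)"] rs t R max_delay_nonneg by auto
    also have "dist (r, x r) (s, x s) \<le> dist r s + dist (x r) (x s)"
      by (simp add: dist_Pair_Pair sqrt_sum_squares_le_sum)
    also have "\<dots> \<le> (1 + C) * dist r s" using xrs by (simp add: algebra_simps)
    finally have "dist (\<tau> r (x r)) (\<tau> s (x s)) \<le> B * ((1 + C) * dist r s)"
      using lipschitz_on_nonneg[OF B] by (simp add: mult_left_mono)
    then show "dist (D r) (D s) \<le> (1 + B * (1 + C)) * dist r s"
      by (simp add: D dist_real_def algebra_simps)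
  qed (use lipschitz_on_nonneg[OF B] lipschitz_on_nonneg[OF C] in simp)
  then show ?thesis by blast
qed

text \<open>By the chain rule the expression in \<open>monotone_delay\<close> is the derivative of
  \<open>D\<close> wherever \<open>x\<close> is differentiable, and the state equation gives this
  almost everywhere.\<close>

lemma D_deriv_AE:
  "\<exists>d>0. AE s in lebesgue_on {t<..<T}. \<exists>y\<ge>d. (D has_real_derivative y) (at s)"
proof -
  obtain B where B: "\<And>\<theta>. \<theta> \<in> {-\<tau>b..0} \<Longrightarrow> norm (w \<theta>) \<le> B" "B \<ge> 0"
    using Lip_bounded[OF w] by blast
  \<comment> \<open>The radius must be positive, and B may be 0.\<close>
  then have "w \<in> Lip_ball \<tau>b (B + 1)" using w by (force simp: Lip_ball_def)
  then obtain d where d: "d > 0" and AE: "AE s in lebesgue_on {t..T}.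
      1 - \<tau>\<^sub>t s (x s) - \<tau>\<^sub>z s (x s) \<bullet> vector_derivative x (at s) \<ge> d"
    using monotone_delay[rule_format, of "B + 1"] t \<alpha> sol B(2) by fastforce
  have "AE s in lebesgue_on {t<..<T}. 1 - \<tau>\<^sub>t s (x s) - \<tau>\<^sub>z s (x s) \<bullet> vector_derivative x (at s) \<ge> d"
    using AE by (auto simp: AE_lebesgue_on_iff_negligible elim!: negligible_subset)
  moreover have "AE s in lebesgue_on {t<..<T}. \<exists>y. (x has_vector_derivative y) (at s)"
    by (rule lebesgue_on_mono[where P = "\<lambda>s. (x has_vector_derivative f s (x s) (x (s - \<tau> s (x s))) (\<alpha> s)) (at s)"])
      (use sol in \<open>auto simp: is_solution_def\<close>)
  ultimately have "AE s in lebesgue_on {t<..<T}. 1 - \<tau>\<^sub>t s (x s) - \<tau>\<^sub>z s (x s) \<bullet> vector_derivative x (at s) \<ge> d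
      \<and> (\<exists>y. (x has_vector_derivative y) (at s))"
    by (rule AE_conjI)
  then have "AE s in lebesgue_on {t<..<T}. \<exists>y\<ge>d. (D has_real_derivative y) (at s)"
  proof (rule lebesgue_on_mono, elim conjE exE)
    fix s y assume s: "s \<in> {t<..<T}" and y: "(x has_vector_derivative y) (at s)"
      and ge: "1 - \<tau>\<^sub>t s (x s) - \<tau>\<^sub>z s (x s) \<bullet> vector_derivative x (at s) \<ge> d"
    \<comment> \<open>\<open>\<tau>\<close> is differentiable within the strip only. The chain rule
      is therefore applied within the open time interval, where the derivative at s within the
      interval is the full one.\<close>
    have outer: "((\<lambda>(t, z). \<tau> t z) has_derivative (\<lambda>(h, k). \<tau>\<^sub>t s (x s) * h + \<tau>\<^sub>z s (x s) \<bullet> k))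
        (at (s, x s) within (\<lambda>r. (r, x r)) ` {t<..<T})"
      by (rule has_derivative_subset[of _ _ _ "{t0..T} \<times> UNIV"]) (use \<tau>_deriv s t in auto)
    have inner: "((\<lambda>r. (r, x r)) has_derivative (\<lambda>h. (h, h *\<^sub>R y))) (at s within {t<..<T})"
      by (rule has_derivative_Pair[OF has_derivative_ident
            has_derivative_at_withinI[OF y[unfolded has_vector_derivative_def]]])
    from has_derivative_in_compose[OF inner outer] have "((\<lambda>r. \<tau> r (x r)) has_derivative (\<lambda>h. \<tau>\<^sub>t s (x s) * h + \<tau>\<^sub>z s (x s) \<bullet> (h *\<^sub>R y))) (at s)"
      using s by (simp add: at_within_open[OF _ open_greaterThanLessThan])
    then have "(D has_derivative (\<lambda>h. h - (\<tau>\<^sub>t s (x s) * h + \<tau>\<^sub>z s (x s) \<bullet> (h *\<^sub>R y)))) (at s)"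
      unfolding D by (rule has_derivative_diff[OF has_derivative_ident])
    then have "(D has_real_derivative 1 - \<tau>\<^sub>t s (x s) - \<tau>\<^sub>z s (x s) \<bullet> y) (at s)"
      unfolding has_field_derivative_def by (rule has_derivative_eq_rhs) (auto simp: algebra_simps)
    with ge y show "\<exists>y\<ge>d. (D has_real_derivative y) (at s)"
      by (auto simp: vector_derivative_at)
  qed
  with d show ?thesis by blast
qed

text \<open>The lower bound on the derivative is integrated. Linear growth, and not just strict
  monotonicity, makes the inverse Lipschitz, so that it maps null sets to null sets.\<close>

lemma D_expanding:
  "\<exists>d>0. \<forall>r\<in>{t..T}. \<forall>s\<in>{t..T}. r \<le> s \<longrightarrow> d * (s - r) \<le> D s - D r"
proof -
  obtain d where d: "d > 0" "AE s in lebesgue_on {t<..<T}. \<exists>y\<ge>d. (D has_real_derivative y) (at s)"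
    using D_deriv_AE by blast
  obtain C where C: "C-lipschitz_on {t..T} D" using D_lipschitz by blast
  have "d * (s - r) \<le> D s - D r" if rs: "r \<in> {t..T}" "s \<in> {t..T}" "r \<le> s" for r s
  proof (rule lipschitz_growth_AE)
    show "C-lipschitz_on {r..s} D" by (rule lipschitz_on_subset[OF C]) (use rs in auto)
    show "AE q in lebesgue_on {r<..<s}. \<exists>y\<ge>d. (D has_real_derivative y) (at q)"
      using d(2) rs by (auto simp: AE_lebesgue_on_iff_negligible elim!: negligible_subset)
  qed fact
  with d(1) show ?thesis by blast
qed

lemma D_le: "s \<in> {t..T} \<Longrightarrow> D s \<in> {t - \<tau>b..s}"
  unfolding D by (rule delayed_time_in) (use t in auto)

lemma D_strict_mono: "\<lbrakk>r \<in> {t..T}; s \<in> {t..T}; r < s\<rbrakk> \<Longrightarrow> D r < D s"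
proof -
  assume rs: "r \<in> {t..T}" "s \<in> {t..T}" "r < s"
  obtain d where "d > 0" "d * (s - r) \<le> D s - D r" using D_expanding rs by (meson less_imp_le)
  moreover have "d * (s - r) > 0" using \<open>d > 0\<close> rs by simp
  ultimately show "D r < D s" by linarith
qed

lemma D_inj: "inj_on D {t..T}"
  by (rule inj_onI) (metis D_strict_mono linorder_less_linear less_irrefl)

lemma D_image: "D ` {t..T} = {D t..D T}"
proof (intro set_eqI iffI)
  fix y assume "y \<in> D ` {t..T}"
  then obtain s where s: "s \<in> {t..T}" "y = D s" by blast
  have "D t \<le> D s" using D_strict_mono[of t s] s t_less by (cases "s = t") auto
  moreover have "D s \<le> D T" using D_strict_mono[of s T] s t_less by (cases "s = T") auto
  ultimately show "y \<in> {D t..D T}" using s by simp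
next
  fix y assume y: "y \<in> {D t..D T}"
  have "continuous_on {t..T} D" using D_lipschitz lipschitz_on_continuous_on by blast
  then obtain s where "t \<le> s" "s \<le> T" "D s = y" using IVT'[of D t y T] y t_less by auto
  then show "y \<in> D ` {t..T}" by auto
qed

section \<open>The inverse of the delayed time and the substitution r = D s\<close>

definition \<gamma> :: "real \<Rightarrow> real" where "\<gamma> = the_inv_into {t..T} D"

lemma \<gamma>_D: "s \<in> {t..T} \<Longrightarrow> \<gamma> (D s) = s"
  unfolding \<gamma>_def by (rule the_inv_into_f_f[OF D_inj])

lemma D_\<gamma>: "r \<in> {D t..D T} \<Longrightarrow> D (\<gamma> r) = r"
  unfolding \<gamma>_def using f_the_inv_into_f[OF D_inj] D_image by simp

lemma \<gamma>_in: "r \<in> {D t..D T} \<Longrightarrow> \<gamma> r \<in> {t..T}"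
  unfolding \<gamma>_def using the_inv_into_into[OF D_inj _ order_refl] D_image by simp

lemma \<gamma>_lipschitz: "\<exists>C. C-lipschitz_on {D t..D T} \<gamma>"
proof -
  obtain d where d: "d > 0" "\<And>r s. \<lbrakk>r \<in> {t..T}; s \<in> {t..T}; r \<le> s\<rbrakk> \<Longrightarrow> d * (s - r) \<le> D s - D r"
    using D_expanding by blast
  have "(1 / d)-lipschitz_on {D t..D T} \<gamma>"
  proof (rule lipschitz_onI)
    fix r s assume rs: "r \<in> {D t..D T}" "s \<in> {D t..D T}"
    have "d * \<bar>\<gamma> s - \<gamma> r\<bar> \<le> \<bar>s - r\<bar>"
      using d(2)[OF \<gamma>_in[OF rs(1)] \<gamma>_in[OF rs(2)]] d(2)[OF \<gamma>_in[OF rs(2)] \<gamma>_in[OF rs(1)]]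
      by (cases "\<gamma> r \<le> \<gamma> s") (simp_all add: D_\<gamma>[OF rs(1)] D_\<gamma>[OF rs(2)])
    then show "dist (\<gamma> r) (\<gamma> s) \<le> 1 / d * dist r s"
      using d(1) by (simp add: dist_real_def abs_minus_commute field_simps)
  qed (use d in simp)
  then show ?thesis by blast
qed

text \<open>The preimage of N under \<open>D\<close> is the image under the Lipschitz map
  \<open>\<gamma>\<close> of the part of N in the range of \<open>D\<close>, hence null.\<close>

lemma AE_D_notin:
  assumes "negligible N"
  shows "AE s in lebesgue_on {t<..<T}. D s \<notin> N"
proof -
  obtain C where C: "C-lipschitz_on {D t..D T} \<gamma>" using \<gamma>_lipschitz by blast
  have "negligible (\<gamma> ` (N \<inter> {D t..D T}))"
    by (rule negligible_lipschitz_image[of _ C])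
      (use assms C in \<open>auto intro: negligible_subset lipschitz_on_subset\<close>)
  moreover have "{s \<in> {t<..<T}. \<not> D s \<notin> N} \<subseteq> \<gamma> ` (N \<inter> {D t..D T})"
  proof
    fix s assume s: "s \<in> {s \<in> {t<..<T}. \<not> D s \<notin> N}"
    then have "D s \<in> {D t..D T}" using D_image by (metis (no_types, lifting) greaterThanLessThan_subseteq_atLeastAtMost_iff imageI mem_Collect_eq order_refl subsetD)
    then show "s \<in> \<gamma> ` (N \<inter> {D t..D T})" using s \<gamma>_D[of s] by (intro image_eqI[of _ _ "D s"]) auto
  qed
  ultimately show ?thesis by (simp add: AE_lebesgue_on_iff_negligible negligible_subset)
qed

lemma AE_x_differentiable_D:
  "AE s in lebesgue_on {t<..<T}. (x has_vector_derivative vector_derivative x (at (D s))) (at (D s))"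
proof -
  obtain C where C: "C-lipschitz_on {t - \<tau>b..T} x" using sol by (auto simp: is_solution_def)
  \<comment> \<open>The left endpoint is added because \<open>D s\<close> may reach it; T is never
    reached, as \<open>D s\<close> is at most s and s is below T.\<close>
  define N where "N = {r \<in> {t - \<tau>b<..<T}. \<not> (\<exists>y. (x has_vector_derivative y) (at r))} \<union> {t - \<tau>b}"
  have "negligible N"
    using lipschitz_differentiable_AE[OF C] by (simp add: N_def AE_lebesgue_on_iff_negligible)
  from AE_D_notin[OF this] show ?thesis
  proof (rule lebesgue_on_mono)
    fix s assume s: "D s \<notin> N" "s \<in> {t<..<T}"
    then have "D s \<in> {t - \<tau>b<..<T}" using D_le[of s] by (auto simp: N_def)
    then show "(x has_vector_derivative vector_derivative x (at (D s))) (at (D s))"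
      using s by (auto simp: N_def vector_derivative_works dest: differentiableI_vector)
  qed
qed

lemma \<gamma>_deriv:
  assumes s: "s \<in> {t<..<T}" and y: "(D has_real_derivative y) (at s)" "y > 0"
  shows "deriv \<gamma> (D s) = inverse y"
proof -
  have Ds: "D s \<in> {D t<..<D T}" using D_strict_mono s t_less by auto
  have "(\<gamma> has_real_derivative inverse y) (at (D s))"
  proof (rule DERIV_inverse_function[where f = D and a = "D t" and b = "D T"])
    show "(D has_real_derivative y) (at (\<gamma> (D s)))" using y s by (simp add: \<gamma>_D)
    obtain C where "C-lipschitz_on {D t..D T} \<gamma>" using \<gamma>_lipschitz by blast
    then have "continuous_on {D t<..<D T} \<gamma>"
      by (intro lipschitz_on_continuous_on) (auto elim: lipschitz_on_subset)
    then show "isCont \<gamma> (D s)"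
      using Ds by (simp add: continuous_on_eq_continuous_at)
  qed (use Ds y D_\<gamma> in auto)
  then show ?thesis by (rule DERIV_imp_deriv)
qed

text \<open>The substitution formula asks for a derivative at each point, so it is used on the set S
  of full measure where \<open>D\<close> has derivative at least d. What S leaves out of {t..T} is
  null, and its image is null because \<open>D\<close> is Lipschitz; both intervals are thus
  recovered.\<close>

lemma change_of_variables_delay:
  fixes k :: "real \<Rightarrow> real"
  assumes k: "k absolutely_integrable_on {t..T}"
  shows "((\<lambda>r. deriv \<gamma> r * k (\<gamma> r)) has_integral integral {t..T} k) {D t..D T}"
proof -
  obtain d where d: "d > 0" "AE s in lebesgue_on {t<..<T}. \<exists>y\<ge>d. (D has_real_derivative y) (at s)"
    using D_deriv_AE by blast
  define S where "S = {s \<in> {t<..<T}. \<exists>y\<ge>d. (D has_real_derivative y) (at s)}"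
  have "negligible ({t<..<T} - S)"
    using d(2) by (auto simp: AE_lebesgue_on_iff_negligible S_def elim!: negligible_subset)
  then have "negligible (({t<..<T} - S) \<union> {t, T})" by simp
  then have neg: "negligible ({t..T} - S)" by (rule negligible_subset) auto
  have "{t..T} - ({t..T} - S) = S" by (auto simp: S_def)
  then have S: "S \<in> sets lebesgue"
    using neg by (metis lmeasurable_cbox fmeasurableD negligible_imp_sets sets.Diff cbox_interval)
  have der: "(D has_field_derivative deriv D s) (at s within S)" if "s \<in> S" for s
    using that by (auto simp: S_def DERIV_imp_deriv intro: has_field_derivative_at_within)
  have inj: "inj_on D S" by (rule inj_on_subset[OF D_inj]) (auto simp: S_def)
  have k_S: "k absolutely_integrable_on S"
    by (rule absolutely_integrable_spike_set[OF k]; rule negligible_subset[OF neg]) (auto simp: S_def)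
  \<comment> \<open>On S the derivatives of \<open>D\<close> and \<open>\<gamma>\<close> are
    reciprocal, so the Jacobian cancels.\<close>
  have eq: "\<bar>deriv D s\<bar> * (deriv \<gamma> (D s) * k (\<gamma> (D s))) = k s" if s: "s \<in> S" for s
  proof -
    obtain y where y: "y \<ge> d" "(D has_real_derivative y) (at s)" using s by (auto simp: S_def)
    have "deriv \<gamma> (D s) = inverse y" using \<gamma>_deriv[of s y] y d(1) s by (auto simp: S_def)
    moreover have "deriv D s = y" using y by (simp add: DERIV_imp_deriv)
    moreover have "\<gamma> (D s) = s" using s by (intro \<gamma>_D) (auto simp: S_def)
    ultimately show ?thesis using y d(1) by simp
  qed
  have "(\<lambda>s. \<bar>deriv D s\<bar> * (deriv \<gamma> (D s) * k (\<gamma> (D s)))) absolutely_integrable_on S \<and>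
      integral S (\<lambda>s. \<bar>deriv D s\<bar> * (deriv \<gamma> (D s) * k (\<gamma> (D s)))) = integral S k"
  proof
    show "(\<lambda>s. \<bar>deriv D s\<bar> * (deriv \<gamma> (D s) * k (\<gamma> (D s)))) absolutely_integrable_on S"
      using k_S eq by (subst set_integrable_cong[OF refl refl, of S _ k]) auto
  qed (use eq in \<open>auto intro: integral_cong\<close>)
  then have "(\<lambda>r. deriv \<gamma> r * k (\<gamma> r)) absolutely_integrable_on D ` S \<and>
      integral (D ` S) (\<lambda>r. deriv \<gamma> r * k (\<gamma> r)) = integral S k"
    using has_absolute_integral_change_of_variables_1'[OF S der inj, of "\<lambda>r. deriv \<gamma> r * k (\<gamma> r)" "integral S k"]
    by blast
  then have int: "((\<lambda>r. deriv \<gamma> r * k (\<gamma> r)) has_integral integral S k) (D ` S)"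
    by (auto simp: has_integral_integrable_integral set_lebesgue_integral_eq_integral(1))
  have S_sub: "S \<subseteq> {t..T}" by (auto simp: S_def)
  obtain C where C: "C-lipschitz_on {t..T} D" using D_lipschitz by blast
  have "negligible (D ` ({t..T} - S))"
    by (rule negligible_lipschitz_image[OF neg lipschitz_on_subset[OF C]]) auto
  then have neg': "negligible ({D t..D T} - D ` S)"
    by (rule negligible_subset) (auto simp flip: D_image)
  have D_sub: "D ` S \<subseteq> {D t..D T}" using S_sub by (auto simp flip: D_image)
  have "((\<lambda>r. deriv \<gamma> r * k (\<gamma> r)) has_integral integral S k) {D t..D T} \<longleftrightarrow>
      ((\<lambda>r. deriv \<gamma> r * k (\<gamma> r)) has_integral integral S k) (D ` S)"
    by (rule has_integral_spike_set_eq; rule negligible_subset[OF neg']) (use D_sub in auto)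
  moreover have "integral S k = integral {t..T} k"
    by (rule integral_spike_set; rule negligible_subset[OF neg]) (use S_sub in auto)
  ultimately show ?thesis using int by simp
qed

end

section \<open>Needle variations\<close>

context delay_control_problem
begin

lemma segment_in_Lip:
  assumes "C-lipschitz_on {t - \<tau>b..T} u" "t \<le> T"
  shows "segment u T \<in> Lip \<tau>b"
proof -
  have "C-lipschitz_on {-\<tau>b..0} (segment u T)"
  proof (rule lipschitz_onI)
    fix r s assume "r \<in> {-\<tau>b..0}" "s \<in> {-\<tau>b..0}"
    then show "dist (segment u T r) (segment u T s) \<le> C * dist r s"
      using lipschitz_onD[OF assms(1), of "T + r" "T + s"] assms(2) by (simp add: segment_def dist_real_def)
  qed (rule lipschitz_on_nonneg[OF assms(1)])
  then show ?thesis by (auto simp: Lip_def)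
qed

lemma state_norm_le:
  assumes "continuous_on {-\<tau>b..0} dw" "norm dz \<le> E" "\<And>\<theta>. \<theta> \<in> {-\<tau>b..0} \<Longrightarrow> norm (dw \<theta>) \<le> E"
  shows "state_norm \<tau>b dz dw \<le> (1 + \<tau>b) * E"
proof -
  have cont: "continuous_on {-\<tau>b..0} (\<lambda>\<theta>. norm (dw \<theta>))" using assms(1) by (intro continuous_intros)
  then have "(\<lambda>\<theta>. norm (dw \<theta>)) absolutely_integrable_on {-\<tau>b..0}"
    by (rule absolutely_integrable_continuous_real)
  then have "(LINT \<theta>|lebesgue_on {-\<tau>b..0}. norm (dw \<theta>)) = integral {-\<tau>b..0} (\<lambda>\<theta>. norm (dw \<theta>))"
    by (intro lebesgue_integral_eq_integral absolutely_integrable_imp_integrable) auto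
  also have "\<dots> \<le> norm (integral {-\<tau>b..0} (\<lambda>\<theta>. norm (dw \<theta>)))" by simp
  also have "\<dots> \<le> E * (0 - - \<tau>b)"
    by (rule integral_norm_bound_const_interior[OF integrable_continuous_real[OF cont]])
      (use assms max_delay_nonneg in auto)
  finally show ?thesis using assms(2) by (simp add: state_norm_def algebra_simps)
qed

lemma cost_eq:
  assumes t: "t \<in> {t0..T}" and w: "w \<in> Lip \<tau>b" and \<alpha>: "\<alpha> \<in> controls A t T"
    and x: "x = trajectory T f \<tau> \<tau>b t w \<alpha>"
  shows "cost T f L g \<tau> \<tau>b t w \<alpha> = integral {t..T} (\<lambda>s. rhs L x s (\<alpha> s)) + g (x T, segment x T)"
proof -
  have "solves t w \<alpha> x" unfolding x by (rule trajectory_is_solution[OF t w \<alpha>])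
  then have "(\<lambda>s. rhs L x s (\<alpha> s)) absolutely_integrable_on {t..T}"
    by (intro rhs_L_integrable[OF _ t \<alpha>] solution_continuous) auto
  then have "(LINT s|lebesgue_on {t..T}. rhs L x s (\<alpha> s)) = integral {t..T} (\<lambda>s. rhs L x s (\<alpha> s))"
    by (intro lebesgue_integral_eq_integral absolutely_integrable_imp_integrable) auto
  then show ?thesis by (simp add: cost_def Let_def x rhs_def)
qed

text \<open>\<open>value_function\<close> is an infimum of reals, so optimality yields an inequality
  against other controls only once the costs are bounded below. The running cost is controlled by
  growth along uniformly bounded trajectories, the terminal cost by comparison with the zero state,
  to which \<open>g_lip\<close> applies on the ball of radius R.\<close>

lemma cost_bdd_below:
  assumes t: "t \<in> {t0..T}" and w: "w \<in> Lip \<tau>b"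
  shows "bdd_below (cost T f L g \<tau> \<tau>b t w ` controls A t T)"
proof -
  obtain R C where R: "R > 0" and sol: "\<And>\<alpha> x. \<lbrakk>\<alpha> \<in> controls A t T; solves t w \<alpha> x\<rbrakk> \<Longrightarrow>
     (\<forall>s\<in>{t - \<tau>b..T}. norm (x s) \<le> R) \<and> C-lipschitz_on {t - \<tau>b..T} x"
    using solution_bounds[OF assms] by blast
  obtain CL where CL: "CL > 0" "\<And>t a z y. \<lbrakk>t \<in> {t0..T}; a \<in> A\<rbrakk> \<Longrightarrow> norm (L t z y a) \<le> CL * (1 + norm z + norm y)"
    using L_growth by auto
  obtain l where l: "l > 0" "\<And>z1 w1 z2 w2. \<lbrakk>(z1, w1) \<in> state_space \<tau>b; (z2, w2) \<in> state_space \<tau>b;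
      w1 \<in> Lip_ball \<tau>b R; w2 \<in> Lip_ball \<tau>b R\<rbrakk> \<Longrightarrow>
      \<bar>g (z1, w1) - g (z2, w2)\<bar> \<le> l * state_norm \<tau>b (z1 - z2) (\<lambda>\<theta>. w1 \<theta> - w2 \<theta>)"
    using g_lip[rule_format, OF R] by blast
  show ?thesis
  proof (rule bdd_belowI2)
    fix \<alpha> assume \<alpha>: "\<alpha> \<in> controls A t T"
    define x where "x = trajectory T f \<tau> \<tau>b t w \<alpha>"
    have x: "solves t w \<alpha> x" unfolding x_def by (rule trajectory_is_solution[OF t w \<alpha>])
    note b = sol[OF \<alpha> x]
    have "norm (integral {t..T} (\<lambda>s. rhs L x s (\<alpha> s))) \<le> CL * (1 + R + R) * (T - t)"
    proof (rule integral_norm_bound_const_interior)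
      show "(\<lambda>s. rhs L x s (\<alpha> s)) integrable_on {t..T}"
        using rhs_L_integrable[OF solution_continuous[OF x] t \<alpha>, of t T]
        by (simp add: set_lebesgue_integral_eq_integral(1))
      fix s assume s: "s \<in> {t<..<T}"
      then have s': "s \<in> {t0..T}" "\<alpha> s \<in> A" using t \<alpha> by (auto simp: controls_def)
      have "norm (rhs L x s (\<alpha> s)) \<le> CL * (1 + norm (x s) + norm (x (s - \<tau> s (x s))))"
        unfolding rhs_def by (rule CL(2)[OF s'])
      also have "\<dots> \<le> CL * (1 + R + R)"
        using b delayed_time_in[of s t "x s"] s s'(1) max_delay_nonneg CL(1)
        by (intro mult_left_mono add_mono) auto
      finally show "norm (rhs L x s (\<alpha> s)) \<le> CL * (1 + R + R)" .
    qed (use t in auto)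
    moreover have "\<bar>g (x T, segment x T) - g (0, \<lambda>_. 0)\<bar> \<le> l * ((1 + \<tau>b) * R)"
    proof -
      have Lip: "segment x T \<in> Lip \<tau>b" using b t by (intro segment_in_Lip) auto
      have seg: "norm (segment x T \<theta>) \<le> R" if "\<theta> \<in> {-\<tau>b..0}" for \<theta>
        using b that t by (auto simp: segment_def)
      have "\<bar>g (x T, segment x T) - g (0, \<lambda>_. 0)\<bar> \<le> l * state_norm \<tau>b (x T - 0) (\<lambda>\<theta>. segment x T \<theta> - 0)"
      proof (rule l(2))
        show "(x T, segment x T) \<in> state_space \<tau>b" using Lip by (simp add: state_space_def segment_def)
        show "segment x T \<in> Lip_ball \<tau>b R" using Lip seg by (simp add: Lip_ball_def)
        have "(\<lambda>_. 0) \<in> Lip \<tau>b" by (auto simp: Lip_def intro: lipschitz_on_constant)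
        then show "(0, \<lambda>_. 0) \<in> state_space \<tau>b" "(\<lambda>_. 0) \<in> Lip_ball \<tau>b R"
          using R by (auto simp: state_space_def Lip_ball_def)
      qed
      also have "state_norm \<tau>b (x T - 0) (\<lambda>\<theta>. segment x T \<theta> - 0) \<le> (1 + \<tau>b) * R"
        using Lip seg[of 0] seg max_delay_nonneg
        by (intro state_norm_le) (auto simp: Lip_def segment_def intro: lipschitz_on_continuous_on)
      finally show ?thesis using l(1) by (simp add: mult_left_mono)
    qed
    ultimately show "g (0, \<lambda>_. 0) - l * ((1 + \<tau>b) * R) - CL * (1 + R + R) * (T - t) \<le> cost T f L g \<tau> \<tau>b t w \<alpha>"
      unfolding cost_eq[OF t w \<alpha> x_def] by (simp add: abs_le_iff)
  qed
qed

lemma optimal_control_le: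
  assumes "t \<in> {t0..T}" "w \<in> Lip \<tau>b" "optimal_control T A f L g \<tau> \<tau>b t w \<alpha>" "\<beta> \<in> controls A t T"
  shows "cost T f L g \<tau> \<tau>b t w \<alpha> \<le> cost T f L g \<tau> \<tau>b t w \<beta>"
  using cINF_lower[OF cost_bdd_below[OF assms(1,2)] assms(4)] assms(3)
  by (simp add: optimal_control_def value_function_def)

end

section \<open>The pre-Hamiltonian along the costate and its gradients\<close>

locale adjoint_trajectory = controlled_trajectory t0 T A f L g \<tau> \<tau>b f\<^sub>z f\<^sub>y L\<^sub>z L\<^sub>y \<tau>\<^sub>t \<tau>\<^sub>z t w \<alpha> x D
  for t0 T :: real and A :: "(real^'m) set"
    and f :: "real \<Rightarrow> real^'n \<Rightarrow> real^'n \<Rightarrow> real^'m \<Rightarrow> real^'n" and L g \<tau> \<tau>b f\<^sub>z f\<^sub>y L\<^sub>z L\<^sub>y \<tau>\<^sub>t \<tau>\<^sub>z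
    and t w \<alpha> x D +
  fixes p :: "real \<Rightarrow> real^'n"
  assumes p: "\<exists>C. C-lipschitz_on {t..T} p"
begin

text \<open>With the costate inserted, \<open>f\<close> and \<open>L\<close> become one scalar
  function, and each pair of \<open>f\<close>- and \<open>L\<close>-terms in the adjoint equation
  becomes one of its partial gradients \<open>Hz\<close> and \<open>Hy\<close>.\<close>

definition Hm :: "real \<Rightarrow> real^'n \<Rightarrow> real^'n \<Rightarrow> real^'m \<Rightarrow> real" where
  "Hm s z y a = pre_hamiltonian f L s z y (p s) a"

definition Hz :: "real \<Rightarrow> real^'n \<Rightarrow> real^'n \<Rightarrow> real^'m \<Rightarrow> real^'n" where
  "Hz s z y a = transpose (f\<^sub>z s z y a) *v p s + L\<^sub>z s z y a"

definition Hy :: "real \<Rightarrow> real^'n \<Rightarrow> real^'n \<Rightarrow> real^'m \<Rightarrow> real^'n" where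
  "Hy s z y a = transpose (f\<^sub>y s z y a) *v p s + L\<^sub>y s z y a"

lemma p_bounded: "\<exists>P>0. \<forall>s\<in>{t..T}. norm (p s) \<le> P"
proof -
  have "compact (p ` {t..T})"
    using p by (intro compact_continuous_image) (auto intro: lipschitz_on_continuous_on)
  then show ?thesis using compact_imp_bounded bounded_pos by (metis imageI)
qed

lemma Hm_has_derivative:
  assumes "s \<in> {t..T}" "a \<in> A"
  shows "((\<lambda>(z, y). Hm s z y a) has_derivative (\<lambda>(h, k). Hz s z y a \<bullet> h + Hy s z y a \<bullet> k)) (at (z, y))"
proof -
  have s: "s \<in> {t0..T}" using assms t by simp
  have "((\<lambda>q. (\<lambda>(z, y). f s z y a) q \<bullet> p s + (\<lambda>(z, y). L s z y a) q) has_derivative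
      (\<lambda>q. (\<lambda>(h, k). f\<^sub>z s z y a *v h + f\<^sub>y s z y a *v k) q \<bullet> p s + (\<lambda>(h, k). L\<^sub>z s z y a \<bullet> h + L\<^sub>y s z y a \<bullet> k) q))
      (at (z, y))"
    using f_deriv L_deriv s assms(2) by (intro has_derivative_add has_derivative_inner_left) auto
  moreover have "(M *v h) \<bullet> q = (transpose M *v q) \<bullet> h" for M :: "real^'n^'n" and h q :: "real^'n"
    by (metis dot_lmul_matrix inner_commute vector_transpose_matrix transpose_transpose)
  ultimately show ?thesis
    by (simp add: Hm_def[abs_def] Hz_def Hy_def pre_hamiltonian_def case_prod_unfold inner_left_distrib algebra_simps)
qed

lemma Hm_lipschitz:
  assumes "R > 0"
  shows "\<exists>l>0. \<forall>s\<in>{t..T}. \<forall>a\<in>A. \<forall>z\<in>cball 0 R. \<forall>y\<in>cball 0 R. \<forall>z'\<in>cball 0 R. \<forall>y'\<in>cball 0 R.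
    norm (Hm s z y a - Hm s z' y' a) \<le> l * (norm (z - z') + norm (y - y'))"
proof -
  obtain P where P: "P > 0" "\<And>s. s \<in> {t..T} \<Longrightarrow> norm (p s) \<le> P" using p_bounded by blast
  obtain l1 where l1: "l1 > 0" "\<And>t a z y z' y'. \<lbrakk>t \<in> {t0..T}; a \<in> A\<rbrakk> \<Longrightarrow>
      norm (f t z y a - f t z' y' a) \<le> l1 * (norm (z - z') + norm (y - y'))"
    using f_lip by blast
  obtain l2 where l2: "l2 > 0" "\<And>t a z y z' y'. \<lbrakk>t \<in> {t0..T}; a \<in> A; z \<in> cball 0 R; y \<in> cball 0 R;
      z' \<in> cball 0 R; y' \<in> cball 0 R\<rbrakk> \<Longrightarrow> \<bar>L t z y a - L t z' y' a\<bar> \<le> l2 * (norm (z - z') + norm (y - y'))"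
    using L_lip[rule_format, OF assms] by blast
  have "norm (Hm s z y a - Hm s z' y' a) \<le> (l1 * P + l2) * (norm (z - z') + norm (y - y'))"
    if s: "s \<in> {t..T}" and a: "a \<in> A" and zy: "z \<in> cball 0 R" "y \<in> cball 0 R" "z' \<in> cball 0 R" "y' \<in> cball 0 R"
    for s a z y z' y'
  proof -
    let ?N = "norm (z - z') + norm (y - y')"
    have s': "s \<in> {t0..T}" using s t by simp
    have "Hm s z y a - Hm s z' y' a = (f s z y a - f s z' y' a) \<bullet> p s + (L s z y a - L s z' y' a)"
      by (simp add: Hm_def pre_hamiltonian_def inner_diff_left)
    then have "norm (Hm s z y a - Hm s z' y' a) \<le> \<bar>(f s z y a - f s z' y' a) \<bullet> p s\<bar> + \<bar>L s z y a - L s z' y' a\<bar>"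
      by simp
    also have "\<bar>(f s z y a - f s z' y' a) \<bullet> p s\<bar> \<le> norm (f s z y a - f s z' y' a) * norm (p s)"
      by (rule Cauchy_Schwarz_ineq2)
    also have "\<dots> \<le> (l1 * ?N) * P"
      using l1(1) by (intro mult_mono l1(2)[OF s' a] P(2)[OF s]) auto
    also have "\<bar>L s z y a - L s z' y' a\<bar> \<le> l2 * ?N" by (rule l2(2)[OF s' a zy])
    finally show ?thesis by (simp add: algebra_simps)
  qed
  moreover have "l1 * P + l2 > 0" using l1(1) l2(1) P(1) by (simp add: add_pos_pos)
  ultimately show ?thesis by blast
qed

text \<open>The gradients are bounded by the Lipschitz constant of \<open>Hm\<close>. That constant
  is taken on the ball of radius \<open>R + 1\<close>, so that unit increments from points of norm
  at most R stay inside.\<close>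

lemma Hm_gradient_bound:
  assumes "R > 0"
  shows "\<exists>l>0. \<forall>s\<in>{t..T}. \<forall>a\<in>A. \<forall>z\<in>cball 0 R. \<forall>y\<in>cball 0 R. \<forall>v.
    \<bar>Hz s z y a \<bullet> v\<bar> \<le> l * norm v \<and> \<bar>Hy s z y a \<bullet> v\<bar> \<le> l * norm v"
proof -
  obtain l where l: "l > 0" "\<And>s a z y z' y'. \<lbrakk>s \<in> {t..T}; a \<in> A; z \<in> cball 0 (R + 1); y \<in> cball 0 (R + 1);
      z' \<in> cball 0 (R + 1); y' \<in> cball 0 (R + 1)\<rbrakk> \<Longrightarrow>
      norm (Hm s z y a - Hm s z' y' a) \<le> l * (norm (z - z') + norm (y - y'))"
    using Hm_lipschitz[of "R + 1"] assms by (metis add_pos_pos zero_less_one)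
  have main: "norm (Hz s z y a \<bullet> h + Hy s z y a \<bullet> k) \<le> l * (norm h + norm k)"
    if s: "s \<in> {t..T}" and a: "a \<in> A" and zy: "z \<in> cball 0 R" "y \<in> cball 0 R" for s a z y h k
  proof -
    have "norm ((\<lambda>(h, k). Hz s z y a \<bullet> h + Hy s z y a \<bullet> k) (h, k)) \<le> l * (\<lambda>(h, k). norm h + norm k) (h, k)"
    proof (rule has_derivative_lipschitz_bound[OF Hm_has_derivative[OF s a] zero_less_one])
      fix hk :: "(real^'n) \<times> (real^'n)" assume hk: "norm hk \<le> 1"
      obtain h k where e: "hk = (h, k)" by force
      have "norm h \<le> 1" "norm k \<le> 1"
        using hk norm_fst_le[of h k] norm_snd_le[of k h] by (auto simp: e)
      then have "norm (Hm s (z + h) (y + k) a - Hm s z y a) \<le> l * (norm (z + h - z) + norm (y + k - y))"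
        using zy norm_triangle_ineq[of z h] norm_triangle_ineq[of y k] by (intro l(2)[OF s a]) auto
      then show "norm ((\<lambda>(z, y). Hm s z y a) ((z, y) + hk) - (\<lambda>(z, y). Hm s z y a) (z, y)) \<le> l * (\<lambda>(h, k). norm h + norm k) hk"
        by (simp add: e)
    qed (auto simp: algebra_simps)
    then show ?thesis by simp
  qed
  have "\<bar>Hz s z y a \<bullet> v\<bar> \<le> l * norm v \<and> \<bar>Hy s z y a \<bullet> v\<bar> \<le> l * norm v"
    if "s \<in> {t..T}" "a \<in> A" "z \<in> cball 0 R" "y \<in> cball 0 R" for s a z y v
    using main[OF that, of v 0] main[OF that, of 0 v] by simp
  with l(1) show ?thesis by blast
qed

lemma rhs_Hm: "rhs Hm u s a = rhs f u s a \<bullet> p s + rhs L u s a"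
  by (simp add: rhs_def Hm_def pre_hamiltonian_def)

definition \<xi> :: "real \<Rightarrow> real^'n" where "\<xi> s = vector_derivative x (at (D s))"

definition Gz :: "real \<Rightarrow> real^'n" where "Gz s = Hz s (x s) (x (D s)) (\<alpha> s)"

definition Gy :: "real \<Rightarrow> real^'n" where "Gy s = Hy s (x s) (x (D s)) (\<alpha> s)"

text \<open>The right-hand side of the adjoint equation paired with a test vector v. In this scalar
  form the transposes disappear and v can be replaced by the variation
  \<open>\<delta> n s\<close>.\<close>

definition adjoint_form :: "(real \<Rightarrow> real^'n) \<Rightarrow> real \<Rightarrow> real^'n \<Rightarrow> real" where
  "adjoint_form gw s v = - (Gz s \<bullet> v) + (\<xi> s \<bullet> Gy s) * (\<tau>\<^sub>z s (x s) \<bullet> v)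
     - (indicator {t..D T} s * deriv \<gamma> s) * (Gy (\<gamma> s) \<bullet> v) - indicator {T - \<tau>b..T} s * (gw (s - T) \<bullet> v)"

end

section \<open>The perturbed trajectories and the size of their deviation\<close>

locale needle_variation = adjoint_trajectory t0 T A f L g \<tau> \<tau>b f\<^sub>z f\<^sub>y L\<^sub>z L\<^sub>y \<tau>\<^sub>t \<tau>\<^sub>z t w \<alpha> x D p
  for t0 T :: real and A :: "(real^'m) set"
    and f :: "real \<Rightarrow> real^'n \<Rightarrow> real^'n \<Rightarrow> real^'m \<Rightarrow> real^'n" and L g \<tau> \<tau>b f\<^sub>z f\<^sub>y L\<^sub>z L\<^sub>y \<tau>\<^sub>t \<tau>\<^sub>z
    and t w \<alpha> x D p +
  fixes s0 :: real and a :: "real^'m"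
  assumes s0: "s0 \<in> {t<..<T}" and a: "a \<in> A"
begin

text \<open>The denominator starts at 2, so that every needle begins strictly after t.\<close>

definition e :: "nat \<Rightarrow> real" where "e n = (s0 - t) / (real n + 2)"

text \<open>The needle ends at \<open>s0\<close>, so the Lebesgue point property will be used from
  the left.\<close>

definition \<beta> :: "nat \<Rightarrow> real \<Rightarrow> real^'m" where
  "\<beta> n s = (if s \<in> {s0 - e n..s0} then a else \<alpha> s)"

definition y :: "nat \<Rightarrow> real \<Rightarrow> real^'n" where "y n = trajectory T f \<tau> \<tau>b t w (\<beta> n)"

definition \<delta> :: "nat \<Rightarrow> real \<Rightarrow> real^'n" where "\<delta> n s = y n s - x s"

lemma e_pos: "e n > 0" using s0 by (simp add: e_def)

lemma e_less: "t < s0 - e n"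
proof -
  have "(s0 - t) * 1 < (s0 - t) * (real n + 2)" using s0 by (intro mult_strict_left_mono) auto
  then have "e n < s0 - t" by (simp add: e_def pos_divide_less_eq)
  then show ?thesis by simp
qed

lemma e_lim: "e \<longlonglongrightarrow> 0"
proof -
  have "(\<lambda>n. (s0 - t) * inverse (real (Suc (Suc n)))) \<longlonglongrightarrow> 0"
    by (rule tendsto_mult_right_zero[OF LIMSEQ_Suc[OF LIMSEQ_inverse_real_of_nat]])
  then show ?thesis by (simp add: e_def[abs_def] divide_inverse add.commute)
qed

lemma \<beta>_controls: "\<beta> n \<in> controls A t T"
proof -
  have "\<beta> n \<in> borel_measurable (lebesgue_on {t<..<T})"
    unfolding \<beta>_def[abs_def]
    by (rule measurable_If_set) (use \<alpha> in \<open>auto simp: controls_def sets_restrict_space\<close>)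
  then show ?thesis using \<alpha> a by (auto simp: controls_def \<beta>_def)
qed

lemma \<beta>_off: "s \<notin> {s0 - e n..s0} \<Longrightarrow> \<beta> n s = \<alpha> s"
  unfolding \<beta>_def by (rule if_not_P)

lemma y_solution: "solves t w (\<beta> n) (y n)"
  unfolding y_def by (rule trajectory_is_solution[OF t w \<beta>_controls])

lemma variation_bounds:
  "\<exists>R>0. \<exists>C\<ge>0. \<exists>K\<ge>0. C-lipschitz_on {t - \<tau>b..T} x \<and> (\<forall>n. C-lipschitz_on {t - \<tau>b..T} (y n)) \<and>
    (\<forall>s\<in>{t - \<tau>b..T}. norm (x s) \<le> R \<and> (\<forall>n. norm (y n s) \<le> R \<and> norm (\<delta> n s) \<le> K * e n))"
proof -
  obtain R C where R: "R > 0" and sols: "\<And>\<alpha> x. \<lbrakk>\<alpha> \<in> controls A t T; solves t w \<alpha> x\<rbrakk> \<Longrightarrow>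
     (\<forall>s\<in>{t - \<tau>b..T}. norm (x s) \<le> R) \<and> C-lipschitz_on {t - \<tau>b..T} x"
    using solution_bounds[OF t w] by blast
  obtain K where K: "K \<ge> 0" and stable: "\<forall>\<alpha>\<in>controls A t T. \<forall>\<beta>\<in>controls A t T. \<forall>x y c d.
     solves t w \<alpha> x \<longrightarrow> solves t w \<beta> y \<longrightarrow> c \<le> d \<longrightarrow>
     (\<forall>s\<in>{t<..<T} - {c..d}. \<alpha> s = \<beta> s) \<longrightarrow> (\<forall>s\<in>{t - \<tau>b..T}. norm (x s - y s) \<le> K * (d - c))"
    using solution_stability[OF t w] by blast
  have "norm (\<delta> n s) \<le> K * e n" if "s \<in> {t - \<tau>b..T}" for n s
    using stable[rule_format, OF \<beta>_controls \<alpha> y_solution sol, of "s0 - e n" s0 n s] that e_pos[of n] \<beta>_off[of _ n]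
    by (auto simp: \<delta>_def)
  moreover have "C \<ge> 0" using sols[OF \<alpha> sol] lipschitz_on_nonneg by blast
  ultimately show ?thesis
    using R K sols[OF \<alpha> sol] sols[OF \<beta>_controls y_solution] by blast
qed

lemma \<delta>_initial: "s \<in> {t - \<tau>b..t} \<Longrightarrow> \<delta> n s = 0"
  by (simp add: \<delta>_def solution_initial[OF y_solution] solution_initial[OF sol])

lemma \<delta>_integral:
  assumes "s \<in> {t..T}"
  shows "\<delta> n s = integral {t..s} (\<lambda>r. rhs f (y n) r (\<beta> n r) - rhs f x r (\<alpha> r))"
proof -
  have "(\<lambda>r. rhs f (y n) r (\<beta> n r)) integrable_on {t..s}" "(\<lambda>r. rhs f x r (\<alpha> r)) integrable_on {t..s}"
    using rhs_f_integrable_on[OF solution_continuous[OF y_solution] t \<beta>_controls]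
      rhs_f_integrable_on[OF solution_continuous[OF sol] t \<alpha>] assms by auto
  then show ?thesis
    by (simp add: \<delta>_def solution_integral[OF y_solution t \<beta>_controls assms]
        solution_integral[OF sol t \<alpha> assms] Henstock_Kurzweil_Integration.integral_diff)
qed

text \<open>Away from the needle the variation not only has size \<open>O(e n)\<close> but also Lipschitz constant \<open>O(e n)\<close>.\<close>
lemma \<delta>_lipschitz_off_needle:
  "\<exists>C\<ge>0. \<forall>n u v. u \<in> {t - \<tau>b..T} \<longrightarrow> v \<in> {t - \<tau>b..T} \<longrightarrow> u \<le> v \<longrightarrow> {u..v} \<inter> {s0 - e n..s0} = {} \<longrightarrow>
     norm (\<delta> n v - \<delta> n u) \<le> C * e n * (v - u)"
proof -
  obtain R C K where bd: "K \<ge> 0" "C-lipschitz_on {t - \<tau>b..T} x"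
    "\<And>s n. s \<in> {t - \<tau>b..T} \<Longrightarrow> norm (\<delta> n s) \<le> K * e n"
    using variation_bounds by blast
  obtain Kf where Kf: "Kf > 0" "\<And>t u v s a E. \<lbrakk>C-lipschitz_on {t - \<tau>b..T} u; s \<in> {t0..T}; t \<le> s; a \<in> A;
     \<forall>r\<in>{t - \<tau>b..s}. norm (u r - v r) \<le> E\<rbrakk> \<Longrightarrow> norm (rhs f u s a - rhs f v s a) \<le> Kf * E"
    using f_rhs_diff[of C] by blast
  have late: "norm (\<delta> n v - \<delta> n u) \<le> Kf * K * e n * (v - u)"
    if uv: "u \<in> {t..T}" "v \<in> {t..T}" "u \<le> v" "{u..v} \<inter> {s0 - e n..s0} = {}" for n u v
  proof -
    define h where "h r = rhs f (y n) r (\<beta> n r) - rhs f x r (\<alpha> r)" for r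
    have h_int: "h integrable_on {c..d}" if "t \<le> c" "d \<le> T" for c d
      unfolding h_def using that
      by (intro integrable_diff rhs_f_integrable_on[OF solution_continuous[OF y_solution] t \<beta>_controls]
        rhs_f_integrable_on[OF solution_continuous[OF sol] t \<alpha>])
    have "integral {t..u} h + integral {u..v} h = integral {t..v} h"
      by (rule Henstock_Kurzweil_Integration.integral_combine) (use uv in \<open>auto intro: h_int\<close>)
    then have "\<delta> n v - \<delta> n u = integral {u..v} h"
      using \<delta>_integral[OF uv(1), of n] \<delta>_integral[OF uv(2), of n] by (simp add: h_def[abs_def] algebra_simps)
    also have "norm \<dots> \<le> Kf * (K * e n) * (v - u)"
    proof (rule integral_norm_bound_const_interior)
      fix r assume r: "r \<in> {u<..<v}"
      then have "r \<notin> {s0 - e n..s0}" using uv(4) by (metis IntI empty_iff greaterThanLessThan_iff atLeastAtMost_iff less_imp_le)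
      then have \<beta>r: "\<beta> n r = \<alpha> r" by (rule \<beta>_off)
      have "norm (rhs f x r (\<alpha> r) - rhs f (y n) r (\<alpha> r)) \<le> Kf * (K * e n)"
      proof (rule Kf(2)[OF bd(2)])
        show "\<forall>q\<in>{t - \<tau>b..r}. norm (x q - y n q) \<le> K * e n"
          using bd(3)[of _ n] r uv(2) by (auto simp: \<delta>_def norm_minus_commute)
      qed (use r uv t \<alpha> in \<open>auto simp: controls_def\<close>)
      then show "norm (h r) \<le> Kf * (K * e n)" by (simp add: h_def \<beta>r norm_minus_commute)
    qed (use uv in \<open>auto intro: h_int\<close>)
    finally show ?thesis by (simp add: mult.assoc)
  qed
  have C0: "Kf * K \<ge> 0" using Kf(1) bd(1) by simp
  have "norm (\<delta> n v - \<delta> n u) \<le> Kf * K * e n * (v - u)"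
    if uv: "u \<in> {t - \<tau>b..T}" "v \<in> {t - \<tau>b..T}" "u \<le> v" "{u..v} \<inter> {s0 - e n..s0} = {}" for n u v
  proof -
    \<comment> \<open>The variation vanishes up to time t, so an interval straddling t is cut there
      and its left part contributes nothing.\<close>
    consider "t \<le> u" | "u < t" "t \<le> v" | "v < t" by linarith
    then show ?thesis
    proof cases
      case 1
      then show ?thesis using late[of u v n] uv by simp
    next
      case 2
      have "norm (\<delta> n v - \<delta> n t) \<le> Kf * K * e n * (v - t)"
        using late[of t v n] uv 2 by auto
      also have "\<dots> \<le> Kf * K * e n * (v - u)"
        using C0 e_pos[of n] 2 by (intro mult_left_mono) (auto simp: mult_nonneg_nonneg)
      finally show ?thesis using \<delta>_initial[of t n] \<delta>_initial[of u n] uv 2 max_delay_nonneg by simp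
    next
      case 3
      then have "\<delta> n u = 0" "\<delta> n v = 0" using uv by (auto intro: \<delta>_initial)
      then show ?thesis using C0 e_pos[of n] uv(3) by (simp add: mult_nonneg_nonneg less_imp_le)
    qed
  qed
  with C0 show ?thesis by blast
qed

text \<open>The increment of \<open>Hm\<close> under the fixed control \<open>\<beta> n\<close>
  minus its linearisation. The delayed argument is displaced by the variation at \<open>D s\<close>
  and by the shift of the delayed time itself; to first order the shift contributes minus the inner
  product of \<open>\<tau>\<^sub>z\<close> and \<open>\<delta> n s\<close> times
  \<open>\<xi> s\<close>, which explains the plus sign. The gradients use \<alpha> also on the
  needle, where this is no linearisation; but every s other than \<open>s0\<close> eventually leaves
  the needle.\<close>

definition remainder :: "nat \<Rightarrow> real \<Rightarrow> real" where
  "remainder n s = rhs Hm (y n) s (\<beta> n s) - rhs Hm x s (\<beta> n s) - Gz s \<bullet> \<delta> n s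
     + (\<xi> s \<bullet> Gy s) * (\<tau>\<^sub>z s (x s) \<bullet> \<delta> n s) - Gy s \<bullet> \<delta> n (D s)"

text \<open>Each clause removes a null set. Differentiability at an interior point
  \<open>D s\<close> also bounds \<open>\<xi> s\<close>; the condition on \<open>D s\<close> keeps
  the two delayed times away from the needle for large n, and \<open>s \<noteq> s0\<close> does the
  same for s.\<close>

definition regular_time :: "real \<Rightarrow> bool" where
  "regular_time s \<longleftrightarrow> (x has_vector_derivative \<xi> s) (at (D s)) \<and> D s \<in> {t - \<tau>b<..<T} \<and> D s \<noteq> s0 \<and> s \<noteq> s0"

lemma AE_regular_time: "AE s in lebesgue_on {t<..<T}. regular_time s"
proof -
  have "AE s in lebesgue_on {t<..<T}. D s \<notin> {t - \<tau>b, s0}" by (rule AE_D_notin) simp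
  moreover have "AE s in lebesgue_on {t<..<T}. s \<noteq> s0"
    by (auto simp: AE_lebesgue_on_iff_negligible intro: negligible_subset[of "{s0}"])
  ultimately have "AE s in lebesgue_on {t<..<T}. (x has_vector_derivative \<xi> s) (at (D s)) \<and>
      D s \<notin> {t - \<tau>b, s0} \<and> s \<noteq> s0"
    using AE_x_differentiable_D unfolding \<xi>_def by (intro AE_conjI)
  then show ?thesis
  proof (rule lebesgue_on_mono)
    fix s assume "(x has_vector_derivative \<xi> s) (at (D s)) \<and> D s \<notin> {t - \<tau>b, s0} \<and> s \<noteq> s0" "s \<in> {t<..<T}"
    then show "regular_time s" using D_le[of s] by (auto simp: regular_time_def)
  qed
qed

text \<open>This supplies the dominating constant after division by \<open>e n\<close>. No
  cancellation is involved: each term is of order \<open>e n\<close> by itself, also on the needle,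
  because both values of \<open>Hm\<close> carry the same control.\<close>

lemma remainder_bound: "\<exists>C. \<forall>n. \<forall>s\<in>{t<..<T}. regular_time s \<longrightarrow> \<bar>remainder n s\<bar> \<le> C * e n"
proof -
  obtain R C K where bd: "R > 0" "C \<ge> 0" "K \<ge> 0" "C-lipschitz_on {t - \<tau>b..T} x"
    "\<And>s. s \<in> {t - \<tau>b..T} \<Longrightarrow> norm (x s) \<le> R"
    "\<And>s n. s \<in> {t - \<tau>b..T} \<Longrightarrow> norm (y n s) \<le> R"
    "\<And>s n. s \<in> {t - \<tau>b..T} \<Longrightarrow> norm (\<delta> n s) \<le> K * e n"
    using variation_bounds by blast
  obtain l where l: "l > 0" "\<And>s a z y z' y'. \<lbrakk>s \<in> {t..T}; a \<in> A; z \<in> cball 0 R; y \<in> cball 0 R;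
      z' \<in> cball 0 R; y' \<in> cball 0 R\<rbrakk> \<Longrightarrow>
      norm (Hm s z y a - Hm s z' y' a) \<le> l * (norm (z - z') + norm (y - y'))"
    using Hm_lipschitz[OF bd(1)] by blast
  obtain l' where l': "l' > 0" "\<And>s a z y v. \<lbrakk>s \<in> {t..T}; a \<in> A; z \<in> cball 0 R; y \<in> cball 0 R\<rbrakk> \<Longrightarrow>
      \<bar>Hz s z y a \<bullet> v\<bar> \<le> l' * norm v \<and> \<bar>Hy s z y a \<bullet> v\<bar> \<le> l' * norm v"
    using Hm_gradient_bound[OF bd(1)] by blast
  obtain k where k: "k > 0" "\<And>t z y. t \<in> {t0..T} \<Longrightarrow> \<bar>\<tau> t z - \<tau> t y\<bar> \<le> k * norm (z - y)"
    using \<tau>_lip by blast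
  have "\<bar>remainder n s\<bar> \<le> (l * (2 + C * k) * K + l' * K + (l' * C) * (k * K) + l' * K) * e n"
    if s: "s \<in> {t<..<T}" and reg: "regular_time s" for n s
  proof -
    have s': "s \<in> {t..T}" "s \<in> {t0..T}" "t \<le> s" using s t by auto
    have \<beta>: "\<beta> n s \<in> A" and \<alpha>s: "\<alpha> s \<in> A" using \<beta>_controls[of n] \<alpha> s by (auto simp: controls_def)
    have "s \<in> {t - \<tau>b..T}" using s max_delay_nonneg by simp
    then have xs: "x s \<in> cball 0 R" "norm (\<delta> n s) \<le> K * e n" using bd(5,7) by auto
    have "D s \<in> {t - \<tau>b..T}" using D_le[OF s'(1)] s by simp
    then have xD: "x (D s) \<in> cball 0 R" "norm (\<delta> n (D s)) \<le> K * e n" using bd(5,7) by auto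
    have "norm (rhs Hm x s (\<beta> n s) - rhs Hm (y n) s (\<beta> n s)) \<le> l * (2 + C * k) * (K * e n)"
    proof (rule rhs_diff[where F = Hm and Z = "cball 0 R", OF l(2)[OF s'(1) \<beta>] bd(4)])
      show "norm (x r - y n r) \<le> K * e n" if "r \<in> {t - \<tau>b..s}" for r
        using bd(7)[of r n] that s by (simp add: \<delta>_def norm_minus_commute)
    qed (use k l(1) s' bd in auto)
    then have 1: "\<bar>rhs Hm (y n) s (\<beta> n s) - rhs Hm x s (\<beta> n s)\<bar> \<le> l * (2 + C * k) * (K * e n)"
      by (simp add: abs_minus_commute)
    have "\<bar>Gz s \<bullet> \<delta> n s\<bar> \<le> l' * norm (\<delta> n s)"
      unfolding Gz_def using l'(2)[OF s'(1) \<alpha>s xs(1) xD(1)] by blast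
    also have "\<dots> \<le> l' * (K * e n)" using xs(2) l'(1) by (intro mult_left_mono) auto
    finally have 2: "\<bar>Gz s \<bullet> \<delta> n s\<bar> \<le> l' * (K * e n)" .
    have Gy: "\<bar>Gy s \<bullet> v\<bar> \<le> l' * norm v" for v
      unfolding Gy_def using l'(2)[OF s'(1) \<alpha>s xs(1) xD(1)] by blast
    have "\<bar>Gy s \<bullet> \<delta> n (D s)\<bar> \<le> l' * norm (\<delta> n (D s))" by (rule Gy)
    also have "\<dots> \<le> l' * (K * e n)" using xD(2) l'(1) by (intro mult_left_mono) auto
    finally have 3: "\<bar>Gy s \<bullet> \<delta> n (D s)\<bar> \<le> l' * (K * e n)" .
    have "norm (\<xi> s) \<le> C"
      by (rule lipschitz_vector_derivative_bound[OF bd(4)]) (use reg in \<open>auto simp: regular_time_def\<close>)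
    then have "l' * norm (\<xi> s) \<le> l' * C" using l'(1) by (intro mult_left_mono) auto
    then have xi: "\<bar>\<xi> s \<bullet> Gy s\<bar> \<le> l' * C" using Gy[of "\<xi> s"] by (simp add: inner_commute)
    have "norm (\<tau>\<^sub>z s (x s) \<bullet> \<delta> n s) \<le> k * norm (\<delta> n s)"
    proof (rule has_derivative_lipschitz_bound[OF delay_has_derivative_state[OF s'(2)] zero_less_one])
      show "norm (\<tau> s (x s + h) - \<tau> s (x s)) \<le> k * norm h" for h
        using k(2)[OF s'(2), of "x s + h" "x s"] by simp
    qed simp
    also have "\<dots> \<le> k * (K * e n)" using xs(2) k(1) by (intro mult_left_mono) auto
    finally have "\<bar>\<xi> s \<bullet> Gy s\<bar> * \<bar>\<tau>\<^sub>z s (x s) \<bullet> \<delta> n s\<bar> \<le> (l' * C) * (k * (K * e n))"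
      using xi l'(1) bd(2) by (intro mult_mono) auto
    then have 4: "\<bar>(\<xi> s \<bullet> Gy s) * (\<tau>\<^sub>z s (x s) \<bullet> \<delta> n s)\<bar> \<le> (l' * C) * (k * (K * e n))"
      by (simp only: abs_mult)
    have "\<bar>remainder n s\<bar> \<le> l * (2 + C * k) * (K * e n) + l' * (K * e n) + (l' * C) * (k * (K * e n)) + l' * (K * e n)"
      unfolding remainder_def using 1 2 3 4 by linarith
    then show ?thesis by (simp add: algebra_simps)
  qed
  then show ?thesis by blast
qed

text \<open>For large n the time s lies off the needle and the control there is \<alpha>. The
  quotient then splits into four errors: E1, E3 and E4 come from linearising \<open>Hm\<close>,
  \<open>x\<close> at \<open>D s\<close> and \<open>\<tau>\<close>. E2 is of another kind: it is the
  change of \<open>\<delta> n\<close> between the two delayed times, and it vanishes because off the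
  needle both the slope of \<open>\<delta> n\<close> and the time shift are of order
  \<open>e n\<close>.\<close>

lemma remainder_limit:
  assumes s: "s \<in> {t<..<T}" and reg: "regular_time s"
  shows "(\<lambda>n. remainder n s / e n) \<longlonglongrightarrow> 0"
proof -
  obtain R C K where bd: "C \<ge> 0" "K \<ge> 0" "C-lipschitz_on {t - \<tau>b..T} x"
    "\<And>s n. s \<in> {t - \<tau>b..T} \<Longrightarrow> norm (\<delta> n s) \<le> K * e n"
    using variation_bounds by blast
  obtain k where k: "k > 0" "\<And>t z y. t \<in> {t0..T} \<Longrightarrow> \<bar>\<tau> t z - \<tau> t y\<bar> \<le> k * norm (z - y)"
    using \<tau>_lip by blast
  obtain C' where C': "C' \<ge> 0" "\<And>n u v. \<lbrakk>u \<in> {t - \<tau>b..T}; v \<in> {t - \<tau>b..T}; u \<le> v;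
      {u..v} \<inter> {s0 - e n..s0} = {}\<rbrakk> \<Longrightarrow> norm (\<delta> n v - \<delta> n u) \<le> C' * e n * (v - u)"
    using \<delta>_lipschitz_off_needle by blast
  have s': "s \<in> {t..T}" "s \<in> {t0..T}" "t \<le> s" and \<alpha>s: "\<alpha> s \<in> A" using s t \<alpha> by (auto simp: controls_def)
  define Dn where "Dn n = s - \<tau> s (y n s)" for n
  define q where "q n = Dn n - D s" for n
  define Y where "Y = x (D s)"
  define kn where "kn n = y n (Dn n) - Y" for n
  have Ds: "D s \<in> {t - \<tau>b..T}" using D_le[OF s'(1)] s by simp
  have Dn: "Dn n \<in> {t - \<tau>b..T}" for n
    using delayed_time_in[OF s'(2,3), of "y n s"] s by (simp add: Dn_def)
  have \<delta>s: "norm (\<delta> n s) \<le> K * e n" for n using bd(4)[of s n] s max_delay_nonneg by simp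
  have q: "\<bar>q n\<bar> \<le> k * K * e n" for n
  proof -
    have "\<bar>q n\<bar> \<le> k * norm (\<delta> n s)"
      using k(2)[OF s'(2), of "x s" "y n s"] by (simp add: q_def Dn_def D \<delta>_def norm_minus_commute)
    also have "\<dots> \<le> k * (K * e n)" using \<delta>s k(1) by (intro mult_left_mono) auto
    finally show ?thesis by simp
  qed
  have kn_eq: "kn n = \<delta> n (Dn n) + (x (D s + q n) - Y)" for n
    by (simp add: kn_def \<delta>_def q_def)
  have kn: "norm (kn n) \<le> (K + C * (k * K)) * e n" for n
  proof -
    have "norm (x (Dn n) - Y) \<le> C * norm (Dn n - D s)"
      unfolding Y_def by (rule lipschitz_on_normD[OF bd(3) Dn Ds])
    also have "\<dots> \<le> C * (k * K * e n)" using q bd(1) by (intro mult_left_mono) (auto simp: q_def)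
    finally have "norm (kn n) \<le> K * e n + C * (k * K * e n)"
      unfolding kn_eq using bd(4)[OF Dn] by (intro norm_triangle_le add_mono) (auto simp: q_def)
    then show ?thesis by (simp add: algebra_simps)
  qed
  define E1 where "E1 n = (Hm s (x s + \<delta> n s) (Y + kn n) (\<alpha> s) - Hm s (x s) Y (\<alpha> s) - (Gz s \<bullet> \<delta> n s + Gy s \<bullet> kn n)) / e n" for n
  define E2 where "E2 n = (\<delta> n (Dn n) - \<delta> n (D s)) /\<^sub>R e n" for n
  define E3 where "E3 n = (x (D s + q n) - Y - q n *\<^sub>R \<xi> s) /\<^sub>R e n" for n
  define E4 where "E4 n = (\<tau> s (x s + \<delta> n s) - \<tau> s (x s) - \<tau>\<^sub>z s (x s) \<bullet> \<delta> n s) / e n" for n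
  have "E1 \<longlonglongrightarrow> 0"
  proof -
    have "norm (\<delta> n s, kn n) \<le> (K + (K + C * (k * K))) * e n" for n
      using norm_Pair_le[of "\<delta> n s" "kn n"] \<delta>s[of n] kn[of n] by (simp add: algebra_simps)
    from has_derivative_seq[OF Hm_has_derivative[OF s'(1) \<alpha>s, of "x s" Y] this e_pos e_lim]
    show ?thesis by (simp add: E1_def[abs_def] Gz_def Gy_def Y_def divide_inverse mult.commute)
  qed
  moreover have "E2 \<longlonglongrightarrow> 0"
  proof (rule Lim_null_comparison)
    show "(\<lambda>n. C' * (k * K) * e n) \<longlonglongrightarrow> 0" by (rule tendsto_mult_right_zero[OF e_lim])
    \<comment> \<open>The shift of the delayed time is at most \<open>k * K * e n\<close> and the
      needle has length \<open>e n\<close>. Once the sum is below the distance from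
      \<open>D s\<close> to \<open>s0\<close>, the interval between the two delayed times misses the
      needle.\<close>
    have "(\<lambda>n. (k * K + 1) * e n) \<longlonglongrightarrow> 0" by (rule tendsto_mult_right_zero[OF e_lim])
    moreover have "\<bar>D s - s0\<bar> > 0" using reg by (simp add: regular_time_def)
    ultimately have "\<forall>\<^sub>F n in sequentially. (k * K + 1) * e n < \<bar>D s - s0\<bar>"
      by (rule order_tendstoD(2))
    then show "\<forall>\<^sub>F n in sequentially. norm (E2 n) \<le> C' * (k * K) * e n"
    proof eventually_elim
      case (elim n)
      then have far: "\<bar>q n\<bar> + e n < \<bar>D s - s0\<bar>" using q[of n] by (simp add: algebra_simps)
      have "norm (\<delta> n (Dn n) - \<delta> n (D s)) \<le> C' * e n * \<bar>q n\<bar>"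
      proof (cases "D s \<le> Dn n")
        case True
        then have "{D s..Dn n} \<inter> {s0 - e n..s0} = {}" using far by (auto simp: q_def)
        then show ?thesis using C'(2)[OF Ds Dn True] True by (simp add: q_def)
      next
        case False
        then have "{Dn n..D s} \<inter> {s0 - e n..s0} = {}" using far by (auto simp: q_def)
        then show ?thesis using C'(2)[OF Dn Ds] False by (simp add: q_def norm_minus_commute)
      qed
      also have "\<dots> \<le> C' * e n * (k * K * e n)"
        using q C'(1) e_pos[of n] by (intro mult_left_mono) auto
      finally have "norm (\<delta> n (Dn n) - \<delta> n (D s)) / e n \<le> C' * (k * K) * e n"
        using e_pos[of n] by (simp add: pos_divide_le_eq mult_ac)
      then show ?case using e_pos[of n] by (simp add: E2_def divide_inverse_commute)
    qed
  qed
  moreover have "E3 \<longlonglongrightarrow> 0"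
  proof -
    have "(x has_derivative (\<lambda>h. h *\<^sub>R \<xi> s)) (at (D s))"
      using reg by (simp add: regular_time_def has_vector_derivative_def)
    from has_derivative_seq[OF this _ e_pos e_lim, of q "k * K"] q
    show ?thesis by (simp add: E3_def[abs_def] Y_def)
  qed
  moreover have "E4 \<longlonglongrightarrow> 0"
    using has_derivative_seq[OF delay_has_derivative_state[OF s'(2)] \<delta>s e_pos e_lim, of "x s"]
    by (simp add: E4_def[abs_def] divide_inverse mult.commute)
  ultimately have "(\<lambda>n. E1 n + Gy s \<bullet> (E2 n + E3 n - E4 n *\<^sub>R \<xi> s)) \<longlonglongrightarrow> 0 + Gy s \<bullet> (0 + 0 - 0 *\<^sub>R \<xi> s)"
    by (intro tendsto_intros)
  then have lim: "(\<lambda>n. E1 n + Gy s \<bullet> (E2 n + E3 n - E4 n *\<^sub>R \<xi> s)) \<longlonglongrightarrow> 0" by simp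
  have "\<forall>\<^sub>F n in sequentially. e n < \<bar>s - s0\<bar>"
    by (rule order_tendstoD(2)[OF e_lim]) (use reg in \<open>simp add: regular_time_def\<close>)
  then have "\<forall>\<^sub>F n in sequentially. E1 n + Gy s \<bullet> (E2 n + E3 n - E4 n *\<^sub>R \<xi> s) = remainder n s / e n"
  proof eventually_elim
    case (elim n)
    then have \<beta>s: "\<beta> n s = \<alpha> s" by (intro \<beta>_off) auto
    have "rhs Hm (y n) s (\<alpha> s) = Hm s (x s + \<delta> n s) (Y + kn n) (\<alpha> s)"
      by (simp add: rhs_def \<delta>_def kn_def Dn_def)
    moreover have "rhs Hm x s (\<alpha> s) = Hm s (x s) Y (\<alpha> s)" by (simp add: rhs_def Y_def D)
    ultimately have "remainder n s / e n = E1 n + (Gy s \<bullet> kn n + (\<xi> s \<bullet> Gy s) * (\<tau>\<^sub>z s (x s) \<bullet> \<delta> n s) - Gy s \<bullet> \<delta> n (D s)) / e n"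
      by (simp add: remainder_def \<beta>s E1_def diff_divide_distrib add_divide_distrib)
    also have "Gy s \<bullet> kn n + (\<xi> s \<bullet> Gy s) * (\<tau>\<^sub>z s (x s) \<bullet> \<delta> n s) - Gy s \<bullet> \<delta> n (D s)
        = Gy s \<bullet> ((\<delta> n (Dn n) - \<delta> n (D s)) + (x (D s + q n) - Y - q n *\<^sub>R \<xi> s)
            - (\<tau> s (x s + \<delta> n s) - \<tau> s (x s) - \<tau>\<^sub>z s (x s) \<bullet> \<delta> n s) *\<^sub>R \<xi> s)"
    proof -
      \<comment> \<open>The shift \<open>q n\<close> is minus the increment of the delay. So
        \<open>q n *\<^sub>R \<xi> s\<close> cancels between the linearisations of \<open>x\<close>
        and of \<open>\<tau>\<close>, leaving the first-order term with
        \<open>\<tau>\<^sub>z\<close>.\<close>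
      have eq: "\<tau> s (x s + \<delta> n s) = \<tau> s (x s) - q n" by (simp add: q_def Dn_def D \<delta>_def)
      show ?thesis unfolding eq
        by (simp add: kn_eq inner_add_right inner_diff_right inner_commute[of "\<xi> s"] algebra_simps)
    qed
    also have "\<dots> / e n = Gy s \<bullet> (E2 n + E3 n - E4 n *\<^sub>R \<xi> s)"
      by (simp add: E2_def E3_def E4_def inner_add_right inner_diff_right divide_inverse algebra_simps)
    finally show ?case by simp
  qed
  then show ?thesis by (rule Lim_transform_eventually[OF lim])
qed

end

section \<open>Expansion of the cost\<close>

lemma lipschitz_on_inner:
  fixes u v :: "'a::metric_space \<Rightarrow> 'b::real_inner"
  assumes u: "C-lipschitz_on S u" "\<And>s. s \<in> S \<Longrightarrow> norm (u s) \<le> B"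
    and v: "C'-lipschitz_on S v" "\<And>s. s \<in> S \<Longrightarrow> norm (v s) \<le> B'" and B: "B \<ge> 0" "B' \<ge> 0"
  shows "(C * B' + B * C')-lipschitz_on S (\<lambda>s. u s \<bullet> v s)"
proof (rule lipschitz_onI)
  fix r s assume rs: "r \<in> S" "s \<in> S"
  have "u r \<bullet> v r - u s \<bullet> v s = (u r - u s) \<bullet> v r + u s \<bullet> (v r - v s)"
    by (simp add: inner_diff_left inner_diff_right)
  then have "\<bar>u r \<bullet> v r - u s \<bullet> v s\<bar> \<le> norm (u r - u s) * norm (v r) + norm (u s) * norm (v r - v s)"
    using Cauchy_Schwarz_ineq2[of "u r - u s" "v r"] Cauchy_Schwarz_ineq2[of "u s" "v r - v s"] by linarith
  also have "\<dots> \<le> (C * dist r s) * B' + B * (C' * dist r s)"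
    using lipschitz_onD[OF u(1) rs] lipschitz_onD[OF v(1) rs] u(2)[OF rs(2)] v(2)[OF rs(1)] B
    by (intro add_mono mult_mono) (auto simp: dist_norm intro: order_trans[OF norm_ge_zero])
  finally show "dist (u r \<bullet> v r) (u s \<bullet> v s) \<le> (C * B' + B * C') * dist r s"
    by (simp add: dist_real_def algebra_simps)
qed (use lipschitz_on_nonneg[OF u(1)] lipschitz_on_nonneg[OF v(1)] B in auto)

context adjoint_trajectory
begin

definition increment :: "real^'m \<Rightarrow> real \<Rightarrow> real" where
  "increment a s = rhs Hm x s a - rhs Hm x s (\<alpha> s)"

lemma increment_integrable:
  assumes a: "a \<in> A"
  shows "increment a absolutely_integrable_on {t..T}"
proof -
  obtain Cp where Cp: "Cp-lipschitz_on {t..T} p" using p by blast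
  have const: "(\<lambda>_. a) \<in> controls A t T" using a by (simp add: controls_def)
  have Hm_int: "(\<lambda>s. rhs Hm x s (\<beta> s)) absolutely_integrable_on {t..T}" if \<beta>: "\<beta> \<in> controls A t T" for \<beta>
  proof -
    note cx = solution_continuous[OF sol]
    have f: "(\<lambda>s. rhs f x s (\<beta> s)) absolutely_integrable_on {t..T}"
      by (rule rhs_f_integrable[OF cx t \<beta>]) auto
    have "(\<lambda>s. p s \<bullet> rhs f x s (\<beta> s)) absolutely_integrable_on {t..T}"
    proof (rule absolutely_integrable_bounded_measurable_product[where h = "(\<bullet>)", OF _ _ _ _ f])
      show "p \<in> borel_measurable (lebesgue_on {t..T})"
        by (rule continuous_imp_measurable_on_sets_lebesgue[OF lipschitz_on_continuous_on[OF Cp]]) simp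
      show "bilinear ((\<bullet>) :: real^'n \<Rightarrow> real^'n \<Rightarrow> real)"
        by (simp add: bilinear_conv_bounded_bilinear bounded_bilinear_inner)
      show "bounded (p ` {t..T})"
        by (rule compact_imp_bounded[OF compact_continuous_image[OF lipschitz_on_continuous_on[OF Cp]]]) simp
    qed simp
    then show ?thesis unfolding rhs_Hm
      by (intro set_integral_add(1) rhs_L_integrable[OF cx t \<beta>]) (auto simp: inner_commute)
  qed
  show ?thesis unfolding increment_def[abs_def]
    by (intro set_integral_diff(1) Hm_int \<alpha> const)
qed

end

section \<open>The exact integral identity for the remainder\<close>

context needle_variation
begin

lemma \<delta>_lipschitz: "\<exists>C. C-lipschitz_on {t - \<tau>b..T} (\<delta> n)"
proof -
  obtain C where "C-lipschitz_on {t - \<tau>b..T} x" "C-lipschitz_on {t - \<tau>b..T} (y n)"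
    using variation_bounds by blast
  then show ?thesis unfolding \<delta>_def[abs_def] by (blast intro: lipschitz_on_diff)
qed

lemma \<delta>_continuous: "continuous_on {t - \<tau>b..T} (\<delta> n)"
  using \<delta>_lipschitz lipschitz_on_continuous_on by blast

text \<open>The gradient is a limit of difference quotients, which is how it inherits measurability from \<open>f\<close> and \<open>L\<close>.\<close>
lemma Gy_\<delta>_integrable: "(\<lambda>s. Gy s \<bullet> \<delta> n (D s)) absolutely_integrable_on {t..T}"
proof -
  obtain R K where bd: "R > 0" "K \<ge> 0" "\<And>s. s \<in> {t - \<tau>b..T} \<Longrightarrow> norm (x s) \<le> R"
    "\<And>s n. s \<in> {t - \<tau>b..T} \<Longrightarrow> norm (\<delta> n s) \<le> K * e n"
    using variation_bounds by blast
  obtain l where l: "l > 0" "\<And>s a z y v. \<lbrakk>s \<in> {t..T}; a \<in> A; z \<in> cball 0 R; y \<in> cball 0 R\<rbrakk> \<Longrightarrow>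
      \<bar>Hz s z y a \<bullet> v\<bar> \<le> l * norm v \<and> \<bar>Hy s z y a \<bullet> v\<bar> \<le> l * norm v"
    using Hm_gradient_bound[OF bd(1)] by blast
  define r where "r i = inverse (real (Suc i))" for i
  have r: "r i > 0" "r \<longlonglongrightarrow> 0" for i
    unfolding r_def using LIMSEQ_inverse_real_of_nat by auto
  let ?M = "lebesgue_on {t<..<T}"
  have cont: "continuous_on {t<..<T} (\<lambda>s. u (D s))" if "continuous_on {t - \<tau>b..T} u" for u :: "real \<Rightarrow> real^'n"
  proof (rule continuous_on_compose2[OF that])
    show "continuous_on {t<..<T} D"
      using D_lipschitz lipschitz_on_continuous_on continuous_on_subset greaterThanLessThan_subseteq_atLeastAtMost_iff
      by (metis order_refl)
    show "D ` {t<..<T} \<subseteq> {t - \<tau>b..T}"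
    proof (rule image_subsetI)
      fix s assume "s \<in> {t<..<T}"
      then show "D s \<in> {t - \<tau>b..T}" using D_le[of s] by auto
    qed
  qed
  have "continuous_on {t<..<T} x"
    using solution_continuous[OF sol] by (rule continuous_on_subset) (use max_delay_nonneg in auto)
  then have x_meas: "x \<in> borel_measurable ?M"
    by (rule continuous_imp_measurable_on_sets_lebesgue) simp
  have D_meas: "(\<lambda>s. u (D s)) \<in> borel_measurable ?M" if "continuous_on {t - \<tau>b..T} u" for u :: "real \<Rightarrow> real^'n"
    by (rule continuous_imp_measurable_on_sets_lebesgue[OF cont[OF that]]) simp
  obtain Cp where "Cp-lipschitz_on {t..T} p" using p by blast
  then have "continuous_on {t<..<T} p"
    by (rule continuous_on_subset[OF lipschitz_on_continuous_on]) auto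
  then have p_meas: "p \<in> borel_measurable ?M"
    by (rule continuous_imp_measurable_on_sets_lebesgue) simp
  have Hm_meas: "(\<lambda>s. Hm s (x s) (v s) (\<alpha> s)) \<in> borel_measurable ?M" if "v \<in> borel_measurable ?M" for v
  proof -
    have "(\<lambda>s. f s (x s) (v s) (\<alpha> s)) \<in> borel_measurable ?M" "(\<lambda>s. L s (x s) (v s) (\<alpha> s)) \<in> borel_measurable ?M"
      by (rule carath_measurable[OF f_cont _ _ x_meas that] carath_measurable[OF L_cont _ _ x_meas that];
          use t \<alpha> in \<open>auto simp: controls_def\<close>)+
    then show ?thesis unfolding Hm_def pre_hamiltonian_def
      by (intro borel_measurable_add borel_measurable_inner p_meas)
  qed
  have meas: "(\<lambda>s. Gy s \<bullet> \<delta> n (D s)) \<in> borel_measurable ?M"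
  proof (rule borel_measurable_LIMSEQ_metric)
    fix i
    show "(\<lambda>s. (Hm s (x s) (x (D s) + r i *\<^sub>R \<delta> n (D s)) (\<alpha> s) - Hm s (x s) (x (D s)) (\<alpha> s)) /\<^sub>R r i) \<in> borel_measurable ?M"
      using D_meas[OF solution_continuous[OF sol]] D_meas[OF \<delta>_continuous]
      by (intro borel_measurable_scaleR borel_measurable_const borel_measurable_diff Hm_meas borel_measurable_add)
  next
    fix s assume "s \<in> space ?M"
    then have s: "s \<in> {t..T}" "\<alpha> s \<in> A" using \<alpha> by (auto simp: controls_def)
    have "norm ((0, r i *\<^sub>R \<delta> n (D s)) :: (real^'n) \<times> (real^'n)) \<le> norm (\<delta> n (D s)) * r i" for i
      using r(1)[of i] by (simp add: norm_Pair mult.commute)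
    from has_derivative_seq[OF Hm_has_derivative[OF s, of "x s" "x (D s)"] this r]
    have "(\<lambda>i. (Hm s (x s) (x (D s) + r i *\<^sub>R \<delta> n (D s)) (\<alpha> s) - Hm s (x s) (x (D s)) (\<alpha> s)
        - r i * (Gy s \<bullet> \<delta> n (D s))) /\<^sub>R r i) \<longlonglongrightarrow> 0"
      by (simp add: Gy_def)
    moreover have "(c - r i * d) /\<^sub>R r i = c /\<^sub>R r i - d" for c d i
      using r(1)[of i] by (simp add: right_diff_distrib)
    ultimately show "(\<lambda>i. (Hm s (x s) (x (D s) + r i *\<^sub>R \<delta> n (D s)) (\<alpha> s) - Hm s (x s) (x (D s)) (\<alpha> s)) /\<^sub>R r i)
        \<longlonglongrightarrow> Gy s \<bullet> \<delta> n (D s)"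
      by (simp only: LIM_zero_iff)
  qed
  show ?thesis
  proof (rule bounded_measurable_absolutely_integrable[OF meas])
    fix s assume s: "s \<in> {t<..<T}"
    have xs: "x s \<in> cball 0 R" using bd(3)[of s] s max_delay_nonneg by auto
    have Ds: "D s \<in> {t - \<tau>b..T}" using D_le[of s] s by auto
    have "norm (Gy s \<bullet> \<delta> n (D s)) \<le> l * norm (\<delta> n (D s))"
      unfolding Gy_def using l(2)[of s "\<alpha> s" "x s" "x (D s)"] s \<alpha> xs bd(3)[OF Ds] by (auto simp: controls_def)
    also have "\<dots> \<le> l * (K * e n)" using l(1) bd(4)[OF Ds] by (intro mult_left_mono) auto
    finally show "norm (Gy s \<bullet> \<delta> n (D s)) \<le> l * (K * e n)" .
  qed auto
qed

text \<open>The substitution produces an integral over {D t..D T}, the adjoint equation one over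
  {t..T}. They agree: before t the variation is zero, and after \<open>D T\<close> the indicator
  is.\<close>

lemma advanced_term_integral:
  "((\<lambda>s. (indicator {t..D T} s * deriv \<gamma> s) * (Gy (\<gamma> s) \<bullet> \<delta> n s)) has_integral
     integral {t..T} (\<lambda>s. Gy s \<bullet> \<delta> n (D s))) {t..T}"
proof -
  let ?h = "\<lambda>s. (indicator {t..D T} s * deriv \<gamma> s) * (Gy (\<gamma> s) \<bullet> \<delta> n s)"
  let ?k = "\<lambda>r. deriv \<gamma> r * (Gy (\<gamma> r) \<bullet> \<delta> n (D (\<gamma> r)))"
  have DtT: "D t \<in> {t - \<tau>b..t}" "D T \<le> T" using D_le[of t] D_le[of T] t_less by auto
  have "(if r \<in> {D t..D T} then ?k r else 0) = (if r \<in> {t..T} then ?h r else 0)" for r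
  proof (cases "r \<in> {D t..D T}")
    case True
    then have k: "?k r = deriv \<gamma> r * (Gy (\<gamma> r) \<bullet> \<delta> n r)" by (simp add: D_\<gamma>)
    show ?thesis
    proof (cases "t \<le> r")
      case True
      then show ?thesis using \<open>r \<in> {D t..D T}\<close> DtT k by simp
    next
      case False
      then have "\<delta> n r = 0" using \<open>r \<in> {D t..D T}\<close> DtT by (intro \<delta>_initial) auto
      then show ?thesis using k False by simp
    qed
  next
    case False
    then show ?thesis using DtT by auto
  qed
  moreover have "((\<lambda>r. if r \<in> {D t..D T} then ?k r else 0) has_integral integral {t..T} (\<lambda>s. Gy s \<bullet> \<delta> n (D s))) UNIV"
    using change_of_variables_delay[OF Gy_\<delta>_integrable, of n] by (simp only: has_integral_restrict_UNIV)
  ultimately have "((\<lambda>r. if r \<in> {t..T} then ?h r else 0) has_integral integral {t..T} (\<lambda>s. Gy s \<bullet> \<delta> n (D s))) UNIV"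
    by (simp only:)
  then show ?thesis by (simp only: has_integral_restrict_UNIV)
qed

text \<open>This is the shift by T. If the maximal delay exceeds the horizon, the window {T -
  \<tau>b..T} begins before t, but there \<open>\<delta> n\<close> is zero.\<close>

lemma terminal_gradient_integral:
  assumes meas: "gw \<in> borel_measurable (lebesgue_on {-\<tau>b..0})"
    and bound: "AE \<theta> in lebesgue_on {-\<tau>b..0}. norm (gw \<theta>) \<le> M"
  shows "((\<lambda>s. indicator {T - \<tau>b..T} s * (gw (s - T) \<bullet> \<delta> n s)) has_integral
     (LINT \<theta>|lebesgue_on {-\<tau>b..0}. gw \<theta> \<bullet> segment (\<delta> n) T \<theta>)) {t..T}"
proof -
  let ?M = "lebesgue_on {-\<tau>b..0}"
  let ?I = "LINT \<theta>|lebesgue_on {-\<tau>b..0}. gw \<theta> \<bullet> segment (\<delta> n) T \<theta>"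
  have cont: "continuous_on {-\<tau>b..0} (segment (\<delta> n) T)"
    unfolding segment_def
    by (rule continuous_on_compose2[OF \<delta>_continuous]) (use t_less in \<open>auto intro!: continuous_intros\<close>)
  then have "segment (\<delta> n) T \<in> borel_measurable ?M"
    by (rule continuous_imp_measurable_on_sets_lebesgue) simp
  with meas have meas': "(\<lambda>\<theta>. gw \<theta> \<bullet> segment (\<delta> n) T \<theta>) \<in> borel_measurable ?M"
    by (rule borel_measurable_inner)
  have "compact (segment (\<delta> n) T ` {-\<tau>b..0})" using cont by (rule compact_continuous_image) simp
  then obtain B where B: "\<forall>v\<in>segment (\<delta> n) T ` {-\<tau>b..0}. norm v \<le> B" using compact_imp_bounded bounded_iff by metis
  have "AE \<theta> in ?M. norm (gw \<theta> \<bullet> segment (\<delta> n) T \<theta>) \<le> \<bar>M\<bar> * \<bar>B\<bar>"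
    using bound
  proof (rule lebesgue_on_mono)
    fix \<theta> assume \<theta>: "norm (gw \<theta>) \<le> M" "\<theta> \<in> {-\<tau>b..0}"
    have "norm (gw \<theta> \<bullet> segment (\<delta> n) T \<theta>) \<le> norm (gw \<theta>) * norm (segment (\<delta> n) T \<theta>)"
      using Cauchy_Schwarz_ineq2 by simp
    also have "\<dots> \<le> \<bar>M\<bar> * \<bar>B\<bar>" using \<theta> B by (intro mult_mono) force+
    finally show "norm (gw \<theta> \<bullet> segment (\<delta> n) T \<theta>) \<le> \<bar>M\<bar> * \<bar>B\<bar>" .
  qed
  moreover have "finite_measure ?M" by (rule finite_measure_lebesgue_on) simp
  ultimately have "integrable ?M (\<lambda>\<theta>. gw \<theta> \<bullet> segment (\<delta> n) T \<theta>)"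
    using meas' by (intro finite_measure.integrable_const_bound)
  then have "((\<lambda>\<theta>. gw \<theta> \<bullet> segment (\<delta> n) T \<theta>) has_integral ?I) {-\<tau>b..0}"
    by (rule has_integral_integral_lebesgue_on) simp
  then have "((\<lambda>s. gw (s - T) \<bullet> \<delta> n s) has_integral ?I) {-\<tau>b + T..0 + T}"
    unfolding has_integral_shift_Icc_real[symmetric] by (simp add: o_def segment_def)
  then have "((\<lambda>s. gw (s - T) \<bullet> \<delta> n s) has_integral ?I) {T - \<tau>b..T}" by simp
  then have "((\<lambda>s. if s \<in> {T - \<tau>b..T} then gw (s - T) \<bullet> \<delta> n s else 0) has_integral ?I) UNIV"
    by (simp only: has_integral_restrict_UNIV)
  moreover have "(if s \<in> {T - \<tau>b..T} then gw (s - T) \<bullet> \<delta> n s else 0) =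
      (if s \<in> {t..T} then indicator {T - \<tau>b..T} s * (gw (s - T) \<bullet> \<delta> n s) else 0)" for s
  proof (cases "t \<le> s")
    case False
    then have "s \<in> {T - \<tau>b..T} \<Longrightarrow> \<delta> n s = 0" using t_less by (intro \<delta>_initial) auto
    then show ?thesis using False by auto
  qed auto
  ultimately have "((\<lambda>s. if s \<in> {t..T} then indicator {T - \<tau>b..T} s * (gw (s - T) \<bullet> \<delta> n s) else 0) has_integral ?I) UNIV"
    by (simp only:)
  then show ?thesis by (simp only: has_integral_restrict_UNIV)
qed

text \<open>Integrate the derivative of the product of \<open>p\<close> and
  \<open>\<delta> n\<close>, insert the adjoint equation tested with \<open>\<delta> n\<close>, and
  add the difference of the running costs. No limit is involved. Integrability of the remainder is
  part of the conclusion, since off a null set it is a sum of integrable functions.\<close>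

lemma remainder_has_integral:
  assumes p': "AE s in lebesgue_on {t<..<T}. (p has_vector_derivative p' s) (at s)"
    and adjoint: "AE s in lebesgue_on {t<..<T}. \<forall>v. p' s \<bullet> v = adjoint_form gw s v"
    and gw: "gw \<in> borel_measurable (lebesgue_on {-\<tau>b..0})" "AE \<theta> in lebesgue_on {-\<tau>b..0}. norm (gw \<theta>) \<le> M"
  shows "(remainder n has_integral
      p T \<bullet> \<delta> n T + (integral {t..T} (\<lambda>s. rhs L (y n) s (\<beta> n s)) - integral {t..T} (\<lambda>s. rhs L x s (\<alpha> s)))
      + (LINT \<theta>|lebesgue_on {-\<tau>b..0}. gw \<theta> \<bullet> segment (\<delta> n) T \<theta>) - integral {s0 - e n..s0} (increment a)) {t..T}"
    (is "(_ has_integral ?V) _")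
proof -
  define \<delta>' where "\<delta>' s = rhs f (y n) s (\<beta> n s) - rhs f x s (\<alpha> s)" for s
  have \<delta>': "AE s in lebesgue_on {t<..<T}. (\<delta> n has_vector_derivative \<delta>' s) (at s)"
  proof -
    have "AE s in lebesgue_on {t<..<T}. (y n has_vector_derivative rhs f (y n) s (\<beta> n s)) (at s)"
      "AE s in lebesgue_on {t<..<T}. (x has_vector_derivative rhs f x s (\<alpha> s)) (at s)"
      using y_solution[of n] sol by (auto simp: is_solution_def rhs_def)
    then show ?thesis unfolding \<delta>_def[abs_def] \<delta>'_def
      by eventually_elim (rule has_vector_derivative_diff)
  qed
  have "((\<lambda>s. p s \<bullet> \<delta>' s + p' s \<bullet> \<delta> n s) has_integral p T \<bullet> \<delta> n T - p t \<bullet> \<delta> n t) {t..T}"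
  proof -
    obtain Cp where Cp: "Cp-lipschitz_on {t..T} p" using p by blast
    obtain P where P: "P > 0" "\<And>s. s \<in> {t..T} \<Longrightarrow> norm (p s) \<le> P" using p_bounded by blast
    obtain C where C: "C-lipschitz_on {t - \<tau>b..T} (\<delta> n)" using \<delta>_lipschitz by blast
    have C': "C-lipschitz_on {t..T} (\<delta> n)" by (rule lipschitz_on_subset[OF C]) (use max_delay_nonneg in auto)
    obtain K where K: "K \<ge> 0" "\<And>s n. s \<in> {t - \<tau>b..T} \<Longrightarrow> norm (\<delta> n s) \<le> K * e n"
      using variation_bounds by blast
    have "(Cp * (K * e n) + P * C)-lipschitz_on {t..T} (\<lambda>s. p s \<bullet> \<delta> n s)"
      using P K(2) K(1) e_pos[of n] max_delay_nonneg by (intro lipschitz_on_inner[OF Cp _ C']) auto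
    moreover have "AE s in lebesgue_on {t<..<T}.
        ((\<lambda>s. p s \<bullet> \<delta> n s) has_vector_derivative p s \<bullet> \<delta>' s + p' s \<bullet> \<delta> n s) (at s)"
      using p' \<delta>' by eventually_elim (rule bounded_bilinear.has_vector_derivative[OF bounded_bilinear_inner])
    ultimately show ?thesis
      using t_less by (intro lipschitz_has_integral_vector_derivative[where F = "\<lambda>s. p s \<bullet> \<delta> n s"]) auto
  qed
  moreover have "\<delta> n t = 0" using max_delay_nonneg by (intro \<delta>_initial) simp
  ultimately have 1: "((\<lambda>s. p s \<bullet> \<delta>' s + p' s \<bullet> \<delta> n s) has_integral p T \<bullet> \<delta> n T) {t..T}" by simp
  have L_int: "((\<lambda>s. rhs L u s (b s)) has_integral integral {t..T} (\<lambda>s. rhs L u s (b s))) {t..T}"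
    if "solves t w b u" "b \<in> controls A t T" for u b
    using rhs_L_integrable[OF solution_continuous[OF that(1)] t that(2), of t T]
    by (intro integrable_integral) (simp add: set_lebesgue_integral_eq_integral(1))
  have 2: "((\<lambda>s. if s \<in> {s0 - e n..s0} then increment a s else 0) has_integral integral {s0 - e n..s0} (increment a)) {t..T}"
  proof -
    have sub: "{s0 - e n..s0} \<subseteq> {t..T}" using e_less[of n] s0 by auto
    have "increment a integrable_on {s0 - e n..s0}"
      using increment_integrable[OF a] integrable_on_subinterval[OF _ sub] set_lebesgue_integral_eq_integral(1) by blast
    then show ?thesis
      by (simp only: has_integral_restrict[OF sub] integrable_integral)
  qed
  have 3: "((\<lambda>s. Gy s \<bullet> \<delta> n (D s)) has_integral integral {t..T} (\<lambda>s. Gy s \<bullet> \<delta> n (D s))) {t..T}"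
    using Gy_\<delta>_integrable by (intro integrable_integral) (simp add: set_lebesgue_integral_eq_integral(1))
  \<comment> \<open>The terminal and the advanced term are added back to cancel their counterparts
    in the adjoint form, and \<open>Gy s \<bullet> \<delta> n (D s)\<close> completes the
    linearisation. The integrals of the delayed and the advanced term cancel each other.\<close>
  let ?total = "\<lambda>s. p s \<bullet> \<delta>' s + p' s \<bullet> \<delta> n s + (rhs L (y n) s (\<beta> n s) - rhs L x s (\<alpha> s))
      + indicator {T - \<tau>b..T} s * (gw (s - T) \<bullet> \<delta> n s)
      - (if s \<in> {s0 - e n..s0} then increment a s else 0)
      - Gy s \<bullet> \<delta> n (D s) + (indicator {t..D T} s * deriv \<gamma> s) * (Gy (\<gamma> s) \<bullet> \<delta> n s)"
  have total: "(?total has_integral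
      ?V
      - integral {t..T} (\<lambda>s. Gy s \<bullet> \<delta> n (D s)) + integral {t..T} (\<lambda>s. Gy s \<bullet> \<delta> n (D s))) {t..T}"
    by (intro has_integral_add has_integral_diff 1 2 3 L_int y_solution \<beta>_controls sol \<alpha>
        advanced_term_integral terminal_gradient_integral[OF gw])
  define N where "N = {s \<in> {t<..<T}. \<not> (\<forall>v. p' s \<bullet> v = adjoint_form gw s v)} \<union> {t, T}"
  have "negligible N"
    using adjoint by (simp add: N_def AE_lebesgue_on_iff_negligible)
  moreover have "remainder n s = ?total s" if s: "s \<in> {t..T} - N" for s
  proof -
    have "p' s \<bullet> \<delta> n s = adjoint_form gw s (\<delta> n s)"
      using s by (auto simp: N_def)
    moreover have "p s \<bullet> \<delta>' s + (rhs L (y n) s (\<beta> n s) - rhs L x s (\<alpha> s)) = rhs Hm (y n) s (\<beta> n s) - rhs Hm x s (\<alpha> s)"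
      by (simp add: rhs_Hm \<delta>'_def inner_diff_right inner_commute)
    \<comment> \<open>The needle enters here: changing the control along the unperturbed
      \<open>x\<close> costs exactly the increment of the pre-Hamiltonian, and only on the
      needle.\<close>
    moreover have "rhs Hm x s (\<alpha> s) + (if s \<in> {s0 - e n..s0} then increment a s else 0) = rhs Hm x s (\<beta> n s)"
    proof (cases "s \<in> {s0 - e n..s0}")
      case True
      then have "\<beta> n s = a" unfolding \<beta>_def by (rule if_P)
      with True show ?thesis by (simp add: increment_def)
    next
      case False
      with \<beta>_off[OF False] show ?thesis by (simp only: if_False add_0_right)
    qed
    ultimately show ?thesis unfolding remainder_def adjoint_form_def by linarith
  qed
  ultimately have "(remainder n has_integral
      ?V
      - integral {t..T} (\<lambda>s. Gy s \<bullet> \<delta> n (D s)) + integral {t..T} (\<lambda>s. Gy s \<bullet> \<delta> n (D s))) {t..T}"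
    using total by (rule has_integral_spike)
  then show ?thesis by simp
qed

lemma integral_remainder_limit:
  assumes "\<And>n. remainder n integrable_on {t..T}"
  shows "(\<lambda>n. integral {t..T} (remainder n) / e n) \<longlonglongrightarrow> 0"
proof -
  obtain C where C: "\<And>n s. \<lbrakk>s \<in> {t<..<T}; regular_time s\<rbrakk> \<Longrightarrow> \<bar>remainder n s\<bar> \<le> C * e n"
    using remainder_bound by blast
  define N where "N = {s \<in> {t<..<T}. \<not> regular_time s} \<union> {t, T}"
  have neg: "negligible N" using AE_regular_time by (simp add: N_def AE_lebesgue_on_iff_negligible)
  have spike: "(h has_integral i) ({t..T} - N) \<longleftrightarrow> (h has_integral i) {t..T}" for h :: "real \<Rightarrow> real" and i
    by (rule has_integral_spike_set_eq; rule negligible_subset[OF neg]) auto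
  have int_eq: "integral ({t..T} - N) h = integral {t..T} h" for h :: "real \<Rightarrow> real"
    by (rule integral_spike_set; rule negligible_subset[OF neg]) auto
  have "(\<lambda>n. integral ({t..T} - N) (\<lambda>s. remainder n s / e n)) \<longlonglongrightarrow> integral ({t..T} - N) (\<lambda>_. 0)"
  proof (rule dominated_convergence(2)[where h = "\<lambda>_. C"])
    show "(\<lambda>s. remainder n s / e n) integrable_on {t..T} - N" for n
      using assms[of n] spike unfolding integrable_on_def by (metis has_integral_divide)
    have "(\<lambda>_. C) integrable_on {t..T}" by (simp add: integrable_on_const)
    then show "(\<lambda>_. C) integrable_on {t..T} - N" using spike unfolding integrable_on_def by blast
    fix s assume "s \<in> {t..T} - N"
    then have s: "s \<in> {t<..<T}" "regular_time s" by (auto simp: N_def)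
    show "norm (remainder n s / e n) \<le> C" for n
      using C[OF s, of n] e_pos[of n] by (simp add: pos_divide_le_eq)
    show "(\<lambda>n. remainder n s / e n) \<longlonglongrightarrow> 0" by (rule remainder_limit[OF s])
  qed
  then show ?thesis by (simp add: int_eq)
qed

text \<open>The variation has sup norm of order \<open>e n\<close>, so its \<open>state_norm\<close>
  is at most \<open>(1 + \<tau>b) * K * e n\<close>. An error that is small compared with the state
  norm is therefore small compared with \<open>e n\<close>.\<close>

lemma terminal_increment_limit:
  assumes g: "has_state_derivative g gz gw \<tau>b (x T) (segment x T)"
  shows "(\<lambda>n. (g (y n T, segment (y n) T) - g (x T, segment x T)
      - (gz \<bullet> \<delta> n T + (LINT \<theta>|lebesgue_on {-\<tau>b..0}. gw \<theta> \<bullet> segment (\<delta> n) T \<theta>))) / e n) \<longlonglongrightarrow> 0"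
    (is "(\<lambda>n. ?r n / e n) \<longlonglongrightarrow> 0")
proof (rule LIMSEQ_I)
  fix c :: real assume c: "c > 0"
  obtain K where K: "K \<ge> 0" "\<And>s n. s \<in> {t - \<tau>b..T} \<Longrightarrow> norm (\<delta> n s) \<le> K * e n"
    using variation_bounds by blast
  define B where "B = (1 + \<tau>b) * K"
  have B0: "B \<ge> 0" using K(1) max_delay_nonneg by (simp add: B_def)
  have space: "(\<delta> n T, segment (\<delta> n) T) \<in> state_space \<tau>b" for n
  proof -
    obtain C where "C-lipschitz_on {t - \<tau>b..T} (\<delta> n)" using \<delta>_lipschitz by blast
    then have "segment (\<delta> n) T \<in> Lip \<tau>b" using t_less by (intro segment_in_Lip) auto
    then show ?thesis by (simp add: state_space_def segment_def)
  qed
  have norm: "state_norm \<tau>b (\<delta> n T) (segment (\<delta> n) T) \<le> B * e n" for n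
  proof -
    have "state_norm \<tau>b (\<delta> n T) (segment (\<delta> n) T) \<le> (1 + \<tau>b) * (K * e n)"
    proof (rule state_norm_le)
      show "continuous_on {-\<tau>b..0} (segment (\<delta> n) T)"
        unfolding segment_def
        by (rule continuous_on_compose2[OF \<delta>_continuous]) (use t_less in \<open>auto intro!: continuous_intros\<close>)
    qed (use K(2) t_less max_delay_nonneg in \<open>auto simp: segment_def\<close>)
    then show ?thesis by (simp add: B_def mult.assoc)
  qed
  define q where "q = c / (2 * (B + 1))"
  have q: "q > 0" using c B0 by (simp add: q_def)
  have qB: "q * B < c"
  proof -
    have "q * (B + 1) = c / 2" using B0 by (simp add: q_def field_simps)
    then show ?thesis using q c by (simp add: distrib_left)
  qed
  obtain d where d: "d > 0" "\<And>dz dw. \<lbrakk>(dz, dw) \<in> state_space \<tau>b; state_norm \<tau>b dz dw < d\<rbrakk> \<Longrightarrow>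
      \<bar>g (x T + dz, \<lambda>\<theta>. segment x T \<theta> + dw \<theta>) - g (x T, segment x T)
        - (gz \<bullet> dz + (LINT \<theta>|lebesgue_on {-\<tau>b..0}. gw \<theta> \<bullet> dw \<theta>))\<bar> \<le> q * state_norm \<tau>b dz dw"
    using g q unfolding has_state_derivative_def by blast
  have "(\<lambda>n. B * e n) \<longlonglongrightarrow> 0" by (rule tendsto_mult_right_zero[OF e_lim])
  then obtain n0 where n0: "\<And>n. n \<ge> n0 \<Longrightarrow> norm (B * e n) < d" using LIMSEQ_D[of _ 0 d] d(1) by force
  have "norm (?r n / e n - 0) < c" if "n \<ge> n0" for n
  proof -
    have "state_norm \<tau>b (\<delta> n T) (segment (\<delta> n) T) < d" using norm[of n] n0[OF that] by simp
    from d(2)[OF space this]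
    have "\<bar>?r n\<bar> \<le> q * state_norm \<tau>b (\<delta> n T) (segment (\<delta> n) T)"
      by (simp add: \<delta>_def segment_def)
    also have "\<dots> \<le> q * (B * e n)" using q norm by (intro mult_left_mono) auto
    finally have "\<bar>?r n\<bar> / e n \<le> q * B" using e_pos[of n] by (simp add: pos_divide_le_eq mult.assoc)
    then show ?thesis using qB e_pos[of n] by (simp add: abs_divide)
  qed
  then show "\<exists>n0. \<forall>n\<ge>n0. norm (?r n / e n - 0) < c" by blast
qed

text \<open>The terminal condition appears as \<open>p T\<close> in the role of the z-derivative of
  \<open>g\<close>. Then the boundary term of the integral identity cancels against the expansion of
  the terminal cost, and what remains of the sum of the three limits is the change of cost divided
  by \<open>e n\<close>, nonnegative by optimality.\<close>

lemma increment_nonneg: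
  assumes x: "x = trajectory T f \<tau> \<tau>b t w \<alpha>"
    and optimal: "\<And>\<beta>. \<beta> \<in> controls A t T \<Longrightarrow> cost T f L g \<tau> \<tau>b t w \<alpha> \<le> cost T f L g \<tau> \<tau>b t w \<beta>"
    and p': "AE s in lebesgue_on {t<..<T}. (p has_vector_derivative p' s) (at s)"
    and adjoint: "AE s in lebesgue_on {t<..<T}. \<forall>v. p' s \<bullet> v = adjoint_form gw s v"
    and g: "has_state_derivative g (p T) gw \<tau>b (x T) (segment x T)"
    and lebesgue_point: "((\<lambda>u. integral {t..u} (increment a)) has_vector_derivative increment a s0) (at s0)"
  shows "increment a s0 \<ge> 0"
proof -
  define W where "W n = (LINT \<theta>|lebesgue_on {-\<tau>b..0}. gw \<theta> \<bullet> segment (\<delta> n) T \<theta>)" for n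
  define \<Delta>L where "\<Delta>L n = integral {t..T} (\<lambda>s. rhs L (y n) s (\<beta> n s)) - integral {t..T} (\<lambda>s. rhs L x s (\<alpha> s))" for n
  define \<Delta>g where "\<Delta>g n = g (y n T, segment (y n) T) - g (x T, segment x T)" for n
  obtain M where gw: "gw \<in> borel_measurable (lebesgue_on {-\<tau>b..0})" "AE \<theta> in lebesgue_on {-\<tau>b..0}. norm (gw \<theta>) \<le> M"
    using g by (auto simp: has_state_derivative_def)
  have rem: "(remainder n has_integral p T \<bullet> \<delta> n T + \<Delta>L n + W n - integral {s0 - e n..s0} (increment a)) {t..T}" for n
    unfolding \<Delta>L_def W_def by (rule remainder_has_integral[OF p' adjoint gw])
  then have "(\<lambda>n. integral {t..T} (remainder n) / e n) \<longlonglongrightarrow> 0"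
    by (intro integral_remainder_limit) blast
  then have 1: "(\<lambda>n. (p T \<bullet> \<delta> n T + \<Delta>L n + W n - integral {s0 - e n..s0} (increment a)) / e n) \<longlonglongrightarrow> 0"
    by (simp only: integral_unique[OF rem])
  have 2: "(\<lambda>n. (\<Delta>g n - (p T \<bullet> \<delta> n T + W n)) / e n) \<longlonglongrightarrow> 0"
    unfolding \<Delta>g_def W_def by (rule terminal_increment_limit[OF g])
  \<comment> \<open>The derivative at \<open>s0\<close> is evaluated along the negative steps
    \<open>- e n\<close>, as the needle lies to the left of \<open>s0\<close>.\<close>
  have 3: "(\<lambda>n. integral {s0 - e n..s0} (increment a) / e n) \<longlonglongrightarrow> increment a s0"
  proof -
    have "(\<lambda>n. - e n) \<longlonglongrightarrow> 0" using tendsto_minus[OF e_lim] by simp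
    moreover have "- e n \<noteq> 0" for n using e_pos[of n] by simp
    ultimately have "(\<lambda>n. (integral {t..s0 + - e n} (increment a) - integral {t..s0} (increment a)) /\<^sub>R (- e n)) \<longlonglongrightarrow> increment a s0"
      by (rule has_vector_derivative_sequence[OF lebesgue_point])
    moreover have "(integral {t..s0 + - e n} (increment a) - integral {t..s0} (increment a)) /\<^sub>R (- e n)
        = integral {s0 - e n..s0} (increment a) / e n" for n
    proof -
      have "increment a integrable_on {t..T}"
        using increment_integrable[OF a] set_lebesgue_integral_eq_integral(1) by blast
      then have "increment a integrable_on {t..s0}"
        by (rule integrable_on_subinterval) (use s0 in auto)
      then have "integral {t..s0 - e n} (increment a) + integral {s0 - e n..s0} (increment a) = integral {t..s0} (increment a)"
        using e_less[of n] e_pos[of n] by (intro Henstock_Kurzweil_Integration.integral_combine) auto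
      then have "integral {t..s0 + - e n} (increment a) - integral {t..s0} (increment a) = - integral {s0 - e n..s0} (increment a)"
        by simp
      then show ?thesis by (simp add: divide_inverse)
    qed
    ultimately show ?thesis by (simp only:)
  qed
  have "(\<lambda>n. (p T \<bullet> \<delta> n T + \<Delta>L n + W n - integral {s0 - e n..s0} (increment a)) / e n
      + (\<Delta>g n - (p T \<bullet> \<delta> n T + W n)) / e n + integral {s0 - e n..s0} (increment a) / e n) \<longlonglongrightarrow> 0 + 0 + increment a s0"
    by (intro tendsto_add 1 2 3)
  moreover have "(p T \<bullet> \<delta> n T + \<Delta>L n + W n - integral {s0 - e n..s0} (increment a)) / e n
      + (\<Delta>g n - (p T \<bullet> \<delta> n T + W n)) / e n + integral {s0 - e n..s0} (increment a) / e n = (\<Delta>L n + \<Delta>g n) / e n" for n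
    by (simp flip: add_divide_distrib)
  ultimately have "(\<lambda>n. (\<Delta>L n + \<Delta>g n) / e n) \<longlonglongrightarrow> increment a s0" by simp
  moreover have "0 \<le> (\<Delta>L n + \<Delta>g n) / e n" for n
  proof -
    have "cost T f L g \<tau> \<tau>b t w (\<beta> n) - cost T f L g \<tau> \<tau>b t w \<alpha> = \<Delta>L n + \<Delta>g n"
      unfolding cost_eq[OF t w \<alpha> x] cost_eq[OF t w \<beta>_controls y_def] \<Delta>L_def \<Delta>g_def by simp
    then show ?thesis using optimal[OF \<beta>_controls[of n]] e_pos[of n] by simp
  qed
  ultimately show ?thesis by (intro LIMSEQ_le_const) auto
qed

end

section \<open>The minimum principle\<close>

context adjoint_trajectory
begin

lemma minimum_principle_at:
  assumes x: "x = trajectory T f \<tau> \<tau>b t w \<alpha>" and optimal: "optimal_control T A f L g \<tau> \<tau>b t w \<alpha>"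
    and p': "AE s in lebesgue_on {t<..<T}. (p has_vector_derivative p' s) (at s)"
    and adjoint: "AE s in lebesgue_on {t<..<T}. \<forall>v. p' s \<bullet> v = adjoint_form gw s v"
    and g: "has_state_derivative g (p T) gw \<tau>b (x T) (segment x T)"
    and a: "a \<in> A"
  shows "AE s in lebesgue_on {t<..<T}. rhs Hm x s (\<alpha> s) \<le> rhs Hm x s a"
proof -
  have "increment a integrable_on {t..T}"
    using increment_integrable[OF a] set_lebesgue_integral_eq_integral(1) by blast
  from indefinite_integral_has_vector_derivative_AE[OF this] show ?thesis
  proof (rule lebesgue_on_mono)
    fix s assume s: "s \<in> {t<..<T}"
      and lebesgue_point: "((\<lambda>u. integral {t..u} (increment a)) has_vector_derivative increment a s) (at s)"
    interpret needle_variation t0 T A f L g \<tau> \<tau>b f\<^sub>z f\<^sub>y L\<^sub>z L\<^sub>y \<tau>\<^sub>t \<tau>\<^sub>z t w \<alpha> x D p s a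
      by unfold_locales (use s a in auto)
    have "0 \<le> increment a s"
      by (rule increment_nonneg[OF x optimal_control_le[OF t w optimal] p' adjoint g lebesgue_point])
    then show "rhs Hm x s (\<alpha> s) \<le> rhs Hm x s a" by (simp add: increment_def)
  qed
qed

lemma Hm_continuous_control:
  assumes "s \<in> {t..T}"
  shows "continuous_on A (\<lambda>a. Hm s z y a)"
proof -
  have "continuous_on A (\<lambda>a. (\<lambda>(t, z, y, a). f t z y a) (s, z, y, a))"
    by (rule continuous_on_compose2[OF f_cont]) (use assms t in \<open>auto intro!: continuous_intros\<close>)
  moreover have "continuous_on A (\<lambda>a. (\<lambda>(t, z, y, a). L t z y a) (s, z, y, a))"
    by (rule continuous_on_compose2[OF L_cont]) (use assms t in \<open>auto intro!: continuous_intros\<close>)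
  ultimately show ?thesis unfolding Hm_def pre_hamiltonian_def by (auto intro!: continuous_intros)
qed

text \<open>The exceptional set of \<open>minimum_principle_at\<close> depends on a, as the Lebesgue
  points do. Countably many null sets are discarded together, and continuity of the pre-Hamiltonian
  in the control extends the inequality from the dense set to \<open>A\<close>.\<close>

lemma minimum_principle:
  assumes "x = trajectory T f \<tau> \<tau>b t w \<alpha>" "optimal_control T A f L g \<tau> \<tau>b t w \<alpha>"
    and "AE s in lebesgue_on {t<..<T}. (p has_vector_derivative p' s) (at s)"
    and "AE s in lebesgue_on {t<..<T}. \<forall>v. p' s \<bullet> v = adjoint_form gw s v"
    and "has_state_derivative g (p T) gw \<tau>b (x T) (segment x T)"
  shows "AE s in lebesgue_on {t<..<T}. is_arg_min (pre_hamiltonian f L s (x s) (x (D s)) (p s)) (\<lambda>a. a \<in> A) (\<alpha> s)"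
proof -
  obtain A0 where A0: "countable A0" "A0 \<subseteq> A" "A \<subseteq> closure A0" using separable by blast
  have "AE s in lebesgue_on {t<..<T}. \<forall>a\<in>A0. rhs Hm x s (\<alpha> s) \<le> rhs Hm x s a"
    by (subst AE_ball_countable[OF A0(1)]) (use minimum_principle_at[OF assms] A0(2) in blast)
  then show ?thesis
  proof (rule lebesgue_on_mono)
    fix s assume le: "\<forall>a\<in>A0. rhs Hm x s (\<alpha> s) \<le> rhs Hm x s a" and s: "s \<in> {t<..<T}"
    have "rhs Hm x s (\<alpha> s) \<le> rhs Hm x s a" if a: "a \<in> A" for a
    proof -
      obtain b where b: "\<And>n. b n \<in> A0" "b \<longlonglongrightarrow> a" using A0(3) a closure_sequential by blast
      have "continuous_on A (\<lambda>a. rhs Hm x s a)"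
        unfolding rhs_def by (rule Hm_continuous_control) (use s in simp)
      then have "(\<lambda>n. rhs Hm x s (b n)) \<longlonglongrightarrow> rhs Hm x s a"
        by (rule continuous_on_tendsto_compose[OF _ b(2) a]) (use b(1) A0(2) in \<open>auto intro!: always_eventually\<close>)
      then show ?thesis by (rule LIMSEQ_le_const) (use le b(1) in auto)
    qed
    moreover have "\<alpha> s \<in> A" using s \<alpha> by (simp add: controls_def)
    moreover have "rhs Hm x s a = pre_hamiltonian f L s (x s) (x (D s)) (p s) a" for a
      by (simp add: rhs_def Hm_def D)
    ultimately show "is_arg_min (pre_hamiltonian f L s (x s) (x (D s)) (p s)) (\<lambda>a. a \<in> A) (\<alpha> s)"
      by (auto simp: is_arg_min_def not_less)
  qed
qed

end

theorem theorem5p2: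
  fixes t0 T t_star \<tau>b :: real
    and A :: "(real^'m) set"
    and f :: "real \<Rightarrow> real^'n \<Rightarrow> real^'n \<Rightarrow> real^'m \<Rightarrow> real^'n"
    and L :: "real \<Rightarrow> real^'n \<Rightarrow> real^'n \<Rightarrow> real^'m \<Rightarrow> real"
    and g :: "(real^'n) \<times> (real \<Rightarrow> real^'n) \<Rightarrow> real"
    and \<tau> :: "real \<Rightarrow> real^'n \<Rightarrow> real"
    and f\<^sub>z f\<^sub>y :: "real \<Rightarrow> real^'n \<Rightarrow> real^'n \<Rightarrow> real^'m \<Rightarrow> real^'n^'n"
    and L\<^sub>z L\<^sub>y :: "real \<Rightarrow> real^'n \<Rightarrow> real^'n \<Rightarrow> real^'m \<Rightarrow> real^'n"
    and \<tau>\<^sub>t :: "real \<Rightarrow> real^'n \<Rightarrow> real"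
    and \<tau>\<^sub>z :: "real \<Rightarrow> real^'n \<Rightarrow> real^'n"
    and w_star x p g\<^sub>w :: "real \<Rightarrow> real^'n"
    and g\<^sub>z :: "real^'n"
    and \<alpha> :: "real \<Rightarrow> real^'m"
    and D \<gamma> :: "real \<Rightarrow> real"
  assumes problem: "delay_control_problem t0 T A f L g \<tau> \<tau>b f\<^sub>z f\<^sub>y L\<^sub>z L\<^sub>y \<tau>\<^sub>t \<tau>\<^sub>z"
    and t_star: "t_star \<in> {t0..T}"
    and w_star: "w_star \<in> Lip \<tau>b"
    and optimal: "optimal_control T A f L g \<tau> \<tau>b t_star w_star \<alpha>"
    and x: "x = trajectory T f \<tau> \<tau>b t_star w_star \<alpha>"
    and g_diff: "has_state_derivative g g\<^sub>z g\<^sub>w \<tau>b (x T) (segment x T)"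
    and D: "D = (\<lambda>s. s - \<tau> s (x s))"
    and \<gamma>: "\<gamma> = the_inv_into {t_star..T} D"
    and p_lip: "\<exists>C. C-lipschitz_on {t_star..T} p"
    and adjoint: "AE s in lebesgue_on {t_star<..<T}. (p has_vector_derivative
        (- (transpose (f\<^sub>z s (x s) (x (D s)) (\<alpha> s)) *v p s) - L\<^sub>z s (x s) (x (D s)) (\<alpha> s)
         + (vector_derivative x (at (D s)) \<bullet> (transpose (f\<^sub>y s (x s) (x (D s)) (\<alpha> s)) *v p s))
             *\<^sub>R \<tau>\<^sub>z s (x s)
         + (vector_derivative x (at (D s)) \<bullet> L\<^sub>y s (x s) (x (D s)) (\<alpha> s)) *\<^sub>R \<tau>\<^sub>z s (x s)
         - (indicator {t_star..D T} s * deriv \<gamma> s)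
             *\<^sub>R (transpose (f\<^sub>y (\<gamma> s) (x (\<gamma> s)) (x s) (\<alpha> (\<gamma> s))) *v p (\<gamma> s))
         - (indicator {t_star..D T} s * deriv \<gamma> s)
             *\<^sub>R L\<^sub>y (\<gamma> s) (x (\<gamma> s)) (x s) (\<alpha> (\<gamma> s))
         - indicator {T - \<tau>b..T} s *\<^sub>R g\<^sub>w (s - T))) (at s)"
    and terminal: "p T = g\<^sub>z"
  shows "AE t in lebesgue_on {t_star<..T}.
           is_arg_min (pre_hamiltonian f L t (x t) (x (D t)) (p t)) (\<lambda>a. a \<in> A) (\<alpha> t)"
proof (cases "t_star < T")
  case True
  have \<alpha>: "\<alpha> \<in> controls A t_star T" using optimal by (simp add: optimal_control_def)
  interpret delay_control_problem t0 T A f L g \<tau> \<tau>b f\<^sub>z f\<^sub>y L\<^sub>z L\<^sub>y \<tau>\<^sub>t \<tau>\<^sub>z by (rule problem)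
  interpret ct: adjoint_trajectory t0 T A f L g \<tau> \<tau>b f\<^sub>z f\<^sub>y L\<^sub>z L\<^sub>y \<tau>\<^sub>t \<tau>\<^sub>z t_star w_star \<alpha> x D p
    by unfold_locales
      (use t_star True w_star \<alpha> p_lip in \<open>auto simp: x D intro: trajectory_is_solution[OF t_star w_star \<alpha>]\<close>)
  have \<gamma>_eq: "\<gamma> = ct.\<gamma>" by (simp add: \<gamma> ct.\<gamma>_def)
  let ?p' = "\<lambda>s. - (transpose (f\<^sub>z s (x s) (x (D s)) (\<alpha> s)) *v p s) - L\<^sub>z s (x s) (x (D s)) (\<alpha> s)
         + (vector_derivative x (at (D s)) \<bullet> (transpose (f\<^sub>y s (x s) (x (D s)) (\<alpha> s)) *v p s))
             *\<^sub>R \<tau>\<^sub>z s (x s)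
         + (vector_derivative x (at (D s)) \<bullet> L\<^sub>y s (x s) (x (D s)) (\<alpha> s)) *\<^sub>R \<tau>\<^sub>z s (x s)
         - (indicator {t_star..D T} s * deriv \<gamma> s)
             *\<^sub>R (transpose (f\<^sub>y (\<gamma> s) (x (\<gamma> s)) (x s) (\<alpha> (\<gamma> s))) *v p (\<gamma> s))
         - (indicator {t_star..D T} s * deriv \<gamma> s)
             *\<^sub>R L\<^sub>y (\<gamma> s) (x (\<gamma> s)) (x s) (\<alpha> (\<gamma> s))
         - indicator {T - \<tau>b..T} s *\<^sub>R g\<^sub>w (s - T)"
  have split: "?p' s \<bullet> v = ct.adjoint_form g\<^sub>w s v"
    for s v
  proof -
    have "(indicator {t_star..D T} s * deriv ct.\<gamma> s) * (ct.Gy (ct.\<gamma> s) \<bullet> v)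
        = (indicator {t_star..D T} s * deriv \<gamma> s) *
            ((transpose (f\<^sub>y (\<gamma> s) (x (\<gamma> s)) (x s) (\<alpha> (\<gamma> s))) *v p (\<gamma> s) + L\<^sub>y (\<gamma> s) (x (\<gamma> s)) (x s) (\<alpha> (\<gamma> s))) \<bullet> v)"
    \<comment> \<open>In the adjoint equation the delayed state at time \<open>\<gamma> s\<close> is
      written \<open>x s\<close>, in \<open>ct.Gy\<close> it is \<open>x (D (\<gamma> s))\<close>.
      They agree where the indicator is 1, because \<open>\<gamma>\<close> inverts \<open>D\<close>
      there; elsewhere both sides are 0.\<close>
    proof (cases "s \<in> {t_star..D T}")
      case True
      then have "s \<in> {D t_star..D T}" using ct.D_le[of t_star] ct.t_less by auto
      then show ?thesis by (simp add: \<gamma>_eq ct.Gy_def ct.Hy_def ct.D_\<gamma>)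
    qed simp
    then show ?thesis
      by (simp add: ct.Gz_def ct.Gy_def ct.Hz_def ct.Hy_def ct.\<xi>_def ct.adjoint_form_def inner_add_left inner_diff_left
          inner_add_right algebra_simps)
  qed
  have "AE s in lebesgue_on {t_star<..<T}. is_arg_min (pre_hamiltonian f L s (x s) (x (D s)) (p s)) (\<lambda>a. a \<in> A) (\<alpha> s)"
    by (rule ct.minimum_principle[OF x optimal adjoint _ g_diff[folded terminal]]) (intro AE_I2 allI split)
  \<comment> \<open>The point T is added to pass from the open interval to the half-open
    one.\<close>
  then have neg: "negligible ({s \<in> {t_star<..<T}. \<not> is_arg_min (pre_hamiltonian f L s (x s) (x (D s)) (p s)) (\<lambda>a. a \<in> A) (\<alpha> s)} \<union> {T})"
    by (simp add: AE_lebesgue_on_iff_negligible)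
  show ?thesis
    by (subst AE_lebesgue_on_iff_negligible, simp, rule negligible_subset[OF neg]) auto
next
  case False
  then show ?thesis by (simp add: AE_lebesgue_on_iff_negligible)
qed

end
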